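(* Let $A \in \mathrm{ASM}(n)$, fix $j \in [n+1]$, and let $\widetilde{A}=\widetilde{A}(1,j)\in\mathrm{ASM}(n+1)$ be the matrix whose first row is the $j$-th standard unit row vector, whose $j$-th column is the first standard unit column vector, and such that deleting its first row and $j$-th column yields $A$ (i.e. $\widetilde A_{a,b}=A_{a-1,b}$ for $a>1,b<j$, $\widetilde A_{a,b}=A_{a-1,b-1}$ for $a>1,b>j$, $\widetilde A_{1,j}=1$, and all other entries in row $1$ or column $j$ are $0$). If $\widetilde{A}$ is Cohen--Macaulay, then $A$ is Cohen--Macaulay.
   Context: An alternating sign matrix (ASM) of size $n$ is an $n\times n$ matrix with entries in $\{-1,0,1\}$ such that each row and each column sums to $1$ and the nonzero entries in each row and each column alternate in sign; $\mathrm{ASM}(n)$ is the set of these. For $A\in\mathrm{ASM}(n)$, $\mathrm{rk}_A(i,j)=\sum_{a\le i}\sum_{b\le j}A_{a,b}$. Let $\kappa$ be a field, $Z=(z_{i,j})$ an $n\times n$ matrix of distinct indeterminates and $R=\kappa[z_{i,j}]$. The ASM ideal is $I_A=\sum_{i,j\in[n]} I_{\mathrm{rk}_A(i,j)+1}(Z_{[i],[j]})$, where $I_k(Z_{[i],[j]})$ is the ideal generated by the $k\times k$ minors of the submatrix of $Z$ on the first $i$ rows and first $j$ columns. The ASM $A$ is called Cohen--Macaulay if $R/I_A$ is a Cohen--Macaulay ring (for $\widetilde A$ one uses the analogous $(n+1)\times(n+1)$ generic matrix and polynomial ring). *)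

theory Defs
  imports
    "HOL-Library.Poly_Mapping"
    "HOL-Library.Extended_Nat"
    "HOL-Algebra.QuotRing"
    "HOL-Algebra.Ring_Divisibility"
    "Jordan_Normal_Form.Determinant"
    "Jordan_Normal_Form.DL_Submatrix"
begin

section \<open>Cohen--Macaulay rings\<close>

text \<open>The localization of \<open>R\<close> at a prime \<open>P\<close>: classes of pairs \<open>(a, s)\<close>, standing for \<open>a / s\<close>
  with \<open>s \<notin> P\<close>, where \<open>(a, s)\<close> and \<open>(b, t)\<close> are identified iff \<open>u (t a - s b) = 0\<close> for some
  \<open>u \<notin> P\<close>.\<close>

definition loc_rel :: "('a, 'm) ring_scheme \<Rightarrow> 'a set \<Rightarrow> (('a \<times> 'a) \<times> ('a \<times> 'a)) set" where
  "loc_rel R P = {((a, s), (b, t)) | a s b t.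
     a \<in> carrier R \<and> s \<in> carrier R - P \<and> b \<in> carrier R \<and> t \<in> carrier R - P \<and>
     (\<exists>u \<in> carrier R - P. u \<otimes>\<^bsub>R\<^esub> (t \<otimes>\<^bsub>R\<^esub> a \<ominus>\<^bsub>R\<^esub> s \<otimes>\<^bsub>R\<^esub> b) = \<zero>\<^bsub>R\<^esub>)}"

definition loc_frac :: "('a, 'm) ring_scheme \<Rightarrow> 'a set \<Rightarrow> 'a \<Rightarrow> 'a \<Rightarrow> ('a \<times> 'a) set" where
  "loc_frac R P a s = loc_rel R P `` {(a, s)}"

definition localization :: "('a, 'm) ring_scheme \<Rightarrow> 'a set \<Rightarrow> ('a \<times> 'a) set ring" where
  "localization R P =
    \<lparr>carrier = (carrier R \<times> (carrier R - P)) // loc_rel R P,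
     mult = (\<lambda>X Y. \<Union>(a, s) \<in> X. \<Union>(b, t) \<in> Y. loc_frac R P (a \<otimes>\<^bsub>R\<^esub> b) (s \<otimes>\<^bsub>R\<^esub> t)),
     one = loc_frac R P \<one>\<^bsub>R\<^esub> \<one>\<^bsub>R\<^esub>,
     zero = loc_frac R P \<zero>\<^bsub>R\<^esub> \<one>\<^bsub>R\<^esub>,
     add = (\<lambda>X Y. \<Union>(a, s) \<in> X. \<Union>(b, t) \<in> Y.
              loc_frac R P (t \<otimes>\<^bsub>R\<^esub> a \<oplus>\<^bsub>R\<^esub> s \<otimes>\<^bsub>R\<^esub> b) (s \<otimes>\<^bsub>R\<^esub> t))\<rparr>"

text \<open>The supremum of the lengths of strict chains of prime ideals. (The zero ring gets dimension 0
  here; only local rings, which are nonzero, matter below.)\<close>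

definition krull_dim :: "('a, 'm) ring_scheme \<Rightarrow> enat" where
  "krull_dim R = Sup {enat k | k. \<exists>P :: nat \<Rightarrow> 'a set.
     (\<forall>i \<le> k. primeideal (P i) R) \<and> (\<forall>i < k. P i \<subset> P (Suc i))}"

text \<open>The middle condition says that \<open>x\<^sub>i\<close> is a nonzerodivisor on \<open>R / (x\<^sub>0, \<dots>, x\<^bsub>i-1\<^esub>)\<close>.\<close>

definition regular_sequence :: "('a, 'm) ring_scheme \<Rightarrow> 'a list \<Rightarrow> bool" where
  "regular_sequence R xs \<longleftrightarrow>
     set xs \<subseteq> carrier R \<and>
     (\<forall>i < length xs. \<forall>a \<in> carrier R.
        xs ! i \<otimes>\<^bsub>R\<^esub> a \<in> Idl\<^bsub>R\<^esub> (set (take i xs)) \<longrightarrow> a \<in> Idl\<^bsub>R\<^esub> (set (take i xs))) \<and>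
     Idl\<^bsub>R\<^esub> (set xs) \<noteq> carrier R"

definition ideal_depth :: "('a, 'm) ring_scheme \<Rightarrow> 'a set \<Rightarrow> enat" where
  "ideal_depth R I = Sup {enat (length xs) | xs. set xs \<subseteq> I \<and> regular_sequence R xs}"

definition cohen_macaulay_local :: "('a, 'm) ring_scheme \<Rightarrow> bool" where
  "cohen_macaulay_local R \<longleftrightarrow>
     cring R \<and> noetherian_ring R \<and>
     (\<exists>m. {M. maximalideal M R} = {m} \<and> ideal_depth R m = krull_dim R)"

definition cohen_macaulay_ring :: "('a, 'm) ring_scheme \<Rightarrow> bool" where
  "cohen_macaulay_ring R \<longleftrightarrow>
     cring R \<and> noetherian_ring R \<and>
     (\<forall>P. primeideal P R \<longrightarrow> cohen_macaulay_local (localization R P))"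

section \<open>Alternating sign matrices and their ideals\<close>

text \<open>Matrix entries are indexed from 0, as usual for the type of matrices used here.\<close>

definition alternating :: "nat \<Rightarrow> (nat \<Rightarrow> int) \<Rightarrow> bool" where
  "alternating n f \<longleftrightarrow>
     (\<forall>a b. a < b \<and> b < n \<and> f a \<noteq> 0 \<and> f b \<noteq> 0 \<and> (\<forall>c. a < c \<and> c < b \<longrightarrow> f c = 0)
        \<longrightarrow> sgn (f b) = - sgn (f a))"

definition ASM :: "nat \<Rightarrow> int mat set" where
  "ASM n = {A \<in> carrier_mat n n.
     (\<forall>a < n. \<forall>b < n. A $$ (a, b) \<in> {-1, 0, 1}) \<and>
     (\<forall>a < n. (\<Sum>b < n. A $$ (a, b)) = 1) \<and>
     (\<forall>b < n. (\<Sum>a < n. A $$ (a, b)) = 1) \<and>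
     (\<forall>a < n. alternating n (\<lambda>b. A $$ (a, b))) \<and>
     (\<forall>b < n. alternating n (\<lambda>a. A $$ (a, b)))}"

text \<open>Here \<open>i\<close> and \<open>j\<close> are the numbers of leading rows and columns, so \<open>rk A i j\<close> is literally
  \<open>rk\<^sub>A(i, j)\<close> for one-based \<open>i\<close>, \<open>j\<close>.\<close>

definition rk :: "int mat \<Rightarrow> nat \<Rightarrow> nat \<Rightarrow> int" where
  "rk A i j = (\<Sum>a < i. \<Sum>b < j. A $$ (a, b))"

text \<open>Polynomials are finitely supported functions from exponent vectors to coefficients. The ring
  \<open>\<kappa>[z\<^bsub>a,b\<^esub> | a, b < n]\<close> consists of those in which only these variables occur.\<close>

type_synonym 'k zpoly = "(nat \<times> nat \<Rightarrow>\<^sub>0 nat) \<Rightarrow>\<^sub>0 'k"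

definition zvar :: "nat \<times> nat \<Rightarrow> 'k::field zpoly" where
  "zvar v = Poly_Mapping.single (Poly_Mapping.single v 1) 1"

definition zring :: "nat \<Rightarrow> 'k::field zpoly ring" where
  "zring n =
    \<lparr>carrier = {p. \<forall>e \<in> Poly_Mapping.keys p. Poly_Mapping.keys e \<subseteq> {..<n} \<times> {..<n}},
     mult = (*), one = 1, zero = 0, add = (+)\<rparr>"

definition generic_mat :: "nat \<Rightarrow> 'k::field zpoly mat" where
  "generic_mat n = mat n n zvar"

definition minors :: "nat \<Rightarrow> 'a::comm_ring_1 mat \<Rightarrow> 'a set" where
  "minors k M = {det (submatrix M I J) | I J.
     I \<subseteq> {..<dim_row M} \<and> J \<subseteq> {..<dim_col M} \<and> card I = k \<and> card J = k}"

definition det_ideal :: "nat \<Rightarrow> nat \<Rightarrow> nat \<Rightarrow> nat \<Rightarrow> 'k::field zpoly set" where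
  "det_ideal n k i j = Idl\<^bsub>zring n\<^esub> (minors k (submatrix (generic_mat n) {..<i} {..<j}))"

text \<open>The sum of a family of ideals is the ideal generated by their union. For an alternating sign
  matrix all values of \<open>rk\<close> are nonnegative, so the conversion to natural numbers loses nothing.\<close>

definition asm_ideal :: "nat \<Rightarrow> int mat \<Rightarrow> 'k::field zpoly set" where
  "asm_ideal n A =
     Idl\<^bsub>zring n\<^esub> (\<Union>i \<in> {1..n}. \<Union>j \<in> {1..n}. det_ideal n (nat (rk A i j) + 1) i j)"

definition cohen_macaulay_asm :: "'k::field itself \<Rightarrow> nat \<Rightarrow> int mat \<Rightarrow> bool" where
  "cohen_macaulay_asm \<kappa> n A \<longleftrightarrow>
     cohen_macaulay_ring (zring n Quot (asm_ideal n A :: 'k zpoly set))"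

text \<open>\<open>A\<close> bordered by a new first row and a new column in zero-based position \<open>j\<close>, which meet in
  a 1 and are 0 elsewhere.\<close>

definition asm_insert :: "nat \<Rightarrow> int mat \<Rightarrow> nat \<Rightarrow> int mat" where
  "asm_insert n A j = mat (n + 1) (n + 1) (\<lambda>(a, b).
     if a = 0 then (if b = j then 1 else 0)
     else if b = j then 0
     else if b < j then A $$ (a - 1, b)
     else A $$ (a - 1, b - 1))"

end

theory Submission
  imports Defs
begin

text \<open>Let \<open>w\<close> be the variable in the corner \<open>(1, j)\<close> of the bordered matrix. Setting \<open>w\<close> to 1 and the
  other variables of row 1 and column \<open>j\<close> to 0 maps the quotient ring of \<open>A~\<close> onto that of \<open>A\<close>; the
  kernel is generated by \<open>w - 1\<close> and these variables, and those left of the corner already vanish in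
  the quotient. The remaining generators form a regular sequence: the ideal of \<open>A~\<close> is invariant
  under scaling row 1, under adding multiples of row 1 to lower rows and under adding multiples of
  column \<open>j\<close> to columns to its right. Applied with a parameter \<open>u\<close>, these operations turn \<open>w - 1\<close> into
  \<open>u w - 1\<close> and each variable \<open>z\<close> into \<open>z + u w\<close>, which, as \<open>w = 1\<close> after the first step, are polynomials
  in \<open>u\<close> with a unit as constant or leading coefficient, hence regular. Finally, a Cohen--Macaulay
  ring modulo a regular element is Cohen--Macaulay; locally, the depth drops by at most one by an
  exchange argument for regular sequences, and the dimension drops by at least one because every
  prime containing a regular element strictly contains a prime avoiding it.\<close>

section \<open>Ideals of Noetherian rings\<close>

text \<open>Geometric origin: the rank conditions concern only northwest corners, so the zero set
  for the bordered matrix is stable under downward row and rightward column operations. Where w is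
  nonzero these clear row 1 and column j, and what remains satisfies the conditions of A. Setting w
  to 1 and the cleared entries to 0 is thus a slice transversal to the operations, and each of its
  equations should cost one unit of dimension and one of depth. Since w - 1 is inhomogeneous, graded
  arguments and free reordering of regular sequences are not at hand. Instead each generator has an
  operation of its own that moves it but fixes the generators adjoined before it, so that the ideal
  reached so far stays invariant. With the parameter u as an indeterminate, regularity becomes
  cancellation in polynomials in u; specializing u to the value at which the operation is the
  identity returns to the original ring. A second obstacle: depth is a supremum over all regular
  sequences, and a long one need not begin with the element to be divided out. Hence the exchange
  argument, which itself needs elements avoiding finitely many associated primes.\<close>

definition adjoin :: "('a, 'm) ring_scheme \<Rightarrow> 'a set \<Rightarrow> 'a \<Rightarrow> 'a set" where
  "adjoin R J t = {j \<oplus>\<^bsub>R\<^esub> r \<otimes>\<^bsub>R\<^esub> t | j r. j \<in> J \<and> r \<in> carrier R}"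

definition regular_mod :: "('a, 'm) ring_scheme \<Rightarrow> 'a set \<Rightarrow> 'a \<Rightarrow> bool" where
  "regular_mod R J t \<longleftrightarrow> t \<in> carrier R \<and> (\<forall>a \<in> carrier R. t \<otimes>\<^bsub>R\<^esub> a \<in> J \<longrightarrow> a \<in> J)"

text \<open>All ideals live in one fixed ring, so no iterated quotients are formed. Properness of
  the last ideal, which \<open>regular_sequence\<close> demands, is kept apart because the exchange
  argument concerns only the regularity conditions.\<close>

fun regular_list :: "('a, 'm) ring_scheme \<Rightarrow> 'a set \<Rightarrow> 'a list \<Rightarrow> bool" where
  "regular_list R J [] \<longleftrightarrow> True"
| "regular_list R J (x # xs) \<longleftrightarrow> regular_mod R J x \<and> regular_list R (adjoin R J x) xs"

definition colon :: "('a, 'm) ring_scheme \<Rightarrow> 'a set \<Rightarrow> 'a \<Rightarrow> 'a set" where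
  "colon R J a = {x \<in> carrier R. x \<otimes>\<^bsub>R\<^esub> a \<in> J}"

definition associated_primes :: "('a, 'm) ring_scheme \<Rightarrow> 'a set \<Rightarrow> 'a set set" where
  "associated_primes R J = {P. primeideal P R \<and> (\<exists>a \<in> carrier R - J. P = colon R J a)}"

lemma adjoinE:
  assumes "x \<in> adjoin R J t"
  obtains j r where "j \<in> J" "r \<in> carrier R" "x = j \<oplus>\<^bsub>R\<^esub> r \<otimes>\<^bsub>R\<^esub> t"
  using assms unfolding adjoin_def by blast

lemma regular_modD:
  "regular_mod R J t \<Longrightarrow> a \<in> carrier R \<Longrightarrow> t \<otimes>\<^bsub>R\<^esub> a \<in> J \<Longrightarrow> a \<in> J"
  unfolding regular_mod_def by blast

lemma regular_mod_carrier: "regular_mod R J t \<Longrightarrow> t \<in> carrier R"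
  unfolding regular_mod_def by blast

lemma ideal_carrier: "ideal I R \<Longrightarrow> a \<in> I \<Longrightarrow> a \<in> carrier R"
  by (rule ideal.Icarr)

lemma ideal_add: "ideal I R \<Longrightarrow> a \<in> I \<Longrightarrow> b \<in> I \<Longrightarrow> a \<oplus>\<^bsub>R\<^esub> b \<in> I"
  by (meson additive_subgroup.a_closed ideal.axioms(1))

lemma ideal_lmult: "ideal I R \<Longrightarrow> a \<in> I \<Longrightarrow> r \<in> carrier R \<Longrightarrow> r \<otimes>\<^bsub>R\<^esub> a \<in> I"
  by (rule ideal.I_l_closed)

lemma ideal_rmult: "ideal I R \<Longrightarrow> a \<in> I \<Longrightarrow> r \<in> carrier R \<Longrightarrow> a \<otimes>\<^bsub>R\<^esub> r \<in> I"
  by (rule ideal.I_r_closed)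

lemma ideal_zero: "ideal I R \<Longrightarrow> \<zero>\<^bsub>R\<^esub> \<in> I"
  by (meson additive_subgroup.zero_closed ideal.axioms(1))

lemma ideal_minus:
  assumes I: "ideal I R" and "a \<in> I" "b \<in> I"
  shows "a \<ominus>\<^bsub>R\<^esub> b \<in> I"
proof -
  interpret ideal I R by (rule I)
  show ?thesis using assms by (simp add: a_minus_def)
qed

context cring
begin

lemma in_adjoinI: "j \<in> J \<Longrightarrow> r \<in> carrier R \<Longrightarrow> j \<oplus> r \<otimes> t \<in> adjoin R J t"
  unfolding adjoin_def by blast

lemma adjoin_ideal:
  assumes "ideal J R" "t \<in> carrier R"
  shows "ideal (adjoin R J t) R"
proof -
  have "adjoin R J t = J <+> PIdl t"
    unfolding adjoin_def set_add_def' cgenideal_def by blast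
  then show ?thesis
    using add_ideals[OF assms(1) cgenideal_ideal[OF assms(2)]] by simp
qed

lemma adjoin_superset:
  assumes "ideal J R" "t \<in> carrier R"
  shows "J \<subseteq> adjoin R J t"
proof
  fix x assume x: "x \<in> J"
  have "x \<oplus> \<zero> \<otimes> t \<in> adjoin R J t" using x by (intro in_adjoinI) auto
  then show "x \<in> adjoin R J t" using ideal_carrier[OF assms(1) x] assms(2) by simp
qed

lemma adjoin_self:
  assumes "ideal J R" "t \<in> carrier R"
  shows "t \<in> adjoin R J t"
proof -
  have "\<zero> \<oplus> \<one> \<otimes> t \<in> adjoin R J t"
    using ideal_zero[OF assms(1)] by (intro in_adjoinI) auto
  then show ?thesis using assms(2) by simp
qed

lemma adjoin_least:
  assumes "ideal K R" "J \<subseteq> K" "t \<in> K"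
  shows "adjoin R J t \<subseteq> K"
  using assms by (auto elim!: adjoinE intro!: ideal_add ideal_lmult)

lemma adjoin_commute:
  assumes "ideal J R" "s \<in> carrier R" "t \<in> carrier R"
  shows "adjoin R (adjoin R J s) t = adjoin R (adjoin R J t) s"
proof -
  have "adjoin R (adjoin R J a) b \<subseteq> adjoin R (adjoin R J b) a"
    if "a \<in> carrier R" "b \<in> carrier R" for a b
  proof -
    note b = adjoin_ideal[OF assms(1) that(2)]
    have "J \<subseteq> adjoin R (adjoin R J b) a" "b \<in> adjoin R (adjoin R J b) a"
      using adjoin_superset[OF assms(1) that(2)] adjoin_superset[OF b that(1)]
        adjoin_self[OF assms(1) that(2)] by blast+
    then show ?thesis
      using adjoin_ideal[OF b that(1)] adjoin_self[OF b that(1)] by (intro adjoin_least)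
  qed
  then show ?thesis using assms(2,3) by blast
qed

lemma adjoin_genideal:
  assumes "S \<subseteq> carrier R" "t \<in> carrier R"
  shows "adjoin R (Idl S) t = Idl (insert t S)"
proof
  have "ideal (Idl (insert t S)) R" "insert t S \<subseteq> Idl (insert t S)"
    using assms genideal_ideal[of "insert t S"] genideal_self[of "insert t S"] by auto
  then show "adjoin R (Idl S) t \<subseteq> Idl (insert t S)"
    using assms(1) by (intro adjoin_least) (auto intro: subsetD[OF genideal_minimal])
  have I: "ideal (Idl S) R" using assms by (simp add: genideal_ideal)
  then have "insert t S \<subseteq> adjoin R (Idl S) t"
    using adjoin_superset[OF I assms(2)] adjoin_self[OF I assms(2)] genideal_self[OF assms(1)] by blast
  then show "Idl (insert t S) \<subseteq> adjoin R (Idl S) t"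
    by (intro genideal_minimal adjoin_ideal I assms(2))
qed

lemma adjoin_zero: "adjoin R {\<zero>} t = PIdl t" if "t \<in> carrier R"
proof -
  have "\<zero> \<oplus> r \<otimes> t = r \<otimes> t" if "r \<in> carrier R" for r using that \<open>t \<in> carrier R\<close> by simp
  then show ?thesis unfolding adjoin_def cgenideal_def by force
qed

lemma colon_ideal:
  assumes J: "ideal J R" and a: "a \<in> carrier R"
  shows "ideal (colon R J a) R"
proof (rule idealI)
  show "ring R" by (rule ring_axioms)
  show "subgroup (colon R J a) (add_monoid R)"
  proof (rule add.subgroupI)
    show "colon R J a \<subseteq> carrier R" unfolding colon_def by blast
    have "\<zero> \<in> colon R J a" using a ideal_zero[OF J] unfolding colon_def by simp
    then show "colon R J a \<noteq> {}" by blast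
    fix x assume x: "x \<in> colon R J a"
    then have "\<zero> \<ominus> x \<otimes> a \<in> J" using ideal_minus[OF J ideal_zero[OF J]] unfolding colon_def by blast
    moreover have "\<zero> \<ominus> x \<otimes> a = \<ominus> x \<otimes> a" using x a unfolding colon_def
      by (simp add: a_minus_def l_minus)
    ultimately show "\<ominus> x \<in> colon R J a" using x unfolding colon_def by auto
    fix y assume "y \<in> colon R J a"
    then show "x \<oplus> y \<in> colon R J a"
      using x a ideal_add[OF J] unfolding colon_def by (auto simp: l_distr)
  qed
  fix x y assume "x \<in> colon R J a" and y: "y \<in> carrier R"
  then have x: "x \<in> carrier R" "x \<otimes> a \<in> J" unfolding colon_def by auto
  have "(y \<otimes> x) \<otimes> a = y \<otimes> (x \<otimes> a)" using x y a by algebra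
  then show yx: "y \<otimes> x \<in> colon R J a" using x y ideal_lmult[OF J] unfolding colon_def by auto
  then show "x \<otimes> y \<in> colon R J a" using x y m_comm by simp
qed

text \<open>A relation x a = j + c z puts z c into J + (x); regularity of z there gives c = j' + d
  x, and cancelling x leaves a - d z in J.\<close>

lemma regular_mod_swap:
  assumes J: "ideal J R" and x: "regular_mod R J x"
    and z: "regular_mod R J z" "regular_mod R (adjoin R J x) z"
  shows "regular_mod R (adjoin R J z) x"
  unfolding regular_mod_def
proof (intro conjI ballI impI)
  show xc: "x \<in> carrier R" using x by (rule regular_mod_carrier)
  have zc: "z \<in> carrier R" using z(1) by (rule regular_mod_carrier)
  fix a assume a: "a \<in> carrier R" "x \<otimes> a \<in> adjoin R J z"
  then obtain j c where j: "j \<in> J" "c \<in> carrier R" "x \<otimes> a = j \<oplus> c \<otimes> z" by (blast elim: adjoinE)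
  have jc: "j \<in> carrier R" using J j(1) by (rule ideal_carrier)
  have "z \<otimes> c = (\<ominus> j) \<oplus> (j \<oplus> c \<otimes> z)" using j(2) jc zc by algebra
  also have "\<dots> = (\<ominus> j) \<oplus> a \<otimes> x" unfolding j(3)[symmetric] using a(1) xc m_comm by simp
  finally have "z \<otimes> c = (\<ominus> j) \<oplus> a \<otimes> x" .
  moreover have "\<ominus> j \<in> J"
    using J j(1) by (meson additive_subgroup.a_inv_closed ideal.axioms(1))
  ultimately have "z \<otimes> c \<in> adjoin R J x" using a(1) by (simp add: in_adjoinI)
  then have "c \<in> adjoin R J x" using z(2) j(2) by (blast intro: regular_modD)
  then obtain j' d where d: "j' \<in> J" "d \<in> carrier R" "c = j' \<oplus> d \<otimes> x" by (blast elim: adjoinE)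
  have j'c: "j' \<in> carrier R" using J d(1) by (rule ideal_carrier)
  have "x \<otimes> (a \<ominus> d \<otimes> z) = x \<otimes> a \<ominus> d \<otimes> x \<otimes> z" using a(1) d(2) xc zc by algebra
  also have "\<dots> = j \<oplus> z \<otimes> j'" unfolding j(3) d(3) using jc j'c d(2) xc zc by algebra
  finally have "x \<otimes> (a \<ominus> d \<otimes> z) \<in> J"
    using J j(1) d(1) zc by (simp add: ideal_add ideal_lmult)
  then have "a \<ominus> d \<otimes> z \<in> J" using x a(1) d(2) zc by - (rule regular_modD[OF x], auto)
  then have "(a \<ominus> d \<otimes> z) \<oplus> d \<otimes> z \<in> adjoin R J z" using d(2) by (intro in_adjoinI)
  moreover have "(a \<ominus> d \<otimes> z) \<oplus> d \<otimes> z = a" using a(1) d(2) zc by algebra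
  ultimately show "a \<in> adjoin R J z" by simp
qed

text \<open>Cross-multiplying y a = j + b t with y' a = i + c t and cancelling t gives y' b in J +
  (y); hence b = k + d y, and cancelling y leaves a - d t in J. So an ideal m containing a regular
  pair annihilates no nonzero class modulo J + (t), which is what a search for an element of m
  regular modulo J + (t) requires.\<close>

lemma regular_pair_exchange:
  assumes J: "ideal J R" and t: "regular_mod R J t"
    and y: "regular_mod R J y" and y': "regular_mod R (adjoin R J y) y'"
    and a: "a \<in> carrier R" "y \<otimes> a \<in> adjoin R J t" "y' \<otimes> a \<in> adjoin R J t"
  shows "a \<in> adjoin R J t"
proof -
  have tc: "t \<in> carrier R" and yc: "y \<in> carrier R" and y'c: "y' \<in> carrier R"
    using t y y' by (auto dest: regular_mod_carrier)
  obtain j b where b: "j \<in> J" "b \<in> carrier R" "y \<otimes> a = j \<oplus> b \<otimes> t"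
    using a(2) by (blast elim: adjoinE)
  obtain i c where c: "i \<in> J" "c \<in> carrier R" "y' \<otimes> a = i \<oplus> c \<otimes> t"
    using a(3) by (blast elim: adjoinE)
  have jc: "j \<in> carrier R" and ic: "i \<in> carrier R" using J b(1) c(1) by (auto intro: ideal_carrier)
  have "t \<otimes> (y' \<otimes> b \<ominus> y \<otimes> c) = y' \<otimes> (j \<oplus> b \<otimes> t) \<ominus> y' \<otimes> j \<ominus> y \<otimes> (i \<oplus> c \<otimes> t) \<oplus> y \<otimes> i"
    using tc yc y'c b(2) c(2) jc ic by algebra
  also have "\<dots> = y \<otimes> i \<ominus> y' \<otimes> j"
    unfolding b(3)[symmetric] c(3)[symmetric] using yc y'c a(1) jc ic by algebra
  finally have "t \<otimes> (y' \<otimes> b \<ominus> y \<otimes> c) \<in> J"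
    using J b(1) c(1) yc y'c by (simp add: ideal_minus ideal_lmult)
  then have "y' \<otimes> b \<ominus> y \<otimes> c \<in> J" using yc y'c b(2) c(2) by - (rule regular_modD[OF t], auto)
  then have "(y' \<otimes> b \<ominus> y \<otimes> c) \<oplus> c \<otimes> y \<in> adjoin R J y" using c(2) by (intro in_adjoinI)
  moreover have "(y' \<otimes> b \<ominus> y \<otimes> c) \<oplus> c \<otimes> y = y' \<otimes> b" using yc y'c b(2) c(2) by algebra
  ultimately have "b \<in> adjoin R J y" using y' b(2) by (auto intro: regular_modD)
  then obtain k d where d: "k \<in> J" "d \<in> carrier R" "b = k \<oplus> d \<otimes> y" by (blast elim: adjoinE)
  have kc: "k \<in> carrier R" using J d(1) by (rule ideal_carrier)
  have "y \<otimes> (a \<ominus> d \<otimes> t) = y \<otimes> a \<ominus> d \<otimes> y \<otimes> t" using a(1) d(2) yc tc by algebra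
  also have "\<dots> = j \<oplus> t \<otimes> k" unfolding b(3) d(3) using jc kc d(2) yc tc by algebra
  finally have "y \<otimes> (a \<ominus> d \<otimes> t) \<in> J"
    using J b(1) d(1) tc by (simp add: ideal_add ideal_lmult)
  then have "a \<ominus> d \<otimes> t \<in> J" using a(1) d(2) tc by - (rule regular_modD[OF y], auto)
  then have "(a \<ominus> d \<otimes> t) \<oplus> d \<otimes> t \<in> adjoin R J t" using d(2) by (intro in_adjoinI)
  moreover have "(a \<ominus> d \<otimes> t) \<oplus> d \<otimes> t = a" using a(1) d(2) tc by algebra
  ultimately show ?thesis by simp
qed

section \<open>Prime avoidance\<close>

lemma prime_avoidance_product:
  assumes "finite F" "primeideal P R" "ideal m R" "\<not> m \<subseteq> P"
    and "\<And>I. I \<in> F \<Longrightarrow> ideal I R" "\<And>I. I \<in> F \<Longrightarrow> \<not> I \<subseteq> P"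
  shows "\<exists>y \<in> m. (\<forall>I \<in> F. y \<in> I) \<and> y \<notin> P"
  using assms(1,5,6)
proof (induction F rule: finite_induct)
  case empty
  then show ?case using assms(4) by blast
next
  case (insert I F)
  then obtain y where y: "y \<in> m" "\<forall>I \<in> F. y \<in> I" "y \<notin> P" by auto
  obtain x where x: "x \<in> I" "x \<notin> P" using insert.prems(2)[of I] by blast
  have I: "ideal I R" "\<And>K. K \<in> F \<Longrightarrow> ideal K R" using insert.prems(1) by auto
  have yc: "y \<in> carrier R" and xc: "x \<in> carrier R"
    using assms(3) y(1) I(1) x(1) by (auto intro: ideal_carrier)
  have "y \<otimes> x \<in> m" using assms(3) y(1) xc by (rule ideal_rmult)
  moreover have "\<forall>K \<in> insert I F. y \<otimes> x \<in> K"
    using I x(1) y(2) xc yc by (auto intro: ideal_rmult ideal_lmult)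
  moreover have "y \<otimes> x \<notin> P" using primeideal.I_prime[OF assms(2) yc xc] x(2) y(3) by blast
  ultimately show ?case by blast
qed

text \<open>Induction on the number of primes. Once no two are comparable, some y lies in all of
  them except P; if an element z avoiding the others happens to lie in P, then z + y avoids
  all.\<close>

lemma prime_avoidance:
  assumes "finite F" "ideal m R" "\<And>P. P \<in> F \<Longrightarrow> primeideal P R" "\<And>P. P \<in> F \<Longrightarrow> \<not> m \<subseteq> P"
  shows "\<exists>z \<in> m. \<forall>P \<in> F. z \<notin> P"
  using assms(1,3,4)
proof (induction "card F" arbitrary: F)
  case 0
  then show ?case using ideal_zero[OF assms(2)] by auto
next
  case (Suc n)
  show ?case
  proof (cases "\<exists>P \<in> F. \<exists>P' \<in> F. P \<noteq> P' \<and> P \<subseteq> P'")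
    case True
    then obtain P P' where P: "P \<in> F" "P' \<in> F" "P \<noteq> P'" "P \<subseteq> P'" by blast
    have "n = card (F - {P})" using Suc.hyps(2) Suc.prems(1) P(1) by simp
    then obtain z where "z \<in> m" "\<forall>P \<in> F - {P}. z \<notin> P"
      using Suc.hyps(1)[of "F - {P}"] Suc.prems by auto
    then show ?thesis using P by blast
  next
    case False
    obtain P where P: "P \<in> F" using Suc.hyps(2) by fastforce
    have "n = card (F - {P})" using Suc.hyps(2) Suc.prems(1) P by simp
    then obtain z where z: "z \<in> m" "\<forall>P \<in> F - {P}. z \<notin> P"
      using Suc.hyps(1)[of "F - {P}"] Suc.prems by auto
    have id: "ideal K R" if "K \<in> F" for K
      using Suc.prems(2)[OF that] by (simp add: primeideal.axioms(1))
    obtain y where y: "y \<in> m" "\<forall>I \<in> F - {P}. y \<in> I" "y \<notin> P"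
      using prime_avoidance_product[of "F - {P}" P m] Suc.prems P False id assms(2)
      by (metis (no_types, lifting) Diff_iff finite_Diff singletonI)
    have zc: "z \<in> carrier R" and yc: "y \<in> carrier R"
      using assms(2) z(1) y(1) by (auto intro: ideal_carrier)
    show ?thesis
    proof (cases "z \<in> P")
      case False
      then show ?thesis using z by blast
    next
      case True
      have eq: "(z \<oplus> y) \<ominus> z = y" "(z \<oplus> y) \<ominus> y = z" using zc yc by algebra+
      have "z \<oplus> y \<notin> P" using ideal_minus[OF id[OF P], of "z \<oplus> y" z] True y(3) eq by auto
      moreover have "z \<oplus> y \<notin> K" if "K \<in> F - {P}" for K
        using ideal_minus[OF id, of K "z \<oplus> y" y] that z y eq by auto
      moreover have "z \<oplus> y \<in> m" using assms(2) z(1) y(1) by (rule ideal_add)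
      ultimately show ?thesis by blast
    qed
  qed
qed

end

section \<open>Primes and regular elements in Noetherian rings\<close>

lemma (in noetherian_ring) maximal_ideal_in_family:
  assumes "S \<noteq> {}" "\<And>I. I \<in> S \<Longrightarrow> ideal I R"
  shows "\<exists>M \<in> S. \<forall>I \<in> S. M \<subseteq> I \<longrightarrow> I = M"
proof (rule subset_Zorn)
  fix C assume C: "subset.chain S C"
  show "\<exists>U \<in> S. \<forall>X \<in> C. X \<subseteq> U"
  proof (cases "C = {}")
    case True
    then show ?thesis using assms(1) by blast
  next
    case False
    have "subset.chain {I. ideal I R} C" using C assms(2) unfolding subset_chain_def by blast
    then have "\<Union>C \<in> C" by (rule ideal_chain_is_trivial[OF False])
    moreover have "C \<subseteq> S" using C unfolding subset_chain_def by blast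
    ultimately show ?thesis by (meson Union_upper subsetD)
  qed
qed

locale noetherian_cring = cring + noetherian_ring
begin

text \<open>An ideal maximal among those disjoint from T is prime: for a, b outside it, T meets both
  enlargements, and the product of the two meeting points would lie in T and, if a b is in the
  ideal, in the ideal as well.\<close>

lemma prime_disjoint_from_multiplicative:
  assumes J: "ideal J R" and T: "T \<subseteq> carrier R" "T \<noteq> {}" "\<And>a b. a \<in> T \<Longrightarrow> b \<in> T \<Longrightarrow> a \<otimes> b \<in> T"
    and disj: "J \<inter> T = {}"
  shows "\<exists>P. primeideal P R \<and> J \<subseteq> P \<and> P \<inter> T = {}"
proof -
  define S where "S = {I. ideal I R \<and> J \<subseteq> I \<and> I \<inter> T = {}}"
  have "S \<noteq> {}" using J disj unfolding S_def by auto
  then obtain M where M: "M \<in> S" "\<forall>I \<in> S. M \<subseteq> I \<longrightarrow> I = M"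
    using maximal_ideal_in_family[of S] unfolding S_def by blast
  have Mi: "ideal M R" and JM: "J \<subseteq> M" and MT: "M \<inter> T = {}" using M(1) unfolding S_def by auto
  have meets: "\<exists>u \<in> M. \<exists>r \<in> carrier R. u \<oplus> r \<otimes> a \<in> T" if "a \<in> carrier R" "a \<notin> M" for a
  proof (rule ccontr)
    assume no: "\<not> ?thesis"
    then have "adjoin R M a \<inter> T = {}" by (blast elim: adjoinE)
    then have "adjoin R M a \<in> S"
      unfolding S_def using adjoin_ideal[OF Mi that(1)] adjoin_superset[OF Mi that(1)] JM by blast
    then have "adjoin R M a = M" using M(2) adjoin_superset[OF Mi that(1)] by blast
    then show False using adjoin_self[OF Mi that(1)] that(2) by blast
  qed
  have "primeideal M R"
  proof (rule primeidealI)
    show "ideal M R" by (rule Mi)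
    show "cring R" by (rule cring_axioms)
    show "carrier R \<noteq> M" using T MT by blast
    fix a b assume ab: "a \<in> carrier R" "b \<in> carrier R" "a \<otimes> b \<in> M"
    show "a \<in> M \<or> b \<in> M"
    proof (rule ccontr)
      assume "\<not> (a \<in> M \<or> b \<in> M)"
      then obtain u r v s where u: "u \<in> M" "r \<in> carrier R" "u \<oplus> r \<otimes> a \<in> T"
        and v: "v \<in> M" "s \<in> carrier R" "v \<oplus> s \<otimes> b \<in> T"
        using meets[of a] meets[of b] ab by metis
      have uc: "u \<in> carrier R" and vc: "v \<in> carrier R" using Mi u(1) v(1) by (auto intro: ideal_carrier)
      have "(u \<oplus> r \<otimes> a) \<otimes> (v \<oplus> s \<otimes> b) =
        (v \<oplus> s \<otimes> b) \<otimes> u \<oplus> ((r \<otimes> a) \<otimes> v \<oplus> (r \<otimes> s) \<otimes> (a \<otimes> b))"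
        using uc vc u(2) v(2) ab(1,2) by algebra
      also have "\<dots> \<in> M"
        using u v vc ab ideal_lmult[OF Mi ab(3), of "r \<otimes> s"]
        by (intro ideal_add[OF Mi] ideal_lmult[OF Mi u(1)] ideal_lmult[OF Mi v(1)]) auto
      finally show False using T(3)[OF u(3) v(3)] MT by blast
    qed
  qed
  then show ?thesis using JM MT by blast
qed

text \<open>This is the source of the dimension drop: a prime containing a regular element is never
  minimal over J.\<close>

lemma prime_below_regular:
  assumes Q: "primeideal Q R" and J: "ideal J R" "J \<subseteq> Q" and x: "x \<in> Q" "regular_mod R J x"
  shows "\<exists>Q'. primeideal Q' R \<and> J \<subseteq> Q' \<and> Q' \<subset> Q \<and> x \<notin> Q'"
proof -
  \<comment> \<open>To miss T is at once to lie inside Q (take k = 0) and to avoid x. J misses T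
    because the powers of x can be cancelled modulo J and J lies in Q.\<close>
  define T where "T = {s \<otimes> x [^] k | s k. s \<in> carrier R - Q \<and> (k::nat) \<in> UNIV}"
  have xc: "x \<in> carrier R" using x(2) by (rule regular_mod_carrier)
  have one: "\<one> \<notin> Q"
    using primeideal.I_notcarr[OF Q] ideal.one_imp_carrier[OF primeideal.axioms(1)[OF Q]] by blast
  have QT: "s \<in> T" if "s \<in> carrier R - Q" for s
  proof -
    have "s = s \<otimes> x [^] (0::nat)" using that by simp
    then show ?thesis using that unfolding T_def by blast
  qed
  have "\<one> \<otimes> x [^] (1::nat) \<in> T" using one unfolding T_def by blast
  then have xT: "x \<in> T" using xc by simp
  have "\<exists>P. primeideal P R \<and> J \<subseteq> P \<and> P \<inter> T = {}"
  proof (rule prime_disjoint_from_multiplicative[OF J(1)])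
    show "T \<subseteq> carrier R" using xc unfolding T_def by auto
    show "T \<noteq> {}" using xT by blast
    fix a b assume "a \<in> T" "b \<in> T"
    then obtain s k s' l where s: "s \<in> carrier R - Q" "a = s \<otimes> x [^] (k::nat)"
      "s' \<in> carrier R - Q" "b = s' \<otimes> x [^] (l::nat)" unfolding T_def by blast
    have "a \<otimes> b = (s \<otimes> s') \<otimes> x [^] (k + l)"
      using s xc by (simp add: nat_pow_mult[symmetric] m_assoc m_lcomm)
    moreover have "s \<otimes> s' \<in> carrier R - Q" using primeideal.I_prime[OF Q] s by auto
    ultimately show "a \<otimes> b \<in> T" unfolding T_def by blast
  next
    have "s \<otimes> x [^] k \<notin> J" if s: "s \<in> carrier R - Q" for s and k :: nat
    proof (induction k)
      case 0
      then show ?case using s J(2) by auto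
    next
      case (Suc k)
      have "s \<otimes> x [^] Suc k = x \<otimes> (s \<otimes> x [^] k)" using s xc by (simp add: m_ac)
      then show ?case using Suc regular_modD[OF x(2), of "s \<otimes> x [^] k"] s xc by auto
    qed
    then show "J \<inter> T = {}" unfolding T_def by blast
  qed
  then obtain P where P: "primeideal P R" "J \<subseteq> P" "P \<inter> T = {}" by blast
  have "P \<subseteq> Q" using P(3) QT ideal_carrier[OF primeideal.axioms(1)[OF P(1)]] by blast
  moreover have "x \<notin> P" using P(3) xT by blast
  ultimately show ?thesis using P x(1) by blast
qed

text \<open>The chain grows downwards: the induction hypothesis gives one above J + (x), and its
  lowest prime contains the regular element x, so another prime fits strictly below it.\<close>

lemma prime_chain_of_regular_list:
  assumes "primeideal Q R" "ideal J R" "J \<subseteq> Q" "set xs \<subseteq> Q" "regular_list R J xs"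
  shows "\<exists>P. (\<forall>i \<le> length xs. primeideal (P i) R \<and> J \<subseteq> P i) \<and> (\<forall>i < length xs. P i \<subset> P (Suc i)) \<and>
    P (length xs) = Q"
  using assms(2-)
proof (induction xs arbitrary: J)
  case Nil
  then show ?case using assms(1) by (intro exI[of _ "\<lambda>_. Q"]) auto
next
  case (Cons x xs)
  have Qi: "ideal Q R" using assms(1) by (rule primeideal.axioms)
  have x: "regular_mod R J x" "x \<in> Q" using Cons.prems by auto
  have xc: "x \<in> carrier R" using x(1) by (rule regular_mod_carrier)
  obtain P where P: "\<forall>i \<le> length xs. primeideal (P i) R \<and> adjoin R J x \<subseteq> P i"
    "\<forall>i < length xs. P i \<subset> P (Suc i)" "P (length xs) = Q"
    using Cons.IH[of "adjoin R J x"] Cons.prems adjoin_ideal[OF _ xc] adjoin_least[OF Qi _ x(2)] by auto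
  have JP: "J \<subseteq> P i" "x \<in> P i" if "i \<le> length xs" for i
    using P(1) that adjoin_superset[OF Cons.prems(1) xc] adjoin_self[OF Cons.prems(1) xc] by blast+
  obtain Q' where Q': "primeideal Q' R" "J \<subseteq> Q'" "Q' \<subset> P 0"
    using prime_below_regular[of "P 0" J x] P(1) JP Cons.prems(1) x(1) by blast
  show ?case
    by (rule exI[of _ "case_nat Q' P"]) (use P JP Q' in \<open>auto split: nat.split\<close>)
qed

section \<open>Associated primes and elements avoiding them\<close>

lemma associated_prime_above_colon:
  assumes J: "ideal J R" and b: "b \<in> carrier R - J"
  shows "\<exists>P \<in> associated_primes R J. colon R J b \<subseteq> P"
proof -
  define S where "S = {colon R J c | c. c \<in> carrier R - J \<and> colon R J b \<subseteq> colon R J c}"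
  have "S \<noteq> {}" using b unfolding S_def by auto
  then obtain M where M: "M \<in> S" "\<forall>I \<in> S. M \<subseteq> I \<longrightarrow> I = M"
    using maximal_ideal_in_family[of S] colon_ideal[OF J] unfolding S_def by blast
  then obtain c where c: "c \<in> carrier R - J" "colon R J b \<subseteq> colon R J c" "M = colon R J c"
    unfolding S_def by blast
  have Mi: "ideal M R" using c colon_ideal[OF J] by auto
  \<comment> \<open>A colon ideal that is maximal among those of elements outside J is prime: if y
    is not in M, the colon ideal of y c contains M, so equals M, and it contains x.\<close>
  have "primeideal M R"
  proof (rule primeidealI)
    show "ideal M R" by (rule Mi)
    show "cring R" by (rule cring_axioms)
    have "\<one> \<notin> M" using c unfolding colon_def by auto
    then show "carrier R \<noteq> M" by blast
    fix x y assume xy: "x \<in> carrier R" "y \<in> carrier R" "x \<otimes> y \<in> M"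
    show "x \<in> M \<or> y \<in> M"
    proof (rule disjCI)
      assume y: "y \<notin> M"
      then have yc: "y \<otimes> c \<in> carrier R - J" using c xy unfolding colon_def by auto
      have sub: "M \<subseteq> colon R J (y \<otimes> c)"
      proof
        fix z assume "z \<in> M"
        then have z: "z \<in> carrier R" "z \<otimes> c \<in> J" using c(3) unfolding colon_def by auto
        have "z \<otimes> (y \<otimes> c) = y \<otimes> (z \<otimes> c)" using z xy c by (simp add: m_lcomm)
        then show "z \<in> colon R J (y \<otimes> c)" using z xy ideal_lmult[OF J] unfolding colon_def by auto
      qed
      then have "colon R J (y \<otimes> c) \<in> S" using yc c(2,3) unfolding S_def by blast
      then have "colon R J (y \<otimes> c) = M" using M(2) sub by blast
      moreover have "x \<in> colon R J (y \<otimes> c)" using xy c unfolding colon_def by (auto simp: m_assoc)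
      ultimately show "x \<in> M" by simp
    qed
  qed
  then show ?thesis using c unfolding associated_primes_def by blast
qed

text \<open>Noetherian induction. Take M maximal among the counterexamples and an associated prime P
  of M, the colon ideal of a. If b yields another associated prime, either the classes generated by
  a and b share a nonzero element, which forces that prime to be P, or they meet trivially, and then
  the colon ideal of b does not change when a is adjoined to M. So only P can be lost in passing to
  the larger ideal M + (a).\<close>

lemma finite_associated_primes:
  assumes "ideal J R"
  shows "finite (associated_primes R J)"
proof (rule ccontr)
  assume inf: "infinite (associated_primes R J)"
  define S where "S = {I. ideal I R \<and> infinite (associated_primes R I)}"
  obtain M where M: "M \<in> S" "\<forall>I \<in> S. M \<subseteq> I \<longrightarrow> I = M"
    using maximal_ideal_in_family[of S] assms inf unfolding S_def by blast
  have Mi: "ideal M R" and Minf: "infinite (associated_primes R M)" using M(1) unfolding S_def by auto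
  obtain P a where P: "primeideal P R" "a \<in> carrier R - M" "P = colon R M a"
  proof -
    have "associated_primes R M \<noteq> {}" using Minf by auto
    then show thesis using that unfolding associated_primes_def by blast
  qed
  have ac: "a \<in> carrier R" using P by blast
  have "adjoin R M a \<noteq> M" using adjoin_self[OF Mi ac] P(2) by blast
  then have fin: "finite (associated_primes R (adjoin R M a))"
    using M(2) adjoin_superset[OF Mi ac] adjoin_ideal[OF Mi ac] unfolding S_def by blast
  \<comment> \<open>Modulo M the element c generates a copy of R/P with P its colon ideal; as P is
    prime, all nonzero elements of that copy have annihilator P.\<close>
  have eqcolon: "colon R M (j \<oplus> r \<otimes> c) = colon R M c"
    if h: "j \<in> M" "r \<in> carrier R" "c \<in> carrier R" "primeideal (colon R M c) R" "j \<oplus> r \<otimes> c \<notin> M" for j r c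
  proof -
    have jc: "j \<in> carrier R" using Mi that(1) by (rule ideal_carrier)
    have r: "r \<notin> colon R M c" using that ideal_add[OF Mi] unfolding colon_def by auto
    have "x \<in> colon R M (j \<oplus> r \<otimes> c) \<longleftrightarrow> x \<otimes> r \<in> colon R M c" if x: "x \<in> carrier R" for x
    proof -
      have xj: "x \<otimes> j \<in> M" using ideal_lmult[OF Mi \<open>j \<in> M\<close> x] .
      have e: "x \<otimes> (j \<oplus> r \<otimes> c) = x \<otimes> j \<oplus> (x \<otimes> r) \<otimes> c"
        "(x \<otimes> r) \<otimes> c = x \<otimes> (j \<oplus> r \<otimes> c) \<ominus> x \<otimes> j"
        using x jc that \<open>r \<in> carrier R\<close> \<open>c \<in> carrier R\<close> by algebra+
      have "x \<otimes> (j \<oplus> r \<otimes> c) \<in> M \<longleftrightarrow> (x \<otimes> r) \<otimes> c \<in> M"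
        using ideal_add[OF Mi xj] ideal_minus[OF Mi _ xj] e by metis
      then show ?thesis using x \<open>r \<in> carrier R\<close> unfolding colon_def by simp
    qed
    moreover have "x \<otimes> r \<in> colon R M c \<longleftrightarrow> x \<in> colon R M c" if x: "x \<in> carrier R" for x
      using primeideal.I_prime[OF h(4) x h(2)] r
        ideal_rmult[OF primeideal.axioms(1)[OF h(4)] _ h(2)] by blast
    ultimately show ?thesis unfolding colon_def by blast
  qed
  have "associated_primes R M \<subseteq> insert P (associated_primes R (adjoin R M a))"
  proof
    fix P' assume "P' \<in> associated_primes R M"
    then obtain b where b: "primeideal P' R" "b \<in> carrier R - M" "P' = colon R M b"
      unfolding associated_primes_def by blast
    have bc: "b \<in> carrier R" using b by blast
    show "P' \<in> insert P (associated_primes R (adjoin R M a))"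
    proof (cases "adjoin R M b \<inter> adjoin R M a \<subseteq> M")
      case False
      then obtain c where c: "c \<in> adjoin R M b" "c \<in> adjoin R M a" "c \<notin> M" by blast
      obtain j r where 1: "j \<in> M" "r \<in> carrier R" "c = j \<oplus> r \<otimes> b" using c(1) by (rule adjoinE)
      obtain i s where 2: "i \<in> M" "s \<in> carrier R" "c = i \<oplus> s \<otimes> a" using c(2) by (rule adjoinE)
      have "P' = colon R M c" using eqcolon[OF 1(1,2) bc] b 1(3) c(3) by auto
      moreover have "P = colon R M c" using eqcolon[OF 2(1,2) ac] P 2(3) c(3) by auto
      ultimately show ?thesis by simp
    next
      case True
      have "x \<otimes> b \<in> adjoin R M b" if "x \<in> carrier R" for x
        using adjoin_self[OF Mi bc] adjoin_ideal[OF Mi bc] that by (blast intro: ideal_lmult)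
      then have "colon R (adjoin R M a) b = colon R M b"
        unfolding colon_def using True adjoin_superset[OF Mi ac] by blast
      moreover have "b \<notin> adjoin R M a" using True b(2) adjoin_self[OF Mi bc] by blast
      ultimately show ?thesis using b unfolding associated_primes_def by auto
    qed
  qed
  then show False using Minf fin by (meson finite_insert finite_subset)
qed

text \<open>The assumption \<open>sub\<close> says that m lies in no associated prime of the given
  ideals, since such a prime is the set of elements killing some nonzero class. An element of m
  avoiding all of these primes is regular modulo each ideal.\<close>

lemma common_regular_element:
  assumes m: "ideal m R" and F: "finite F" "\<And>J. J \<in> F \<Longrightarrow> ideal J R"
    and sub: "\<And>J a. J \<in> F \<Longrightarrow> a \<in> carrier R \<Longrightarrow> (\<forall>z \<in> m. z \<otimes> a \<in> J) \<Longrightarrow> a \<in> J"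
  shows "\<exists>z \<in> m. \<forall>J \<in> F. regular_mod R J z"
proof -
  have "\<exists>z \<in> m. \<forall>P \<in> (\<Union>J \<in> F. associated_primes R J). z \<notin> P"
  proof (rule prime_avoidance[OF _ m])
    show "finite (\<Union>J \<in> F. associated_primes R J)" using F finite_associated_primes by blast
    fix P assume "P \<in> (\<Union>J \<in> F. associated_primes R J)"
    then obtain J a where J: "J \<in> F" "primeideal P R" "a \<in> carrier R - J" "P = colon R J a"
      unfolding associated_primes_def by blast
    then show "primeideal P R" by blast
    show "\<not> m \<subseteq> P" using sub[OF J(1), of a] J unfolding colon_def by blast
  qed
  then obtain z where z: "z \<in> m" "\<And>J P. J \<in> F \<Longrightarrow> P \<in> associated_primes R J \<Longrightarrow> z \<notin> P" by blast
  have zc: "z \<in> carrier R" using m z(1) by (rule ideal_carrier)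
  have "regular_mod R J z" if J: "J \<in> F" for J
    unfolding regular_mod_def
  proof (intro conjI ballI impI zc)
    fix a assume a: "a \<in> carrier R" "z \<otimes> a \<in> J"
    show "a \<in> J"
    proof (rule ccontr)
      assume "a \<notin> J"
      then obtain P where "P \<in> associated_primes R J" "colon R J a \<subseteq> P"
        using associated_prime_above_colon[OF F(2)[OF J]] a by blast
      moreover have "z \<in> colon R J a" using zc a unfolding colon_def by blast
      ultimately show False using z(2)[OF J] by blast
    qed
  qed
  then show ?thesis using z(1) by blast
qed

text \<open>An elementary form of Rees' theorem that all maximal regular sequences in \<open>m\<close> have the same
  length: an auxiliary element \<open>z\<close> is regular modulo \<open>J\<close>, \<open>J + (t)\<close> and \<open>J + (y)\<close>, so that it can
  be exchanged with both \<open>t\<close> and \<open>y\<close>.\<close>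

lemma regular_list_exchange:
  assumes m: "ideal m R" and "ideal J R" "t \<in> m" "regular_mod R J t" "set ys \<subseteq> m" "regular_list R J ys"
  shows "\<exists>xs. length xs = length ys - 1 \<and> set xs \<subseteq> m \<and> regular_list R (adjoin R J t) xs"
  using assms(2-)
proof (induction "length ys" arbitrary: J t ys)
  case 0
  then show ?case by (intro exI[of _ "[]"]) auto
next
  case (Suc n)
  note J = Suc.prems(1) and t = Suc.prems(2,3)
  obtain y ys' where ys: "ys = y # ys'" using Suc.hyps(2) by (cases ys) auto
  have y: "y \<in> m" "regular_mod R J y" using Suc.prems ys by auto
  have yc: "y \<in> carrier R" and tc: "t \<in> carrier R" using y(2) t(2) by (auto dest: regular_mod_carrier)
  show ?case
  proof (cases ys')
    case Nil
    then show ?thesis using ys by (intro exI[of _ "[]"]) auto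
  next
    case (Cons y' ys'')
    then have y': "y' \<in> m" "regular_mod R (adjoin R J y) y'" using Suc.prems ys by auto
    \<comment> \<open>That m kills no nonzero class is witnessed by y modulo J, by the pair y, y'
      modulo J + (t), and by y' modulo J + (y).\<close>
    have "\<exists>z \<in> m. \<forall>K \<in> {J, adjoin R J t, adjoin R J y}. regular_mod R K z"
    proof (rule common_regular_element[OF m])
      show "finite {J, adjoin R J t, adjoin R J y}" by simp
      show "ideal K R" if "K \<in> {J, adjoin R J t, adjoin R J y}" for K
        using that J adjoin_ideal[OF J] yc tc by blast
      fix K a assume K: "K \<in> {J, adjoin R J t, adjoin R J y}" and a: "a \<in> carrier R" "\<forall>z \<in> m. z \<otimes> a \<in> K"
      from K consider "K = J" | "K = adjoin R J t" | "K = adjoin R J y" by blast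
      then show "a \<in> K"
      proof cases
        case 1
        then show ?thesis using regular_modD[OF y(2) a(1)] a(2) y(1) by blast
      next
        case 2
        then show ?thesis
          using regular_pair_exchange[OF J t(2) y(2) y'(2) a(1)] a(2) y(1) y'(1) by blast
      next
        case 3
        then show ?thesis using regular_modD[OF y'(2) a(1)] a(2) y'(1) by blast
      qed
    qed
    then obtain z where z: "z \<in> m" "regular_mod R J z" "regular_mod R (adjoin R J t) z"
      "regular_mod R (adjoin R J y) z" by blast
    have zc: "z \<in> carrier R" using z(2) by (rule regular_mod_carrier)
    \<comment> \<open>First exchange, modulo J + (y): the tail of \<open>ys\<close> gives up one
      element for z. Swapping y and z makes \<open>y # us\<close>, one shorter than
      \<open>ys\<close>, regular modulo J + (z).\<close>
    obtain us where us: "length us = length ys' - 1" "set us \<subseteq> m"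
      "regular_list R (adjoin R (adjoin R J y) z) us"
      using Suc.hyps(1)[of ys' "adjoin R J y" z] Suc.hyps(2) Suc.prems ys z adjoin_ideal[OF J yc] by auto
    have "regular_list R (adjoin R J z) (y # us)"
      using us(3) regular_mod_swap[OF J y(2) z(2,4)] adjoin_commute[OF J yc zc] by simp
    moreover have "n = length (y # us)" using us(1) Suc.hyps(2) ys Cons by simp
    \<comment> \<open>Second exchange, modulo J + (z): now t enters at the cost of one more element.
      Swapping t and z puts z back at the head, so only one element is lost in total.\<close>
    ultimately obtain vs where vs: "length vs = n - 1" "set vs \<subseteq> m"
      "regular_list R (adjoin R (adjoin R J z) t) vs"
      using Suc.hyps(1)[of "y # us" "adjoin R J z" t] us(2) y(1) t(1)
        regular_mod_swap[OF J t(2) z(2,3)] adjoin_ideal[OF J zc] by auto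
    have "regular_list R (adjoin R J t) (z # vs)"
      using vs(3) z(3) adjoin_commute[OF J tc zc] by simp
    moreover have "length (z # vs) = length ys - 1" using vs(1) Suc.hyps(2) ys Cons by simp
    ultimately show ?thesis using z(1) vs(2) by (intro exI[of _ "z # vs"]) auto
  qed
qed

end

section \<open>Cohen--Macaulay rings modulo a regular element\<close>

lemma (in cring) regular_list_genideal_iff:
  assumes "S \<subseteq> carrier R"
  shows "regular_list R (Idl S) xs \<longleftrightarrow> set xs \<subseteq> carrier R \<and>
    (\<forall>i < length xs. \<forall>a \<in> carrier R.
       xs ! i \<otimes> a \<in> Idl (S \<union> set (take i xs)) \<longrightarrow> a \<in> Idl (S \<union> set (take i xs)))"
  using assms
proof (induction xs arbitrary: S)
  case Nil
  then show ?case by simp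
next
  case (Cons x xs)
  show ?case
  proof (cases "x \<in> carrier R")
    case False
    then show ?thesis by (auto simp: regular_mod_def)
  next
    case True
    then have S: "insert x S \<subseteq> carrier R" using Cons.prems by blast
    show ?thesis
      using Cons.IH[OF S] adjoin_genideal[OF Cons.prems True] True
      by (simp add: regular_mod_def All_less_Suc2 conj_ac)
  qed
qed

lemma (in cring) genideal_empty: "Idl {} = {\<zero>}"
proof
  show "Idl {} \<subseteq> {\<zero>}" by (rule genideal_minimal[OF zeroideal]) simp
  show "{\<zero>} \<subseteq> Idl {}" using ideal_zero[OF genideal_ideal[of "{}"]] by simp
qed

lemma (in cring) regular_sequence_iff:
  "regular_sequence R xs \<longleftrightarrow> regular_list R {\<zero>} xs \<and> Idl (set xs) \<noteq> carrier R"
  using regular_list_genideal_iff[of "{}" xs] genideal_empty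
  by (auto simp: regular_sequence_def)

lemma (in noetherian_cring) maximalideal_exists:
  assumes "\<one> \<noteq> \<zero>"
  shows "\<exists>M. maximalideal M R"
proof -
  define S where "S = {I. ideal I R \<and> \<one> \<notin> I}"
  have "{\<zero>} \<in> S" using zeroideal assms unfolding S_def by auto
  then obtain M where M: "M \<in> S" "\<forall>I \<in> S. M \<subseteq> I \<longrightarrow> I = M"
    using maximal_ideal_in_family[of S] unfolding S_def by blast
  have "maximalideal M R"
  proof (rule maximalidealI)
    show "ideal M R" "carrier R \<noteq> M" using M(1) unfolding S_def by auto
    fix J assume J: "ideal J R" "M \<subseteq> J" "J \<subseteq> carrier R"
    show "J = M \<or> J = carrier R"
      using M(2) J ideal.one_imp_carrier[OF J(1)] unfolding S_def by blast
  qed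
  then show ?thesis by blast
qed

text \<open>The inequality common to all Noetherian rings; for Cohen--Macaulayness of a quotient
  this leaves only the reverse one.\<close>

lemma (in noetherian_cring) ideal_depth_le_krull_dim:
  assumes "primeideal m R"
  shows "ideal_depth R m \<le> krull_dim R"
  unfolding ideal_depth_def
proof (rule Sup_least, clarify)
  fix xs assume xs: "set xs \<subseteq> m" "regular_sequence R xs"
  have "{\<zero>} \<subseteq> m" using ideal_zero[OF primeideal.axioms(1)[OF assms]] by simp
  moreover have "regular_list R {\<zero>} xs" using xs(2) by (simp add: regular_sequence_iff)
  ultimately obtain P where "\<forall>i \<le> length xs. primeideal (P i) R" "\<forall>i < length xs. P i \<subset> P (Suc i)"
    using prime_chain_of_regular_list[OF assms zeroideal _ xs(1)] by metis
  then show "enat (length xs) \<le> krull_dim R"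
    unfolding krull_dim_def by (intro Sup_upper) blast
qed

section \<open>Images and preimages under surjective ring homomorphisms\<close>

locale surjective_cring_hom = R?: cring R + S?: cring S + ring_hom_ring R S h
  for R (structure) and S (structure) and h +
  assumes surj: "h ` carrier R = carrier S"
begin

lemma image_preimage: "I \<subseteq> carrier S \<Longrightarrow> h ` {r \<in> carrier R. h r \<in> I} = I"
proof
  assume I: "I \<subseteq> carrier S"
  show "I \<subseteq> h ` {r \<in> carrier R. h r \<in> I}"
  proof
    fix s assume s: "s \<in> I"
    then obtain r where "r \<in> carrier R" "s = h r" using surj I by blast
    then show "s \<in> h ` {r \<in> carrier R. h r \<in> I}" using s by simp
  qed
qed blast

lemma image_ideal:
  assumes I: "ideal I R"
  shows "ideal (h ` I) S"
proof (rule idealI)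
  show "ring S" by (rule S.ring_axioms)
  have Ic: "I \<subseteq> carrier R" using I by (auto intro: ideal_carrier)
  show "subgroup (h ` I) (add_monoid S)"
  proof (rule S.add.subgroupI)
    show "h ` I \<subseteq> carrier S" using Ic by auto
    show "h ` I \<noteq> {}" using ideal_zero[OF I] by blast
    fix a assume "a \<in> h ` I"
    then obtain x where x: "x \<in> I" "a = h x" by blast
    have "\<ominus>\<^bsub>R\<^esub> x \<in> I" using I x(1) by (meson additive_subgroup.a_inv_closed ideal.axioms(1))
    then show "\<ominus>\<^bsub>S\<^esub> a \<in> h ` I"
      unfolding x(2) hom_a_inv[OF subsetD[OF Ic x(1)], symmetric] by (rule imageI)
    fix b assume "b \<in> h ` I"
    then obtain y where y: "y \<in> I" "b = h y" by blast
    show "a \<oplus>\<^bsub>S\<^esub> b \<in> h ` I"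
      unfolding x(2) y(2) hom_add[OF subsetD[OF Ic x(1)] subsetD[OF Ic y(1)], symmetric]
      by (rule imageI) (rule ideal_add[OF I x(1) y(1)])
  qed
  fix a s assume "a \<in> h ` I" "s \<in> carrier S"
  then obtain x r where x: "x \<in> I" "a = h x" "r \<in> carrier R" "s = h r" using surj by blast
  have "r \<otimes>\<^bsub>R\<^esub> x \<in> I" "x \<otimes>\<^bsub>R\<^esub> r \<in> I" using I x by (auto intro: ideal_lmult ideal_rmult)
  then have "h (r \<otimes>\<^bsub>R\<^esub> x) \<in> h ` I" "h (x \<otimes>\<^bsub>R\<^esub> r) \<in> h ` I" by auto
  then show "s \<otimes>\<^bsub>S\<^esub> a \<in> h ` I" "a \<otimes>\<^bsub>S\<^esub> s \<in> h ` I"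
    using x subsetD[OF Ic x(1)] by simp_all
qed

lemma image_adjoin:
  assumes "I \<subseteq> carrier R" "x \<in> carrier R"
  shows "h ` adjoin R I x = adjoin S (h ` I) (h x)"
proof
  show "h ` adjoin R I x \<subseteq> adjoin S (h ` I) (h x)"
  proof
    fix y assume "y \<in> h ` adjoin R I x"
    then obtain j r where "j \<in> I" "r \<in> carrier R" "y = h (j \<oplus>\<^bsub>R\<^esub> r \<otimes>\<^bsub>R\<^esub> x)"
      by (auto elim: adjoinE)
    then have "h j \<oplus>\<^bsub>S\<^esub> h r \<otimes>\<^bsub>S\<^esub> h x \<in> adjoin S (h ` I) (h x)" "y = h j \<oplus>\<^bsub>S\<^esub> h r \<otimes>\<^bsub>S\<^esub> h x"
      using assms by (auto intro!: S.in_adjoinI)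
    then show "y \<in> adjoin S (h ` I) (h x)" by simp
  qed
  show "adjoin S (h ` I) (h x) \<subseteq> h ` adjoin R I x"
  proof
    fix y assume "y \<in> adjoin S (h ` I) (h x)"
    then obtain j s where j: "j \<in> I" "s \<in> carrier S" "y = h j \<oplus>\<^bsub>S\<^esub> s \<otimes>\<^bsub>S\<^esub> h x"
      by (auto elim!: adjoinE)
    then obtain r where r: "r \<in> carrier R" "s = h r" using surj by blast
    have "y = h (j \<oplus>\<^bsub>R\<^esub> r \<otimes>\<^bsub>R\<^esub> x)" using j r assms by auto
    then show "y \<in> h ` adjoin R I x" using j(1) r(1) by (auto intro: R.in_adjoinI)
  qed
qed

lemma noetherian_image:
  assumes "noetherian_ring R"
  shows "noetherian_ring S"
proof (rule S.noetherian_ringI)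
  fix I assume I: "ideal I S"
  let ?J = "{r \<in> carrier R. h r \<in> I}"
  obtain A where A: "A \<subseteq> carrier R" "finite A" "?J = Idl\<^bsub>R\<^esub> A"
    using noetherian_ring.finetely_gen[OF assms ideal_vimage[OF I]] by blast
  have hA: "h ` A \<subseteq> carrier S" using A(1) by auto
  have "I = Idl\<^bsub>S\<^esub> (h ` A)"
  proof
    have "A \<subseteq> {r \<in> carrier R. h r \<in> Idl\<^bsub>S\<^esub> (h ` A)}"
      using A(1) S.genideal_self[OF hA] by auto
    then have "?J \<subseteq> {r \<in> carrier R. h r \<in> Idl\<^bsub>S\<^esub> (h ` A)}"
      unfolding A(3) using ideal_vimage[OF S.genideal_ideal[OF hA]] by (intro R.genideal_minimal)
    then have "h ` ?J \<subseteq> Idl\<^bsub>S\<^esub> (h ` A)" by blast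
    moreover have "I \<subseteq> carrier S" using ideal_carrier[OF I] by blast
    ultimately show "I \<subseteq> Idl\<^bsub>S\<^esub> (h ` A)" using image_preimage[of I] by simp
    have "A \<subseteq> ?J" unfolding A(3) using R.genideal_self[OF A(1)] .
    then show "Idl\<^bsub>S\<^esub> (h ` A) \<subseteq> I" by (intro S.genideal_minimal[OF I]) auto
  qed
  then show "\<exists>A \<subseteq> carrier S. finite A \<and> I = Idl\<^bsub>S\<^esub> A" using hA A(2) by blast
qed

lemma maximalideal_vimage:
  assumes M: "maximalideal M S"
  shows "maximalideal {r \<in> carrier R. h r \<in> M} R"
proof (rule maximalidealI)
  have Mi: "ideal M S" using M by (rule maximalideal.axioms)
  have Mc: "M \<subseteq> carrier S" using Mi by (auto intro: ideal_carrier)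
  show "ideal {r \<in> carrier R. h r \<in> M} R" using ideal_vimage[OF Mi] .
  show "carrier R \<noteq> {r \<in> carrier R. h r \<in> M}"
    using image_preimage[OF Mc] surj maximalideal.I_notcarr[OF M] by auto
  fix J assume J: "ideal J R" "{r \<in> carrier R. h r \<in> M} \<subseteq> J" "J \<subseteq> carrier R"
  have "M \<subseteq> h ` J" using image_preimage[OF Mc] J(2) by blast
  moreover have "h ` J \<subseteq> carrier S" using J(3) by auto
  ultimately have "h ` J = M \<or> h ` J = carrier S"
    using maximalideal.I_maximal[OF M image_ideal[OF J(1)]] by blast
  moreover have "J = carrier R" if hJ: "h ` J = carrier S"
  proof -
    obtain x where x: "x \<in> J" "h x = \<one>\<^bsub>S\<^esub>" 
    proof -
      have "\<one>\<^bsub>S\<^esub> \<in> h ` J" unfolding hJ by (rule S.one_closed)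
      then show thesis using that by (auto simp: image_iff)
    qed
    have xc: "x \<in> carrier R" using x J by blast
    have "h (\<one>\<^bsub>R\<^esub> \<ominus>\<^bsub>R\<^esub> x) = \<zero>\<^bsub>S\<^esub>" using x(2) xc by (simp add: R.minus_eq S.r_neg)
    then have "\<one>\<^bsub>R\<^esub> \<ominus>\<^bsub>R\<^esub> x \<in> J" using J(2) ideal_zero[OF Mi] xc by auto
    then have "(\<one>\<^bsub>R\<^esub> \<ominus>\<^bsub>R\<^esub> x) \<oplus>\<^bsub>R\<^esub> x \<in> J" using ideal_add[OF J(1)] x(1) by blast
    moreover have "(\<one>\<^bsub>R\<^esub> \<ominus>\<^bsub>R\<^esub> x) \<oplus>\<^bsub>R\<^esub> x = \<one>\<^bsub>R\<^esub>" using xc by (simp add: R.minus_eq R.a_assoc R.l_neg)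
    ultimately show ?thesis using ideal.one_imp_carrier[OF J(1)] by simp
  qed
  ultimately show "J = {r \<in> carrier R. h r \<in> M} \<or> J = carrier R" using J by blast
qed

lemma regular_mod_image:
  assumes J: "ideal J R" "{r \<in> carrier R. h r = \<zero>\<^bsub>S\<^esub>} \<subseteq> J" and x: "regular_mod R J x"
  shows "regular_mod S (h ` J) (h x)"
  unfolding regular_mod_def
proof (intro conjI ballI impI)
  have xc: "x \<in> carrier R" using x by (rule regular_mod_carrier)
  then show "h x \<in> carrier S" by simp
  fix b assume b: "b \<in> carrier S" "h x \<otimes>\<^bsub>S\<^esub> b \<in> h ` J"
  obtain a where a: "a \<in> carrier R" "b = h a" using b(1) surj by blast
  obtain j where j: "j \<in> J" "h x \<otimes>\<^bsub>S\<^esub> b = h j" using b(2) by blast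
  have jc: "j \<in> carrier R" using J(1) j(1) by (rule ideal_carrier)
  have "h (x \<otimes>\<^bsub>R\<^esub> a) = h j" using j(2) a xc by simp
  then have "h (x \<otimes>\<^bsub>R\<^esub> a \<ominus>\<^bsub>R\<^esub> j) = \<zero>\<^bsub>S\<^esub>" using jc xc a(1) by (simp add: R.minus_eq S.r_neg)
  then have "x \<otimes>\<^bsub>R\<^esub> a \<ominus>\<^bsub>R\<^esub> j \<in> J" using J(2) xc a(1) jc by auto
  then have "(x \<otimes>\<^bsub>R\<^esub> a \<ominus>\<^bsub>R\<^esub> j) \<oplus>\<^bsub>R\<^esub> j \<in> J" using ideal_add[OF J(1)] j(1) by blast
  moreover have "(x \<otimes>\<^bsub>R\<^esub> a \<ominus>\<^bsub>R\<^esub> j) \<oplus>\<^bsub>R\<^esub> j = x \<otimes>\<^bsub>R\<^esub> a"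
    using xc a(1) jc by (simp add: R.minus_eq R.a_assoc R.l_neg)
  ultimately have "a \<in> J" using regular_modD[OF x a(1)] by simp
  then show "b \<in> h ` J" using a(2) by blast
qed

lemma regular_list_image:
  assumes "ideal J R" "{r \<in> carrier R. h r = \<zero>\<^bsub>S\<^esub>} \<subseteq> J" "regular_list R J xs"
  shows "regular_list S (h ` J) (map h xs)"
  using assms
proof (induction xs arbitrary: J)
  case Nil
  then show ?case by simp
next
  case (Cons x xs)
  have xc: "x \<in> carrier R" using Cons.prems(3) by (auto dest: regular_mod_carrier)
  have Jc: "J \<subseteq> carrier R" using Cons.prems(1) by (auto intro: ideal_carrier)
  have "regular_list S (h ` adjoin R J x) (map h xs)"
    using Cons.IH[OF R.adjoin_ideal[OF Cons.prems(1) xc]] R.adjoin_superset[OF Cons.prems(1) xc]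
      Cons.prems by auto
  then show ?case
    using regular_mod_image[OF Cons.prems(1,2)] Cons.prems(3) image_adjoin[OF Jc xc] by simp
qed

text \<open>A chain of length k in S is pulled back to R and extended below; equality of depth and
  dimension in R then supplies at least k + 1 regular elements, which after an exchange for t leave
  at least k to map to S. Treating each k separately avoids subtraction in \<open>enat\<close> and
  any appeal to finite dimension.\<close>

theorem cohen_macaulay_local_image:
  assumes CM: "cohen_macaulay_local R" and nontriv: "\<one>\<^bsub>S\<^esub> \<noteq> \<zero>\<^bsub>S\<^esub>"
    and t: "regular_mod R {\<zero>\<^bsub>R\<^esub>} t" and ker: "{r \<in> carrier R. h r = \<zero>\<^bsub>S\<^esub>} = PIdl\<^bsub>R\<^esub> t"
  shows "cohen_macaulay_local S"
proof -
  obtain m where m: "{M. maximalideal M R} = {m}" and depth: "ideal_depth R m = krull_dim R"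
    and noeth: "noetherian_ring R"
    using CM unfolding cohen_macaulay_local_def by blast
  interpret R': noetherian_cring R using noeth by (simp add: noetherian_cring_def R.cring_axioms)
  interpret S': noetherian_cring S
    using noetherian_image[OF noeth] by (simp add: noetherian_cring_def S.cring_axioms)
  have vm: "{r \<in> carrier R. h r \<in> M} = m" if "maximalideal M S" for M
  proof -
    have "{r \<in> carrier R. h r \<in> M} \<in> {M. maximalideal M R}"
      using maximalideal_vimage[OF that] by (rule CollectI)
    then show ?thesis unfolding m by (rule singletonD)
  qed
  have Mhm: "M = h ` m" if "maximalideal M S" for M
    using image_preimage[of M] vm[OF that] ideal_carrier[OF maximalideal.axioms(1)[OF that]] by auto
  obtain M where M: "maximalideal M S" using S'.maximalideal_exists[OF nontriv] by blast
  have uniq: "{M. maximalideal M S} = {h ` m}" using M Mhm by auto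
  have hm: "maximalideal (h ` m) S" using M Mhm by simp
  have mi: "ideal m R" using m maximalideal.axioms(1) by blast
  have tc: "t \<in> carrier R" using t by (rule regular_mod_carrier)
  have tker: "h t = \<zero>\<^bsub>S\<^esub>" using ker R.cgenideal_self[OF tc] by blast
  have tm: "t \<in> m" using vm[OF M] tker tc ideal_zero[OF maximalideal.axioms(1)[OF M]] by auto
  have le: "ideal_depth S (h ` m) \<le> krull_dim S"
    using S'.ideal_depth_le_krull_dim[OF S.maximalideal_prime[OF hm]] .
  have "krull_dim S \<le> ideal_depth S (h ` m)"
    unfolding krull_dim_def
  proof (rule Sup_least, clarify)
    fix k and P :: "nat \<Rightarrow> 'c set"
    assume P: "\<forall>i \<le> k. primeideal (P i) S" "\<forall>i < k. P i \<subset> P (Suc i)"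
    define Q where "Q i = {r \<in> carrier R. h r \<in> P i}" for i
    have Qp: "primeideal (Q i) R" if "i \<le> k" for i
      using primeideal_vimage[OF R.cring_axioms] P(1) that unfolding Q_def by blast
    have Pc: "P i \<subseteq> carrier S" if "i \<le> k" for i
    proof -
      have "primeideal (P i) S" using P(1) that by simp
      from ideal_carrier[OF primeideal.axioms(1)[OF this]] show ?thesis by (rule subsetI)
    qed
    have Qs: "Q i \<subset> Q (Suc i)" if "i < k" for i
    proof -
      have "Q i \<noteq> Q (Suc i)"
        using image_preimage[OF Pc, of i] image_preimage[OF Pc, of "Suc i"] P(2) that
        unfolding Q_def by (metis Suc_leI less_imp_le_nat psubsetE subset_refl)
      then show ?thesis using P(2) that unfolding Q_def by blast
    qed
    have "t \<in> Q 0" "\<zero>\<^bsub>R\<^esub> \<in> Q 0"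
      using tker tc P(1) ideal_zero[OF primeideal.axioms(1)[of "P 0" S]] unfolding Q_def by auto
    \<comment> \<open>The additional prime at the bottom exists because \<open>Q 0\<close> contains
      the regular element t.\<close>
    then obtain Q' where Q': "primeideal Q' R" "Q' \<subset> Q 0"
      using R'.prime_below_regular[OF Qp R.zeroideal _ _ t, of 0] by blast
    have "enat (Suc k) \<le> krull_dim R"
      unfolding krull_dim_def
    proof (intro Sup_upper CollectI exI conjI allI impI refl)
      show "primeideal (case_nat Q' Q i) R" if "i \<le> Suc k" for i
        using that Q' Qp by (auto split: nat.split)
      show "case_nat Q' Q i \<subset> case_nat Q' Q (Suc i)" if "i < Suc k" for i
        using that Q' Qs by (auto split: nat.split)
    qed (rule refl)
    \<comment> \<open>The strict inequality makes the supremum yield an actual regular sequence, of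
      length above k.\<close>
    then have "enat k < ideal_depth R m" unfolding depth by (simp add: Suc_ile_eq)
    then obtain ys where ys: "k < length ys" "set ys \<subseteq> m" "regular_sequence R ys"
      unfolding ideal_depth_def less_Sup_iff by auto
    have "regular_list R {\<zero>\<^bsub>R\<^esub>} ys" using ys(3) R.regular_sequence_iff by blast
    then obtain xs where xs: "length xs = length ys - 1" "set xs \<subseteq> m"
      "regular_list R (PIdl\<^bsub>R\<^esub> t) xs"
      using R'.regular_list_exchange[OF mi R.zeroideal tm t ys(2)] R.adjoin_zero[OF tc] by auto
    have "h ` (PIdl\<^bsub>R\<^esub> t) = {\<zero>\<^bsub>S\<^esub>}" unfolding ker[symmetric] using R.zero_closed by force
    then have "regular_list S {\<zero>\<^bsub>S\<^esub>} (map h xs)"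
      using regular_list_image[OF R.cgenideal_ideal[OF tc] _ xs(3)] ker by simp
    moreover have sub: "set (map h xs) \<subseteq> h ` m" using xs(2) by auto
    then have "Idl\<^bsub>S\<^esub> (set (map h xs)) \<subseteq> h ` m"
      using hm maximalideal.axioms(1) S.genideal_minimal by blast
    then have "Idl\<^bsub>S\<^esub> (set (map h xs)) \<noteq> carrier S"
      using maximalideal.I_notcarr[OF hm] ideal_carrier[OF maximalideal.axioms(1)[OF hm]] by blast
    ultimately have "regular_sequence S (map h xs)" by (simp add: S.regular_sequence_iff)
    then have "enat (length (map h xs)) \<le> ideal_depth S (h ` m)"
      unfolding ideal_depth_def using sub by (intro Sup_upper) blast
    moreover have "enat k \<le> enat (length (map h xs))" using xs(1) ys(1) by simp
    ultimately show "enat k \<le> ideal_depth S (h ` m)" by (rule order_trans[rotated])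
  qed
  then show ?thesis
    unfolding cohen_macaulay_local_def
    using uniq le S.cring_axioms noetherian_image[OF noeth] by auto
qed

end

section \<open>Localization at a prime\<close>

context primeideal
begin

abbreviation frac :: "'a \<Rightarrow> 'a \<Rightarrow> ('a \<times> 'a) set" where
  "frac \<equiv> loc_frac R I"

lemma one_denominator: "\<one> \<in> carrier R - I"
  using I_notcarr one_imp_carrier by auto

lemma mult_denominator: "s \<in> carrier R - I \<Longrightarrow> t \<in> carrier R - I \<Longrightarrow> s \<otimes> t \<in> carrier R - I"
  using I_prime by auto

lemma loc_relI:
  "a \<in> carrier R \<Longrightarrow> s \<in> carrier R - I \<Longrightarrow> b \<in> carrier R \<Longrightarrow> t \<in> carrier R - I \<Longrightarrow>
    u \<in> carrier R - I \<Longrightarrow> u \<otimes> (t \<otimes> a \<ominus> s \<otimes> b) = \<zero> \<Longrightarrow> ((a, s), (b, t)) \<in> loc_rel R I"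
  unfolding loc_rel_def by blast

lemma loc_relE:
  assumes "((a, s), (b, t)) \<in> loc_rel R I"
  obtains u where "a \<in> carrier R" "s \<in> carrier R - I" "b \<in> carrier R" "t \<in> carrier R - I"
    "u \<in> carrier R - I" "u \<otimes> (t \<otimes> a \<ominus> s \<otimes> b) = \<zero>"
  using assms unfolding loc_rel_def by blast

lemma loc_rel_equiv: "equiv (carrier R \<times> (carrier R - I)) (loc_rel R I)"
proof (rule equivI)
  show "loc_rel R I \<subseteq> (carrier R \<times> (carrier R - I)) \<times> (carrier R \<times> (carrier R - I))"
    unfolding loc_rel_def by blast
  show "refl_on (carrier R \<times> (carrier R - I)) (loc_rel R I)"
  proof (rule refl_onI)
    fix x assume "x \<in> carrier R \<times> (carrier R - I)"
    then obtain a s where x: "x = (a, s)" "a \<in> carrier R" "s \<in> carrier R - I" by auto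
    have "s \<otimes> a \<ominus> s \<otimes> a = \<zero>" using x by (simp add: minus_eq r_neg)
    then show "(x, x) \<in> loc_rel R I" using x one_denominator by (auto intro!: loc_relI[of _ _ _ _ \<one>])
  qed
  show "sym (loc_rel R I)"
  proof (rule symI)
    fix x y assume xy: "(x, y) \<in> loc_rel R I"
    obtain a s b t where e: "x = (a, s)" "y = (b, t)" by (metis surj_pair)
    from xy[unfolded e] obtain u where h: "a \<in> carrier R" "s \<in> carrier R - I" "b \<in> carrier R"
      "t \<in> carrier R - I" "u \<in> carrier R - I" "u \<otimes> (t \<otimes> a \<ominus> s \<otimes> b) = \<zero>" by (rule loc_relE)
    have c: "u \<in> carrier R" "t \<in> carrier R" "s \<in> carrier R" using h by auto
    have "u \<otimes> (s \<otimes> b \<ominus> t \<otimes> a) = \<ominus> (u \<otimes> (t \<otimes> a \<ominus> s \<otimes> b))" using c h(1,3) by algebra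
    then show "(y, x) \<in> loc_rel R I" unfolding e using h by (intro loc_relI[of _ _ _ _ u]) auto
  qed
  show "trans (loc_rel R I)"
  proof (rule transI)
    fix x y z assume xy: "(x, y) \<in> loc_rel R I" and yz: "(y, z) \<in> loc_rel R I"
    obtain a s b t c w where e: "x = (a, s)" "y = (b, t)" "z = (c, w)" by (metis surj_pair)
    from xy[unfolded e] obtain u where h: "a \<in> carrier R" "s \<in> carrier R - I" "b \<in> carrier R"
      "t \<in> carrier R - I" "u \<in> carrier R - I" "u \<otimes> (t \<otimes> a \<ominus> s \<otimes> b) = \<zero>" by (rule loc_relE)
    from yz[unfolded e] obtain v where k: "c \<in> carrier R" "w \<in> carrier R - I"
      "v \<in> carrier R - I" "v \<otimes> (w \<otimes> b \<ominus> t \<otimes> c) = \<zero>" by (rule loc_relE)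
    have cr: "u \<in> carrier R" "v \<in> carrier R" "t \<in> carrier R" "s \<in> carrier R" "w \<in> carrier R"
      using h k by auto
    \<comment> \<open>The witness must also absorb the middle denominator t, which cannot be
      cancelled in a ring with zero divisors.\<close>
    have "(u \<otimes> v \<otimes> t) \<otimes> (w \<otimes> a \<ominus> s \<otimes> c) =
      (v \<otimes> w) \<otimes> (u \<otimes> (t \<otimes> a \<ominus> s \<otimes> b)) \<oplus> (u \<otimes> s) \<otimes> (v \<otimes> (w \<otimes> b \<ominus> t \<otimes> c))"
      using cr h(1,3) k(1) by algebra
    then have "(u \<otimes> v \<otimes> t) \<otimes> (w \<otimes> a \<ominus> s \<otimes> c) = \<zero>" using h(6) k(4) cr by simp
    moreover have "u \<otimes> v \<otimes> t \<in> carrier R - I" using h k by (intro mult_denominator)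
    ultimately show "(x, z) \<in> loc_rel R I" unfolding e using h k by (intro loc_relI) auto
  qed
qed

lemma frac_eq_iff:
  assumes "a \<in> carrier R" "s \<in> carrier R - I" "b \<in> carrier R" "t \<in> carrier R - I"
  shows "frac a s = frac b t \<longleftrightarrow> (\<exists>u \<in> carrier R - I. u \<otimes> (t \<otimes> a \<ominus> s \<otimes> b) = \<zero>)"
proof -
  have "frac a s = frac b t \<longleftrightarrow> ((a, s), (b, t)) \<in> loc_rel R I"
    unfolding loc_frac_def using assms by (intro eq_equiv_class_iff[OF loc_rel_equiv]) auto
  then show ?thesis using assms unfolding loc_rel_def by blast
qed

lemma frac_eqI:
  "((a, s), (b, t)) \<in> loc_rel R I \<Longrightarrow> frac a s = frac b t"
  unfolding loc_frac_def by (rule equiv_class_eq[OF loc_rel_equiv])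

lemma frac_mult:
  assumes "a \<in> carrier R" "s \<in> carrier R - I" "b \<in> carrier R" "t \<in> carrier R - I"
  shows "frac a s \<otimes>\<^bsub>localization R I\<^esub> frac b t = frac (a \<otimes> b) (s \<otimes> t)"
proof -
  \<comment> \<open>The product in \<open>localization\<close> is a union over all representatives;
    independence of the representatives collapses it to a single class.\<close>
  have cong: "congruent2 (loc_rel R I) (loc_rel R I) (\<lambda>(a, s) (b, t). frac (a \<otimes> b) (s \<otimes> t))"
  proof (rule congruent2I')
    fix x x' y y' assume xx: "(x, x') \<in> loc_rel R I" and yy: "(y, y') \<in> loc_rel R I"
    obtain a s a' s' b t b' t' where e: "x = (a, s)" "x' = (a', s')" "y = (b, t)" "y' = (b', t')"
      by (metis surj_pair)
    from xx[unfolded e] obtain u where h: "a \<in> carrier R" "s \<in> carrier R - I" "a' \<in> carrier R"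
      "s' \<in> carrier R - I" "u \<in> carrier R - I" "u \<otimes> (s' \<otimes> a \<ominus> s \<otimes> a') = \<zero>" by (rule loc_relE)
    from yy[unfolded e] obtain v where k: "b \<in> carrier R" "t \<in> carrier R - I" "b' \<in> carrier R"
      "t' \<in> carrier R - I" "v \<in> carrier R - I" "v \<otimes> (t' \<otimes> b \<ominus> t \<otimes> b') = \<zero>" by (rule loc_relE)
    have cr: "u \<in> carrier R" "v \<in> carrier R" "s \<in> carrier R" "t \<in> carrier R" "s' \<in> carrier R"
      "t' \<in> carrier R" using h k by auto
    have "(u \<otimes> v) \<otimes> ((s' \<otimes> t') \<otimes> (a \<otimes> b) \<ominus> (s \<otimes> t) \<otimes> (a' \<otimes> b')) =
      (v \<otimes> t' \<otimes> b) \<otimes> (u \<otimes> (s' \<otimes> a \<ominus> s \<otimes> a')) \<oplus> (u \<otimes> s \<otimes> a') \<otimes> (v \<otimes> (t' \<otimes> b \<ominus> t \<otimes> b'))"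
      using cr h(1,3) k(1,3) by algebra
    then have "(u \<otimes> v) \<otimes> ((s' \<otimes> t') \<otimes> (a \<otimes> b) \<ominus> (s \<otimes> t) \<otimes> (a' \<otimes> b')) = \<zero>"
      using h(1,3,6) k(1,3,6) cr by simp
    then have "frac (a \<otimes> b) (s \<otimes> t) = frac (a' \<otimes> b') (s' \<otimes> t')"
      using h k mult_denominator by (intro frac_eqI loc_relI[of _ _ _ _ "u \<otimes> v"]) auto
    then show "(case x of (a, s) \<Rightarrow> \<lambda>(b, t). frac (a \<otimes> b) (s \<otimes> t)) y =
      (case x' of (a, s) \<Rightarrow> \<lambda>(b, t). frac (a \<otimes> b) (s \<otimes> t)) y'" unfolding e by simp
  qed
  show ?thesis
    using UN_equiv_class2[OF loc_rel_equiv loc_rel_equiv cong, of "(a, s)" "(b, t)"] assms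
    by (simp add: localization_def loc_frac_def split_def)
qed

lemma frac_add:
  assumes "a \<in> carrier R" "s \<in> carrier R - I" "b \<in> carrier R" "t \<in> carrier R - I"
  shows "frac a s \<oplus>\<^bsub>localization R I\<^esub> frac b t = frac (t \<otimes> a \<oplus> s \<otimes> b) (s \<otimes> t)"
proof -
  have cong: "congruent2 (loc_rel R I) (loc_rel R I) (\<lambda>(a, s) (b, t). frac (t \<otimes> a \<oplus> s \<otimes> b) (s \<otimes> t))"
  proof (rule congruent2I')
    fix x x' y y' assume xx: "(x, x') \<in> loc_rel R I" and yy: "(y, y') \<in> loc_rel R I"
    obtain a s a' s' b t b' t' where e: "x = (a, s)" "x' = (a', s')" "y = (b, t)" "y' = (b', t')"
      by (metis surj_pair)
    from xx[unfolded e] obtain u where h: "a \<in> carrier R" "s \<in> carrier R - I" "a' \<in> carrier R"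
      "s' \<in> carrier R - I" "u \<in> carrier R - I" "u \<otimes> (s' \<otimes> a \<ominus> s \<otimes> a') = \<zero>" by (rule loc_relE)
    from yy[unfolded e] obtain v where k: "b \<in> carrier R" "t \<in> carrier R - I" "b' \<in> carrier R"
      "t' \<in> carrier R - I" "v \<in> carrier R - I" "v \<otimes> (t' \<otimes> b \<ominus> t \<otimes> b') = \<zero>" by (rule loc_relE)
    have cr: "u \<in> carrier R" "v \<in> carrier R" "s \<in> carrier R" "t \<in> carrier R" "s' \<in> carrier R"
      "t' \<in> carrier R" using h k by auto
    have "(u \<otimes> v) \<otimes> ((s' \<otimes> t') \<otimes> (t \<otimes> a \<oplus> s \<otimes> b) \<ominus> (s \<otimes> t) \<otimes> (t' \<otimes> a' \<oplus> s' \<otimes> b')) =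
      (v \<otimes> t \<otimes> t') \<otimes> (u \<otimes> (s' \<otimes> a \<ominus> s \<otimes> a')) \<oplus> (u \<otimes> s \<otimes> s') \<otimes> (v \<otimes> (t' \<otimes> b \<ominus> t \<otimes> b'))"
      using cr h(1,3) k(1,3) by algebra
    then have "(u \<otimes> v) \<otimes> ((s' \<otimes> t') \<otimes> (t \<otimes> a \<oplus> s \<otimes> b) \<ominus> (s \<otimes> t) \<otimes> (t' \<otimes> a' \<oplus> s' \<otimes> b')) = \<zero>"
      using h(6) k(6) cr by simp
    then have "frac (t \<otimes> a \<oplus> s \<otimes> b) (s \<otimes> t) = frac (t' \<otimes> a' \<oplus> s' \<otimes> b') (s' \<otimes> t')"
      using h k mult_denominator by (intro frac_eqI loc_relI[of _ _ _ _ "u \<otimes> v"]) auto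
    then show "(case x of (a, s) \<Rightarrow> \<lambda>(b, t). frac (t \<otimes> a \<oplus> s \<otimes> b) (s \<otimes> t)) y =
      (case x' of (a, s) \<Rightarrow> \<lambda>(b, t). frac (t \<otimes> a \<oplus> s \<otimes> b) (s \<otimes> t)) y'" unfolding e by simp
  qed
  show ?thesis
    using UN_equiv_class2[OF loc_rel_equiv loc_rel_equiv cong, of "(a, s)" "(b, t)"] assms
    by (simp add: localization_def loc_frac_def split_def)
qed

lemma frac_closed: "a \<in> carrier R \<Longrightarrow> s \<in> carrier R - I \<Longrightarrow> frac a s \<in> carrier (localization R I)"
  unfolding localization_def loc_frac_def by (auto intro!: quotientI)

lemma fracE:
  assumes "x \<in> carrier (localization R I)"
  obtains a s where "a \<in> carrier R" "s \<in> carrier R - I" "x = frac a s"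
  using assms unfolding localization_def loc_frac_def by (auto elim!: quotientE)

lemma localization_one: "\<one>\<^bsub>localization R I\<^esub> = frac \<one> \<one>"
  and localization_zero: "\<zero>\<^bsub>localization R I\<^esub> = frac \<zero> \<one>"
  unfolding localization_def by simp_all

lemma frac_eq_zero_iff:
  assumes "a \<in> carrier R" "s \<in> carrier R - I"
  shows "frac a s = \<zero>\<^bsub>localization R I\<^esub> \<longleftrightarrow> (\<exists>u \<in> carrier R - I. u \<otimes> a = \<zero>)"
proof -
  have "\<one> \<otimes> a \<ominus> s \<otimes> \<zero> = a" using assms by (simp add: minus_eq)
  then show ?thesis
    using frac_eq_iff[OF assms zero_closed one_denominator] by (simp add: localization_zero)
qed

end

text \<open>Provides the ring axioms for a localization of D: it is an image of a localization of C,
  whose ring axioms come with the Cohen--Macaulay hypothesis. They are thus never verified from the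
  fraction construction.\<close>

lemma cring_image:
  assumes A: "cring A" and H: "H \<in> Ring.ring_hom A B" "H ` carrier A = carrier B" "H \<zero>\<^bsub>A\<^esub> = \<zero>\<^bsub>B\<^esub>"
  shows "cring B"
proof -
  interpret A: cring A by (rule A)
  have "ring (B\<lparr>carrier := carrier B, zero := \<zero>\<^bsub>B\<^esub>\<rparr>)"
    using A.ring_hom_imp_img_ring[OF H(1)] unfolding H(2,3) .
  then have B: "ring B" by simp
  have "x \<otimes>\<^bsub>B\<^esub> y = y \<otimes>\<^bsub>B\<^esub> x" if xy: "x \<in> carrier B" "y \<in> carrier B" for x y
  proof -
    obtain a b where "a \<in> carrier A" "b \<in> carrier A" "x = H a" "y = H b"
      using xy unfolding H(2)[symmetric] by blast
    then show ?thesis using ring_hom_mult[OF H(1)] A.m_comm by metis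
  qed
  then show ?thesis
    using B unfolding cring_def by (simp add: comm_monoid_def comm_monoid_axioms_def ring_def)
qed

text \<open>Reduction to the local case: a prime P of D pulls back to a prime Q of C, and h induces
  a surjection from the localization at Q to that at P with kernel generated by t/1.\<close>

theorem cohen_macaulay_ring_mod_regular:
  assumes CM: "cohen_macaulay_ring C" and D: "cring D"
    and hom: "h \<in> Ring.ring_hom C D" "h ` carrier C = carrier D"
    and t: "regular_mod C {\<zero>\<^bsub>C\<^esub>} t" and ker: "{c \<in> carrier C. h c = \<zero>\<^bsub>D\<^esub>} = PIdl\<^bsub>C\<^esub> t"
  shows "cohen_macaulay_ring D"
proof -
  have C: "cring C" "noetherian_ring C" using CM unfolding cohen_macaulay_ring_def by auto
  interpret C: cring C by (rule C)
  interpret D: cring D by (rule D)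
  interpret surjective_cring_hom C D h
    by (intro surjective_cring_hom.intro surjective_cring_hom_axioms.intro ring_hom_ringI2
        C D hom C.ring_axioms D.ring_axioms)
  have tc: "t \<in> carrier C" using t by (rule regular_mod_carrier)
  have ht: "h t = \<zero>\<^bsub>D\<^esub>" using ker C.cgenideal_self[OF tc] by blast
  have "cohen_macaulay_local (localization D P)" if P: "primeideal P D" for P
  proof -
    define Q where "Q = {c \<in> carrier C. h c \<in> P}"
    have Q: "primeideal Q C" unfolding Q_def using primeideal_vimage[OF C(1) P] .
    interpret P: primeideal P D by (rule P)
    interpret Q: primeideal Q C by (rule Q)
    let ?A = "localization C Q" and ?B = "localization D P"
    have hQ: "h s \<in> carrier D - P \<longleftrightarrow> s \<in> carrier C - Q" if "s \<in> carrier C" for s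
      using that unfolding Q_def by auto
    have A: "cohen_macaulay_local ?A" using CM Q unfolding cohen_macaulay_ring_def by blast
    then have Ac: "cring ?A" unfolding cohen_macaulay_local_def by blast
    interpret A: cring ?A by (rule Ac)
    \<comment> \<open>The map a/s to h(a)/h(s), written as a union over representatives; it is well
      defined because h sends the complement of Q into that of P.\<close>
    define H where "H X = (\<Union>(a, s) \<in> X. P.frac (h a) (h s))" for X
    have H: "H (Q.frac a s) = P.frac (h a) (h s)" if as: "a \<in> carrier C" "s \<in> carrier C - Q" for a s
    proof -
      have "congruent (loc_rel C Q) (\<lambda>(a, s). P.frac (h a) (h s))"
      proof (rule congruentI)
        fix x y assume xy: "(x, y) \<in> loc_rel C Q"
        obtain a s b t where e: "x = (a, s)" "y = (b, t)" by (metis surj_pair)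
        from xy[unfolded e] obtain u where k: "a \<in> carrier C" "s \<in> carrier C - Q" "b \<in> carrier C"
          "t \<in> carrier C - Q" "u \<in> carrier C - Q" "u \<otimes>\<^bsub>C\<^esub> (t \<otimes>\<^bsub>C\<^esub> a \<ominus>\<^bsub>C\<^esub> s \<otimes>\<^bsub>C\<^esub> b) = \<zero>\<^bsub>C\<^esub>"
          by (rule Q.loc_relE)
        have "h (u \<otimes>\<^bsub>C\<^esub> (t \<otimes>\<^bsub>C\<^esub> a \<ominus>\<^bsub>C\<^esub> s \<otimes>\<^bsub>C\<^esub> b)) =
          h u \<otimes>\<^bsub>D\<^esub> (h t \<otimes>\<^bsub>D\<^esub> h a \<ominus>\<^bsub>D\<^esub> h s \<otimes>\<^bsub>D\<^esub> h b)"
          using k(1-5) by (simp add: C.minus_eq D.minus_eq)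
        then have "h u \<otimes>\<^bsub>D\<^esub> (h t \<otimes>\<^bsub>D\<^esub> h a \<ominus>\<^bsub>D\<^esub> h s \<otimes>\<^bsub>D\<^esub> h b) = \<zero>\<^bsub>D\<^esub>" using k(6) by simp
        then have "P.frac (h a) (h s) = P.frac (h b) (h t)"
          using k hQ by (intro P.frac_eqI P.loc_relI[of _ _ _ _ "h u"]) auto
        then show "(case x of (a, s) \<Rightarrow> P.frac (h a) (h s)) = (case y of (a, s) \<Rightarrow> P.frac (h a) (h s))"
          unfolding e by simp
      qed
      from UN_equiv_class[OF Q.loc_rel_equiv this, of "(a, s)"] show ?thesis
        using as unfolding H_def loc_frac_def[of C] by simp
    qed
    have Hhom: "H \<in> Ring.ring_hom ?A ?B"
    proof (rule ring_hom_memI)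
      show "H X \<in> carrier ?B" if "X \<in> carrier ?A" for X
        using that by (rule Q.fracE) (use H hQ P.frac_closed in auto)
      fix X Y assume XY: "X \<in> carrier ?A" "Y \<in> carrier ?A"
      obtain a s where X: "a \<in> carrier C" "s \<in> carrier C - Q" "X = Q.frac a s" using XY(1) by (rule Q.fracE)
      obtain b t where Y: "b \<in> carrier C" "t \<in> carrier C - Q" "Y = Q.frac b t" using XY(2) by (rule Q.fracE)
      have c: "s \<in> carrier C" "t \<in> carrier C" using X Y by auto
      have d: "h s \<in> carrier D - P" "h t \<in> carrier D - P" using hQ X Y by auto
      have st: "s \<otimes>\<^bsub>C\<^esub> t \<in> carrier C - Q" using X(2) Y(2) by (rule Q.mult_denominator)
      show "H (X \<otimes>\<^bsub>?A\<^esub> Y) = H X \<otimes>\<^bsub>?B\<^esub> H Y"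
        using X Y c d st by (simp add: Q.frac_mult P.frac_mult H)
      show "H (X \<oplus>\<^bsub>?A\<^esub> Y) = H X \<oplus>\<^bsub>?B\<^esub> H Y"
        using X Y c d st by (simp add: Q.frac_add P.frac_add H)
    next
      show "H \<one>\<^bsub>?A\<^esub> = \<one>\<^bsub>?B\<^esub>"
        using H[OF C.one_closed Q.one_denominator] by (simp add: Q.localization_one P.localization_one)
    qed
    have H0: "H \<zero>\<^bsub>?A\<^esub> = \<zero>\<^bsub>?B\<^esub>"
      using H[OF C.zero_closed Q.one_denominator] by (simp add: Q.localization_zero P.localization_zero)
    have Hsurj: "H ` carrier ?A = carrier ?B"
    proof
      show "H ` carrier ?A \<subseteq> carrier ?B" using ring_hom_closed[OF Hhom] by blast
      show "carrier ?B \<subseteq> H ` carrier ?A"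
      proof
        fix Y assume "Y \<in> carrier ?B"
        then obtain b t where Y: "b \<in> carrier D" "t \<in> carrier D - P" "Y = P.frac b t" by (rule P.fracE)
        obtain a s where a: "a \<in> carrier C" "b = h a" "s \<in> carrier C" "t = h s" using Y(1,2) surj by blast
        have s: "s \<in> carrier C - Q" using hQ a Y(2) by blast
        then have "Y = H (Q.frac a s)" using H a Y by simp
        then show "Y \<in> H ` carrier ?A" using Q.frac_closed[OF a(1) s] by blast
      qed
    qed
    have Bc: "cring ?B" by (rule cring_image[OF Ac Hhom Hsurj H0])
    interpret B: cring ?B by (rule Bc)
    interpret HH: surjective_cring_hom ?A ?B H
      by (intro surjective_cring_hom.intro surjective_cring_hom_axioms.intro ring_hom_ringI2
          Ac Bc Hhom Hsurj A.ring_axioms B.ring_axioms)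
    let ?t = "Q.frac t \<one>\<^bsub>C\<^esub>"
    have ft: "Q.frac c s \<otimes>\<^bsub>?A\<^esub> ?t = Q.frac (c \<otimes>\<^bsub>C\<^esub> t) s" if "c \<in> carrier C" "s \<in> carrier C - Q" for c s
      using that tc Q.one_denominator by (simp add: Q.frac_mult)
    show ?thesis
    proof (rule HH.cohen_macaulay_local_image[OF A, of ?t])
      show "\<one>\<^bsub>?B\<^esub> \<noteq> \<zero>\<^bsub>?B\<^esub>"
        using P.frac_eq_zero_iff[OF D.one_closed P.one_denominator] ideal_zero[OF P.is_ideal]
        by (auto simp: P.localization_one)
      show "regular_mod ?A {\<zero>\<^bsub>?A\<^esub>} ?t"
        unfolding regular_mod_def
      proof (intro conjI ballI impI)
        show tA: "?t \<in> carrier ?A" using tc Q.one_denominator by (rule Q.frac_closed)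
        fix X assume X: "X \<in> carrier ?A" "?t \<otimes>\<^bsub>?A\<^esub> X \<in> {\<zero>\<^bsub>?A\<^esub>}"
        obtain a s where a: "a \<in> carrier C" "s \<in> carrier C - Q" "X = Q.frac a s" using X(1) by (rule Q.fracE)
        have "Q.frac (a \<otimes>\<^bsub>C\<^esub> t) s = \<zero>\<^bsub>?A\<^esub>"
          using X ft[OF a(1,2)] A.m_comm[OF tA X(1)] a(3) by simp
        \<comment> \<open>Regularity survives localization: t (u a) = 0 gives u a = 0, which already
          says a/s = 0.\<close>
        then obtain u where u: "u \<in> carrier C - Q" "u \<otimes>\<^bsub>C\<^esub> (a \<otimes>\<^bsub>C\<^esub> t) = \<zero>\<^bsub>C\<^esub>"
          using Q.frac_eq_zero_iff a tc by auto
        have "t \<otimes>\<^bsub>C\<^esub> (u \<otimes>\<^bsub>C\<^esub> a) = u \<otimes>\<^bsub>C\<^esub> (a \<otimes>\<^bsub>C\<^esub> t)" using u(1) a(1) tc by (simp add: C.m_ac)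
        then have "u \<otimes>\<^bsub>C\<^esub> a = \<zero>\<^bsub>C\<^esub>" using regular_modD[OF t, of "u \<otimes>\<^bsub>C\<^esub> a"] u a(1) by simp
        then have "X = \<zero>\<^bsub>?A\<^esub>" using Q.frac_eq_zero_iff a u(1) by auto
        then show "X \<in> {\<zero>\<^bsub>?A\<^esub>}" by simp
      qed
      show "{X \<in> carrier ?A. H X = \<zero>\<^bsub>?B\<^esub>} = PIdl\<^bsub>?A\<^esub> ?t"
      proof (rule Set.set_eqI, rule iffI)
        fix X assume "X \<in> {X \<in> carrier ?A. H X = \<zero>\<^bsub>?B\<^esub>}"
        then have X: "X \<in> carrier ?A" "H X = \<zero>\<^bsub>?B\<^esub>" by auto
        obtain a s where a: "a \<in> carrier C" "s \<in> carrier C - Q" "X = Q.frac a s" using X(1) by (rule Q.fracE)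
        have "P.frac (h a) (h s) = \<zero>\<^bsub>?B\<^esub>" using X(2) H a by simp
        moreover have "h s \<in> carrier D - P" using hQ a by simp
        ultimately obtain u where u: "u \<in> carrier D - P" "u \<otimes>\<^bsub>D\<^esub> h a = \<zero>\<^bsub>D\<^esub>"
          using P.frac_eq_zero_iff[of "h a" "h s"] a(1) by auto
        obtain v where v: "v \<in> carrier C" "u = h v" using u(1) surj by blast
        have vQ: "v \<in> carrier C - Q" using hQ v u(1) by blast
        have "v \<otimes>\<^bsub>C\<^esub> a \<in> PIdl\<^bsub>C\<^esub> t" using u(2) v a(1) unfolding ker[symmetric] by auto
        then obtain c where c: "c \<in> carrier C" "v \<otimes>\<^bsub>C\<^esub> a = c \<otimes>\<^bsub>C\<^esub> t" unfolding cgenideal_def by blast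
        \<comment> \<open>From v a = c t follows a/s = (c/(v s)) (t/1), an explicit multiple of
          t/1.\<close>
        have vs: "v \<otimes>\<^bsub>C\<^esub> s \<in> carrier C - Q" using vQ a(2) by (rule Q.mult_denominator)
        have sC: "s \<in> carrier C" using a(2) by blast
        have "\<one>\<^bsub>C\<^esub> \<otimes>\<^bsub>C\<^esub> ((v \<otimes>\<^bsub>C\<^esub> s) \<otimes>\<^bsub>C\<^esub> a \<ominus>\<^bsub>C\<^esub> s \<otimes>\<^bsub>C\<^esub> (c \<otimes>\<^bsub>C\<^esub> t)) = \<zero>\<^bsub>C\<^esub>"
          unfolding c(2)[symmetric] using v(1) sC a(1) by (simp add: C.m_ac C.minus_eq C.r_neg)
        then have "X = Q.frac (c \<otimes>\<^bsub>C\<^esub> t) (v \<otimes>\<^bsub>C\<^esub> s)"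
          unfolding a(3) using a(1,2) c(1) tc vs Q.one_denominator
          by (intro Q.frac_eqI Q.loc_relI[of _ _ _ _ "\<one>\<^bsub>C\<^esub>"]) auto
        also have "\<dots> = Q.frac c (v \<otimes>\<^bsub>C\<^esub> s) \<otimes>\<^bsub>?A\<^esub> ?t" using ft[OF c(1) vs] by simp
        finally show "X \<in> PIdl\<^bsub>?A\<^esub> ?t"
          unfolding cgenideal_def using Q.frac_closed[OF c(1) vs] by blast
      next
        fix X assume "X \<in> PIdl\<^bsub>?A\<^esub> ?t"
        then obtain Y where Y: "Y \<in> carrier ?A" "X = Y \<otimes>\<^bsub>?A\<^esub> ?t" unfolding cgenideal_def by blast
        have tA: "?t \<in> carrier ?A" using tc Q.one_denominator by (rule Q.frac_closed)
        have "H ?t = \<zero>\<^bsub>?B\<^esub>" using H[OF tc Q.one_denominator] ht by (simp add: P.localization_zero)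
        then show "X \<in> {X \<in> carrier ?A. H X = \<zero>\<^bsub>?B\<^esub>}"
          using Y tA HH.hom_mult[OF Y(1) tA] HH.hom_closed[OF Y(1)] by simp
      qed
    qed
  qed
  then show ?thesis
    unfolding cohen_macaulay_ring_def using D noetherian_image[OF C(2)] by blast
qed

text \<open>The target D is any image of R with kernel L + (t), not literally a quotient of
  \<open>R Quot L\<close>. This keeps all generators of a sequence inside R and avoids isomorphisms
  between iterated quotients.\<close>

lemma cohen_macaulay_quot_step:
  assumes R: "cring R" and L: "ideal L R" and CM: "cohen_macaulay_ring (R Quot L)" and D: "cring D"
    and f: "f \<in> Ring.ring_hom R D" "f ` carrier R = carrier D"
    and t: "regular_mod R L t" and ker: "{r \<in> carrier R. f r = \<zero>\<^bsub>D\<^esub>} = adjoin R L t"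
  shows "cohen_macaulay_ring D"
proof -
  interpret R: cring R by (rule R)
  interpret L: ideal L R by (rule L)
  interpret D: cring D by (rule D)
  interpret f: ring_hom_ring R D f by (intro ring_hom_ringI2 R.ring_axioms D.ring_axioms f)
  let ?C = "R Quot L" and ?c = "\<lambda>r. L +>\<^bsub>R\<^esub> r"
  have C: "cring ?C" by (rule L.quotient_is_cring[OF R])
  interpret C: cring ?C by (rule C)
  interpret c: ring_hom_ring R ?C ?c by (rule L.rcos_ring_hom_ring)
  have carr: "\<exists>r \<in> carrier R. X = ?c r" if "X \<in> carrier ?C" for X
    using that unfolding FactRing_def A_RCOSETS_def' by auto
  have zero: "\<zero>\<^bsub>?C\<^esub> = L" unfolding FactRing_def by simp
  have cz: "?c r = \<zero>\<^bsub>?C\<^esub> \<longleftrightarrow> r \<in> L" if "r \<in> carrier R" for r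
    unfolding zero using that L.rcos_const_imp_mem R.a_rcos_zero[OF L] by blast
  have tc: "t \<in> carrier R" using t by (rule regular_mod_carrier)
  have fL: "f l = \<zero>\<^bsub>D\<^esub>" if "l \<in> L" for l
    using ker R.adjoin_superset[OF L tc] that by blast
  have ft: "f t = \<zero>\<^bsub>D\<^esub>" using ker R.adjoin_self[OF L tc] by blast
  \<comment> \<open>The factorization of f through the cosets of L: f vanishes on L, so the image of
    a coset is a singleton.\<close>
  define h where "h X = the_elem (f ` X)" for X
  have h: "h (?c r) = f r" if r: "r \<in> carrier R" for r
  proof -
    have "f ` (?c r) = {f r}"
    proof -
      have "f (l \<oplus>\<^bsub>R\<^esub> r) = f r" if "l \<in> L" for l
        using that r fL f.hom_add[OF L.Icarr[OF that] r] by simp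
      moreover have "L \<noteq> {}" using ideal_zero[OF L] by blast
      ultimately show ?thesis unfolding a_r_coset_def' by (simp add: image_UN)
    qed
    then show ?thesis unfolding h_def by simp
  qed
  show ?thesis
  proof (rule cohen_macaulay_ring_mod_regular[OF CM D, of h "?c t"])
    show "h \<in> Ring.ring_hom ?C D"
    proof (rule ring_hom_memI)
      show "h X \<in> carrier D" if "X \<in> carrier ?C" for X using carr[OF that] h by auto
      fix X Y assume "X \<in> carrier ?C" "Y \<in> carrier ?C"
      then obtain x y where xy: "x \<in> carrier R" "y \<in> carrier R" "X = ?c x" "Y = ?c y"
        using carr by metis
      show "h (X \<otimes>\<^bsub>?C\<^esub> Y) = h X \<otimes>\<^bsub>D\<^esub> h Y"
        using xy h c.hom_mult[OF xy(1,2)] by (metis R.m_closed f.hom_mult)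
      show "h (X \<oplus>\<^bsub>?C\<^esub> Y) = h X \<oplus>\<^bsub>D\<^esub> h Y"
        using xy h c.hom_add[OF xy(1,2)] by (metis R.a_closed f.hom_add)
    next
      show "h \<one>\<^bsub>?C\<^esub> = \<one>\<^bsub>D\<^esub>" using h[OF R.one_closed] c.hom_one f.hom_one by simp
    qed
    show "h ` carrier ?C = carrier D"
    proof
      show "h ` carrier ?C \<subseteq> carrier D" using carr h by (metis f.hom_closed image_subsetI)
      show "carrier D \<subseteq> h ` carrier ?C"
      proof
        fix y assume "y \<in> carrier D"
        then obtain r where r: "r \<in> carrier R" "y = f r" using f(2) by blast
        then have "y = h (?c r)" using h by simp
        then show "y \<in> h ` carrier ?C" using c.hom_closed[OF r(1)] by blast
      qed
    qed
    show "regular_mod ?C {\<zero>\<^bsub>?C\<^esub>} (?c t)"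
      unfolding regular_mod_def
    proof (intro conjI ballI impI)
      show "?c t \<in> carrier ?C" using c.hom_closed[OF tc] .
      fix X assume X: "X \<in> carrier ?C" "?c t \<otimes>\<^bsub>?C\<^esub> X \<in> {\<zero>\<^bsub>?C\<^esub>}"
      obtain r where r: "r \<in> carrier R" "X = ?c r" using carr[OF X(1)] by blast
      have "?c (t \<otimes>\<^bsub>R\<^esub> r) = \<zero>\<^bsub>?C\<^esub>" using X(2) c.hom_mult[OF tc r(1)] r(2) by simp
      then have "t \<otimes>\<^bsub>R\<^esub> r \<in> L" using cz[OF R.m_closed[OF tc r(1)]] by blast
      then have "r \<in> L" by (rule regular_modD[OF t r(1)])
      then show "X \<in> {\<zero>\<^bsub>?C\<^esub>}" using cz r by simp
    qed
    show "{X \<in> carrier ?C. h X = \<zero>\<^bsub>D\<^esub>} = PIdl\<^bsub>?C\<^esub> (?c t)"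
    proof (rule Set.set_eqI, rule iffI)
      fix X assume "X \<in> {X \<in> carrier ?C. h X = \<zero>\<^bsub>D\<^esub>}"
      then have X: "X \<in> carrier ?C" "h X = \<zero>\<^bsub>D\<^esub>" by auto
      obtain r where r: "r \<in> carrier R" "X = ?c r" using carr[OF X(1)] by blast
      have "r \<in> adjoin R L t" using r X(2) h unfolding ker[symmetric] by simp
      then obtain l s where l: "l \<in> L" "s \<in> carrier R" "r = l \<oplus>\<^bsub>R\<^esub> s \<otimes>\<^bsub>R\<^esub> t" by (rule adjoinE)
      have lc: "l \<in> carrier R" using L.Icarr[OF l(1)] .
      have "X = ?c l \<oplus>\<^bsub>?C\<^esub> ?c (s \<otimes>\<^bsub>R\<^esub> t)"
        unfolding r(2) l(3) using lc l(2) tc by (intro c.hom_add) auto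
      also have "\<dots> = ?c (s \<otimes>\<^bsub>R\<^esub> t)"
      proof -
        have "?c l = \<zero>\<^bsub>?C\<^esub>" using cz lc l(1) by simp
        then show ?thesis using C.l_zero[OF c.hom_closed, of "s \<otimes>\<^bsub>R\<^esub> t"] l(2) tc by simp
      qed
      also have "\<dots> = ?c s \<otimes>\<^bsub>?C\<^esub> ?c t" using l(2) tc by (rule c.hom_mult)
      finally show "X \<in> PIdl\<^bsub>?C\<^esub> (?c t)" unfolding cgenideal_def using c.hom_closed[OF l(2)] by blast
    next
      fix X assume "X \<in> PIdl\<^bsub>?C\<^esub> (?c t)"
      then obtain Y where Y: "Y \<in> carrier ?C" "X = Y \<otimes>\<^bsub>?C\<^esub> ?c t" unfolding cgenideal_def by blast
      obtain r where r: "r \<in> carrier R" "Y = ?c r" using carr[OF Y(1)] by blast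
      have X: "X = ?c (r \<otimes>\<^bsub>R\<^esub> t)" unfolding Y(2) r(2) using c.hom_mult[OF r(1) tc] by simp
      have "h X = f r \<otimes>\<^bsub>D\<^esub> f t" unfolding X using h[of "r \<otimes>\<^bsub>R\<^esub> t"] r(1) tc by simp
      then have "h X = \<zero>\<^bsub>D\<^esub>" using ft r(1) by simp
      moreover have "X \<in> carrier ?C" unfolding X using c.hom_closed[of "r \<otimes>\<^bsub>R\<^esub> t"] r(1) tc by simp
      ultimately show "X \<in> {X \<in> carrier ?C. h X = \<zero>\<^bsub>D\<^esub>}" by simp
    qed
  qed
qed

text \<open>The list is nonempty because the last regular element carries the property over to D
  itself; for an empty list one would have to transport it along an isomorphism from
  \<open>R Quot L\<close> to D.\<close>

theorem cohen_macaulay_quot_regular_list: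
  assumes R: "cring R" and D: "cring D" and f: "f \<in> Ring.ring_hom R D" "f ` carrier R = carrier D"
    and "ideal L R" "cohen_macaulay_ring (R Quot L)" "ts \<noteq> []" "regular_list R L ts"
    and "{r \<in> carrier R. f r = \<zero>\<^bsub>D\<^esub>} = foldl (adjoin R) L ts"
  shows "cohen_macaulay_ring D"
  using assms(5-)
proof (induction ts arbitrary: L)
  case Nil
  then show ?case by simp
next
  case (Cons t ts)
  have t: "regular_mod R L t" using Cons.prems by simp
  have tc: "t \<in> carrier R" using t by (rule regular_mod_carrier)
  note L' = cring.adjoin_ideal[OF R Cons.prems(1) tc]
  show ?case
  proof (cases ts)
    case Nil
    then show ?thesis
      using cohen_macaulay_quot_step[OF R Cons.prems(1,2) D f t] Cons.prems(5) by simp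
  next
    case (Cons t' ts')
    let ?L = "adjoin R L t"
    interpret R: cring R by (rule R)
    interpret L': ideal ?L R by (rule L')
    \<comment> \<open>At an intermediate stage the target is the quotient by the enlarged ideal,
      with the canonical map.\<close>
    have "cohen_macaulay_ring (R Quot ?L)"
    proof (rule cohen_macaulay_quot_step[OF R Cons.prems(1,2) _ L'.rcos_ring_hom _ t])
      show "cring (R Quot ?L)" by (rule L'.quotient_is_cring[OF R])
      show "(+>\<^bsub>R\<^esub>) ?L ` carrier R = carrier (R Quot ?L)"
        unfolding FactRing_def A_RCOSETS_def' by auto
      have z: "\<zero>\<^bsub>R Quot ?L\<^esub> = ?L" unfolding FactRing_def by simp
      have "?L +>\<^bsub>R\<^esub> r = ?L \<longleftrightarrow> r \<in> ?L" if "r \<in> carrier R" for r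
        using that L'.rcos_const_imp_mem R.a_rcos_zero[OF L'] by blast
      then show "{r \<in> carrier R. ?L +>\<^bsub>R\<^esub> r = \<zero>\<^bsub>R Quot ?L\<^esub>} = ?L"
        unfolding z using L'.Icarr by blast
    qed
    then show ?thesis using Cons.IH[OF L'] Cons.prems Cons by simp
  qed
qed

section \<open>Polynomial rings in matrix variables\<close>

definition zmono :: "('v \<Rightarrow> 'b::comm_ring_1) \<Rightarrow> ('v \<Rightarrow>\<^sub>0 nat) \<Rightarrow> 'b" where
  "zmono x e = (\<Prod>v \<in> Poly_Mapping.keys e. x v ^ Poly_Mapping.lookup e v)"

text \<open>The separate coefficient map c lets one construction serve both for substitutions of
  polynomials (c is \<open>zconst\<close>) and for deformations, whose values are polynomials in a
  further parameter.\<close>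

definition zeval :: "('k::comm_ring_1 \<Rightarrow> 'b::comm_ring_1) \<Rightarrow> ('v \<Rightarrow> 'b) \<Rightarrow> (('v \<Rightarrow>\<^sub>0 nat) \<Rightarrow>\<^sub>0 'k) \<Rightarrow> 'b" where
  "zeval c x p = (\<Sum>e \<in> Poly_Mapping.keys p. c (Poly_Mapping.lookup p e) * zmono x e)"

lemma zmono_superset:
  assumes "finite A" "Poly_Mapping.keys e \<subseteq> A"
  shows "zmono x e = (\<Prod>v \<in> A. x v ^ Poly_Mapping.lookup e v)"
  unfolding zmono_def using assms
  by (intro prod.mono_neutral_left) (auto simp: in_keys_iff)

lemma zmono_add: "zmono x (e + e') = zmono x e * zmono x e'"
proof -
  let ?A = "Poly_Mapping.keys e \<union> Poly_Mapping.keys e'"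
  have fin: "finite ?A" by simp
  show ?thesis
    using zmono_superset[OF fin, of "e + e'" x] zmono_superset[OF fin, of e x]
      zmono_superset[OF fin, of e' x] Poly_Mapping.keys_add[of e e']
    by (simp add: lookup_add power_add prod.distrib)
qed

lemma zmono_zero [simp]: "zmono x 0 = 1"
  by (simp add: zmono_def)

lemma zmono_single [simp]: "zmono x (Poly_Mapping.single v (Suc 0)) = x v"
  by (simp add: zmono_def)

lemma poly_mapping_sum_singles:
  "p = (\<Sum>e \<in> Poly_Mapping.keys p. Poly_Mapping.single e (Poly_Mapping.lookup p e))"
proof (rule poly_mapping_eqI)
  fix e
  show "Poly_Mapping.lookup p e =
    Poly_Mapping.lookup (\<Sum>e \<in> Poly_Mapping.keys p. Poly_Mapping.single e (Poly_Mapping.lookup p e)) e"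
    by (simp add: lookup_sum lookup_single when_def in_keys_iff)
qed

locale zeval_hom = c: comm_ring_hom c for c :: "'k::comm_ring_1 \<Rightarrow> 'b::comm_ring_1"
begin

lemma zeval_superset:
  assumes "finite A" "Poly_Mapping.keys p \<subseteq> A"
  shows "zeval c x p = (\<Sum>e \<in> A. c (Poly_Mapping.lookup p e) * zmono x e)"
  unfolding zeval_def using assms
  by (intro sum.mono_neutral_left) (auto simp: in_keys_iff)

lemma zeval_add: "zeval c x (p + q) = zeval c x p + zeval c x q"
proof -
  let ?A = "Poly_Mapping.keys p \<union> Poly_Mapping.keys q"
  have fin: "finite ?A" by simp
  show ?thesis
    using zeval_superset[OF fin, of "p + q" x] zeval_superset[OF fin, of p x]
      zeval_superset[OF fin, of q x] Poly_Mapping.keys_add[of p q]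
    by (simp add: lookup_add c.hom_add distrib_right sum.distrib)
qed

lemma zeval_zero: "zeval c x 0 = 0"
  by (simp add: zeval_def)

lemma zeval_sum: "zeval c x (sum f A) = (\<Sum>i \<in> A. zeval c x (f i))"
  by (induction A rule: infinite_finite_induct) (auto simp: zeval_add zeval_zero)

lemma zeval_single: "zeval c x (Poly_Mapping.single e a) = c a * zmono x e"
  by (simp add: zeval_def)

lemma zeval_mult: "zeval c x (p * q) = zeval c x p * zeval c x q"
proof -
  let ?s = "\<lambda>p e. Poly_Mapping.single e (Poly_Mapping.lookup p e)"
  have "p * q = (\<Sum>e \<in> Poly_Mapping.keys p. ?s p e) * (\<Sum>e \<in> Poly_Mapping.keys q. ?s q e)"
    using poly_mapping_sum_singles[of p] poly_mapping_sum_singles[of q] by simp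
  also have "\<dots> = (\<Sum>e \<in> Poly_Mapping.keys p. \<Sum>e' \<in> Poly_Mapping.keys q. ?s p e * ?s q e')"
    by (rule sum_product)
  finally have "zeval c x (p * q) =
    (\<Sum>e \<in> Poly_Mapping.keys p. \<Sum>e' \<in> Poly_Mapping.keys q. zeval c x (?s p e * ?s q e'))"
    by (simp add: zeval_sum)
  also have "\<dots> = (\<Sum>e \<in> Poly_Mapping.keys p. \<Sum>e' \<in> Poly_Mapping.keys q.
      (c (Poly_Mapping.lookup p e) * zmono x e) * (c (Poly_Mapping.lookup q e') * zmono x e'))"
    by (intro sum.cong refl) (simp add: mult_single zeval_single c.hom_mult zmono_add mult_ac)
  also have "\<dots> = zeval c x p * zeval c x q"
    unfolding zeval_def by (rule sum_product[symmetric])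
  finally show ?thesis .
qed

lemma zeval_one: "zeval c x 1 = 1"
  using zeval_single[of x 0 1] by simp

sublocale hom: comm_ring_hom "zeval c x" for x
  by unfold_locales (auto simp: zeval_add zeval_mult zeval_one zeval_zero)

end

abbreviation zconst :: "'k::field \<Rightarrow> 'k zpoly" where
  "zconst \<equiv> Poly_Mapping.single 0"

lemma zconst_hom: "comm_ring_hom zconst"
  by unfold_locales (auto simp: single_add mult_single)

interpretation zconst: zeval_hom zconst
  unfolding zeval_hom_def by (rule zconst_hom)

lemma zeval_zvar:
  assumes "zeval_hom c"
  shows "zeval c x (zvar v) = x v"
proof -
  interpret zeval_hom c by (rule assms)
  show ?thesis using zeval_single[of x "Poly_Mapping.single v 1" 1] by (simp add: zvar_def)
qed

lemma zmono_zvar: "zmono zvar e = (Poly_Mapping.single e 1 :: 'k::field zpoly)"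
proof -
  have pow: "(zvar v :: 'k zpoly) ^ m = Poly_Mapping.single (Poly_Mapping.single v m) 1" for v m
    by (induction m) (auto simp: zvar_def mult_single single_add[symmetric])
  have "(\<Prod>v \<in> A. zvar v ^ Poly_Mapping.lookup e v :: 'k zpoly) =
    Poly_Mapping.single (\<Sum>v \<in> A. Poly_Mapping.single v (Poly_Mapping.lookup e v)) 1" if "finite A" for A
    using that by (induction A rule: finite_induct) (auto simp: pow mult_single)
  then show ?thesis
    unfolding zmono_def using poly_mapping_sum_singles[of e] by simp
qed

lemma zeval_id: "zeval zconst zvar p = p"
proof -
  have "zeval zconst zvar p =
    (\<Sum>e \<in> Poly_Mapping.keys p. Poly_Mapping.single e (Poly_Mapping.lookup p e))"
    unfolding zeval_def zmono_zvar by (simp add: mult_single)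
  then show ?thesis using poly_mapping_sum_singles[of p] by simp
qed

section \<open>The polynomial ring in the entries of an n by n matrix\<close>

lemma zring_simps [simp]:
  "(\<oplus>\<^bsub>zring n\<^esub>) = (+)" "(\<otimes>\<^bsub>zring n\<^esub>) = (*)" "\<zero>\<^bsub>zring n\<^esub> = 0" "\<one>\<^bsub>zring n\<^esub> = 1"
  by (simp_all add: zring_def)

lemma in_zring_iff:
  "p \<in> carrier (zring n) \<longleftrightarrow> (\<forall>e \<in> Poly_Mapping.keys p. Poly_Mapping.keys e \<subseteq> {..<n} \<times> {..<n})"
  by (simp add: zring_def)

lemma zring_add: "p \<in> carrier (zring n) \<Longrightarrow> q \<in> carrier (zring n) \<Longrightarrow> p + q \<in> carrier (zring n)"
  using Poly_Mapping.keys_add[of p q] by (fastforce simp: in_zring_iff)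

lemma zring_uminus: "p \<in> carrier (zring n) \<Longrightarrow> - p \<in> carrier (zring n)"
  by (auto simp: in_zring_iff in_keys_iff)

lemma zring_minus: "p \<in> carrier (zring n) \<Longrightarrow> q \<in> carrier (zring n) \<Longrightarrow> p - q \<in> carrier (zring n)"
  using zring_add[of p n "- q"] zring_uminus[of q n] by simp

lemma zring_mult:
  assumes "p \<in> carrier (zring n)" "q \<in> carrier (zring n)"
  shows "p * q \<in> carrier (zring n)"
  unfolding in_zring_iff
proof
  fix e assume "e \<in> Poly_Mapping.keys (p * q)"
  then obtain a b where "e = a + b" "a \<in> Poly_Mapping.keys p" "b \<in> Poly_Mapping.keys q"
    using keys_mult[of p q] by auto
  then show "Poly_Mapping.keys e \<subseteq> {..<n} \<times> {..<n}"
    using assms Poly_Mapping.keys_add[of a b] unfolding in_zring_iff by blast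
qed

lemma zring_zero: "0 \<in> carrier (zring n)" and zring_one: "1 \<in> carrier (zring n)"
  by (auto simp: in_zring_iff)

lemma zring_zconst: "zconst a \<in> carrier (zring n)"
  by (auto simp: in_zring_iff)

lemma zring_zvar: "a < n \<Longrightarrow> b < n \<Longrightarrow> zvar (a, b) \<in> carrier (zring n)"
  by (auto simp: in_zring_iff zvar_def)

lemmas zring_closed = zring_add zring_uminus zring_minus zring_mult zring_zero zring_one
  zring_zconst zring_zvar

lemma zring_power: "p \<in> carrier (zring n) \<Longrightarrow> p ^ m \<in> carrier (zring n)"
  by (induction m) (auto intro: zring_closed)

lemma zring_sum: "(\<And>i. i \<in> A \<Longrightarrow> f i \<in> carrier (zring n)) \<Longrightarrow> sum f A \<in> carrier (zring n)"
  by (induction A rule: infinite_finite_induct) (auto intro: zring_closed)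

lemma zring_cring: "cring (zring n :: 'k::field zpoly ring)"
proof (rule cringI)
  show "abelian_group (zring n :: 'k zpoly ring)"
  proof (rule abelian_groupI)
    fix p assume p: "p \<in> carrier (zring n :: 'k zpoly ring)"
    show "\<exists>q \<in> carrier (zring n). q \<oplus>\<^bsub>zring n\<^esub> p = \<zero>\<^bsub>zring n\<^esub>"
      using zring_uminus[OF p] by (intro bexI[of _ "- p"]) auto
  qed (auto intro: zring_closed)
  show "comm_monoid (zring n :: 'k zpoly ring)"
    by (rule comm_monoidI) (auto intro: zring_closed)
qed (auto simp: distrib_right)

lemma zring_a_inv: "p \<in> carrier (zring n) \<Longrightarrow> \<ominus>\<^bsub>zring n\<^esub> p = - p"
proof -
  assume p: "p \<in> carrier (zring n)"
  interpret cring "zring n :: 'a zpoly ring" by (rule zring_cring)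
  show ?thesis using minus_equality[of "- p" p] zring_uminus[OF p] p by simp
qed

text \<open>By \<open>zeval_id\<close> every p is a sum of constants times products of variables.
  Claims about substitutions, which are ring homomorphisms, thereby reduce to constants and
  variables.\<close>

lemma zring_induct [consumes 1, case_names zconst zvar add mult]:
  assumes "p \<in> carrier (zring n :: 'k::field zpoly ring)"
    and "\<And>a. Q (zconst a)" "\<And>a b. a < n \<Longrightarrow> b < n \<Longrightarrow> Q (zvar (a, b))"
    and add: "\<And>p q. p \<in> carrier (zring n) \<Longrightarrow> q \<in> carrier (zring n) \<Longrightarrow> Q p \<Longrightarrow> Q q \<Longrightarrow> Q (p + q)"
    and mult: "\<And>p q. p \<in> carrier (zring n) \<Longrightarrow> q \<in> carrier (zring n) \<Longrightarrow> Q p \<Longrightarrow> Q q \<Longrightarrow> Q (p * q)"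
  shows "Q p"
proof -
  have pow: "Q (p ^ m) \<and> p ^ m \<in> carrier (zring n)" if "Q p" "p \<in> carrier (zring n)" for p m
    using that assms(2)[of 1] by (induction m) (auto intro: mult zring_closed)
  have mono: "Q (\<Prod>v \<in> A. zvar v ^ Poly_Mapping.lookup e v) \<and>
      (\<Prod>v \<in> A. zvar v ^ Poly_Mapping.lookup e v :: 'k zpoly) \<in> carrier (zring n)"
    if "finite A" "A \<subseteq> {..<n} \<times> {..<n}" for A and e :: "nat \<times> nat \<Rightarrow>\<^sub>0 nat"
    using that
  proof (induction A rule: finite_induct)
    case empty
    then show ?case using assms(2)[of 1] by (auto intro: zring_closed)
  next
    case (insert v A)
    obtain a b where v: "v = (a, b)" "a < n" "b < n" using insert.prems by (cases v) auto
    have "Q (zvar v ^ Poly_Mapping.lookup e v) \<and>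
        (zvar v ^ Poly_Mapping.lookup e v :: 'k zpoly) \<in> carrier (zring n)"
      unfolding v(1) using pow[OF assms(3)[OF v(2,3)] zring_zvar[OF v(2,3)]] by simp
    then show ?case using insert by (auto intro: mult zring_closed)
  qed
  have "Q (\<Sum>e \<in> E. zconst (Poly_Mapping.lookup p e) * zmono zvar e) \<and>
      (\<Sum>e \<in> E. zconst (Poly_Mapping.lookup p e) * zmono zvar e) \<in> carrier (zring n)"
    if "finite E" "E \<subseteq> Poly_Mapping.keys p" for E
    using that
  proof (induction E rule: finite_induct)
    case empty
    then show ?case using assms(2)[of 0] by (auto intro: zring_closed)
  next
    case (insert e E)
    have "Poly_Mapping.keys e \<subseteq> {..<n} \<times> {..<n}" using insert.prems assms(1) unfolding in_zring_iff by blast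
    then have "Q (zmono zvar e) \<and> (zmono zvar e :: 'k zpoly) \<in> carrier (zring n)"
      unfolding zmono_def by (intro mono) auto
    then show ?case using insert by (auto intro!: add mult assms(2) zring_closed)
  qed
  from this[of "Poly_Mapping.keys p"] have "Q (zeval zconst zvar p)" unfolding zeval_def by simp
  then show ?thesis by (simp add: zeval_id)
qed

lemma zeval_in_zring:
  assumes "p \<in> carrier (zring n)" "\<And>a b. a < n \<Longrightarrow> b < n \<Longrightarrow> x (a, b) \<in> carrier (zring m)"
  shows "zeval zconst x p \<in> carrier (zring m)"
  using assms(1)
  by (induction p rule: zring_induct)
    (auto simp: zconst.zeval_single zeval_zvar[OF zconst.zeval_hom_axioms] zconst.zeval_add
      zconst.zeval_mult intro!: zring_closed assms(2))

section \<open>Determinantal ideals\<close>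

text \<open>Rows and columns are chosen by functions, not sets: replacing one index by another then
  always yields a \<open>zdet\<close> again, even if an index is repeated or the order is no longer
  increasing.\<close>

definition zdet :: "(nat \<times> nat \<Rightarrow> 'a::comm_ring_1) \<Rightarrow> nat \<Rightarrow> (nat \<Rightarrow> nat) \<Rightarrow> (nat \<Rightarrow> nat) \<Rightarrow> 'a" where
  "zdet x k f g = det (mat k k (\<lambda>(p, q). x (f p, g q)))"

lemma zdet_cong:
  "(\<And>p q. p < k \<Longrightarrow> q < k \<Longrightarrow> x (f p, g q) = y (f' p, g' q)) \<Longrightarrow> zdet x k f g = zdet y k f' g'"
  unfolding zdet_def by (intro arg_cong[of _ _ det] cong_mat) auto

lemma zdet_transpose: "zdet x k f g = zdet (x \<circ> prod.swap) k g f"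
proof -
  have "transpose_mat (mat k k (\<lambda>(p, q). x (f p, g q))) = mat k k (\<lambda>(p, q). x (f q, g p))"
    by (rule eq_matI) auto
  then show ?thesis
    using det_transpose[of "mat k k (\<lambda>(p, q). x (f p, g q))" k] by (simp add: zdet_def)
qed

lemma zdet_hom:
  assumes "comm_ring_hom h"
  shows "h (zdet x k f g) = zdet (h \<circ> x) k f g"
proof -
  interpret comm_ring_hom h by (rule assms)
  have "map_mat h (mat k k (\<lambda>(p, q). x (f p, g q))) = mat k k (\<lambda>(p, q). (h \<circ> x) (f p, g q))"
    by (rule eq_matI) auto
  then show ?thesis
    using hom_det[of "mat k k (\<lambda>(p, q). x (f p, g q))"] by (simp add: zdet_def)
qed

lemma zdet_0 [simp]: "zdet x 0 f g = 1"
  by (simp add: zdet_def)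

lemma zdet_laplace_row:
  assumes "p0 < Suc k"
  shows "zdet x (Suc k) f g = (\<Sum>q < Suc k. x (f p0, g q) *
    ((- 1) ^ (p0 + q) * zdet x k (f \<circ> insert_index p0) (g \<circ> insert_index q)))"
proof -
  let ?A = "mat (Suc k) (Suc k) (\<lambda>(p, q). x (f p, g q))"
  have "mat_delete ?A p0 q = mat k k (\<lambda>(p, q'). x ((f \<circ> insert_index p0) p, (g \<circ> insert_index q) q'))"
    if "q < Suc k" for q
    unfolding mat_delete_def by (rule eq_matI) (use that assms in \<open>auto simp: insert_index_def\<close>)
  then have "cofactor ?A p0 q = (- 1) ^ (p0 + q) * zdet x k (f \<circ> insert_index p0) (g \<circ> insert_index q)"
    if "q < Suc k" for q
    using that by (simp add: cofactor_def zdet_def)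
  moreover have "det ?A = (\<Sum>q < Suc k. ?A $$ (p0, q) * cofactor ?A p0 q)"
    by (rule laplace_expansion_row) (use assms in auto)
  ultimately show ?thesis using assms by (simp add: zdet_def del: sum.lessThan_Suc)
qed

lemma insert_index_less: "p < k \<Longrightarrow> insert_index p0 p < Suc k"
  by (auto simp: insert_index_def)

lemma insert_index_neq: "insert_index p0 p \<noteq> p0"
  by (auto simp: insert_index_def)

text \<open>Expanded along row p0, the three determinants have the same cofactors. Entries and index
  maps may differ among them, so that scaling a row, adding a row, and a zero row are all
  instances.\<close>

lemma zdet_row_linear:
  assumes "p0 < k"
    and "\<And>q. q < k \<Longrightarrow> x (f p0, g q) = a * y (f1 p0, g1 q) + b * z (f2 p0, g2 q)"
    and "\<And>p q. p < k \<Longrightarrow> q < k \<Longrightarrow> p \<noteq> p0 \<Longrightarrow> x (f p, g q) = y (f1 p, g1 q)"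
    and "\<And>p q. p < k \<Longrightarrow> q < k \<Longrightarrow> p \<noteq> p0 \<Longrightarrow> x (f p, g q) = z (f2 p, g2 q)"
  shows "zdet x k f g = a * zdet y k f1 g1 + b * zdet z k f2 g2"
proof -
  obtain l where k: "k = Suc l" using assms(1) by (cases k) auto
  have p0: "p0 < Suc l" using assms(1) k by simp
  have 1: "zdet x l (f \<circ> insert_index p0) (g \<circ> insert_index q) =
      zdet y l (f1 \<circ> insert_index p0) (g1 \<circ> insert_index q)" for q
    by (rule zdet_cong) (use assms(3) insert_index_less insert_index_neq in \<open>auto simp: k\<close>)
  have 2: "zdet x l (f \<circ> insert_index p0) (g \<circ> insert_index q) =
      zdet z l (f2 \<circ> insert_index p0) (g2 \<circ> insert_index q)" for q
    by (rule zdet_cong) (use assms(4) insert_index_less insert_index_neq in \<open>auto simp: k\<close>)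
  let ?c = "\<lambda>q. (- 1) ^ (p0 + q) * zdet x l (f \<circ> insert_index p0) (g \<circ> insert_index q)"
  have "zdet x k f g = (\<Sum>q < Suc l. x (f p0, g q) * ?c q)"
    unfolding k by (rule zdet_laplace_row[OF p0])
  also have "\<dots> = (\<Sum>q < Suc l. a * (y (f1 p0, g1 q) * ?c q) + b * (z (f2 p0, g2 q) * ?c q))"
    by (intro sum.cong refl) (use assms(2) in \<open>auto simp: k algebra_simps\<close>)
  also have "\<dots> = a * (\<Sum>q < Suc l. y (f1 p0, g1 q) * ?c q) + b * (\<Sum>q < Suc l. z (f2 p0, g2 q) * ?c q)"
    by (simp only: sum.distrib sum_distrib_left)
  also have "\<dots> = a * zdet y k f1 g1 + b * zdet z k f2 g2"
    unfolding k zdet_laplace_row[OF p0, of y] zdet_laplace_row[OF p0, of z] using 1 2 by simp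
  finally show ?thesis .
qed

lemma zdet_zero_row:
  assumes "p0 < k" "\<And>q. q < k \<Longrightarrow> x (f p0, g q) = 0"
  shows "zdet x k f g = 0"
  using zdet_row_linear[of p0 k x f g 0 x f g 0 x f g] assms by simp

lemma zdet_zero_col:
  assumes "q0 < k" "\<And>p. p < k \<Longrightarrow> x (f p, g q0) = 0"
  shows "zdet x k f g = 0"
  unfolding zdet_transpose[of x k f g] by (rule zdet_zero_row[OF assms(1)]) (simp add: assms(2))

lemma zdet_not_inj:
  assumes "\<not> inj_on f {..<k}"
  shows "zdet x k f g = 0"
proof -
  obtain p q where pq: "p < k" "q < k" "p \<noteq> q" "f p = f q"
    using assms unfolding inj_on_def by auto
  show ?thesis
    unfolding zdet_def
    by (rule det_identical_rows[of _ k p q]) (use pq in \<open>auto intro!: eq_vecI\<close>)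
qed

lemma zdet_not_inj_cols: "\<not> inj_on g {..<k} \<Longrightarrow> zdet x k f g = 0"
  unfolding zdet_transpose[of x k f g] by (rule zdet_not_inj)

lemma zdet_permute:
  assumes "\<pi> permutes {..<k}"
  shows "zdet x k (f \<circ> \<pi>) g = zdet x k f g \<or> zdet x k (f \<circ> \<pi>) g = - zdet x k f g"
proof -
  let ?A = "mat k k (\<lambda>(p, q). x (f p, g q))"
  have "\<pi> p < k" if "p < k" for p using permutes_in_image[OF assms] that by simp
  then have "mat k k (\<lambda>(i, j). ?A $$ (\<pi> i, j)) = mat k k (\<lambda>(p, q). x ((f \<circ> \<pi>) p, g q))"
    by (intro eq_matI) auto
  moreover have "det (mat k k (\<lambda>(i, j). ?A $$ (\<pi> i, j))) = signof \<pi> * det ?A"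
    by (rule det_permute_rows) (use assms in \<open>auto simp: atLeast0LessThan\<close>)
  ultimately show ?thesis by (auto simp: zdet_def sign_def)
qed

text \<open>Minors in \<open>minors\<close> are indexed by sets through their increasing
  enumeration; sorting an injective index map costs only a sign.\<close>

lemma zdet_pick_rows:
  assumes inj: "inj_on f {..<k}"
  shows "zdet x k f g = zdet x k (pick (f ` {..<k})) g \<or> zdet x k f g = - zdet x k (pick (f ` {..<k})) g"
proof -
  define I where "I = f ` {..<k}"
  have I: "finite I" "card I = k" using inj by (auto simp: I_def card_image)
  \<comment> \<open>The position of f p in the increasing enumeration of I, continued by the
    identity so as to be a permutation.\<close>
  define \<pi> where "\<pi> p = (if p < k then card {a \<in> I. a < f p} else p)" for p
  have pick: "pick I (\<pi> p) = f p" if "p < k" for p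
    using that pick_card_in_set[of "f p" I] by (auto simp: \<pi>_def I_def)
  have less: "\<pi> p < k" if "p < k" for p
  proof -
    have "{a \<in> I. a < f p} \<subset> I" using that by (auto simp: I_def)
    then show ?thesis using psubset_card_mono[OF I(1)] I(2) that by (auto simp: \<pi>_def)
  qed
  have "inj_on \<pi> {..<k}"
    using pick inj by (metis (no_types, lifting) inj_on_def lessThan_iff)
  then have "bij_betw \<pi> {..<k} {..<k}"
    using less endo_inj_surj[of "{..<k}" \<pi>] by (auto simp: bij_betw_def)
  then have "\<pi> permutes {..<k}" by (rule bij_imp_permutes) (simp add: \<pi>_def)
  moreover have "zdet x k f g = zdet x k (pick I \<circ> \<pi>) g"
    by (rule zdet_cong) (simp add: pick)
  ultimately show ?thesis using zdet_permute[of \<pi> k x "pick I" g] by (simp add: I_def)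
qed

lemma zdet_pick:
  assumes "inj_on f {..<k}" "inj_on g {..<k}"
  shows "zdet x k f g = zdet x k (pick (f ` {..<k})) (pick (g ` {..<k})) \<or>
    zdet x k f g = - zdet x k (pick (f ` {..<k})) (pick (g ` {..<k}))"
proof -
  have "zdet x k f' g = zdet x k f' (pick (g ` {..<k})) \<or> zdet x k f' g = - zdet x k f' (pick (g ` {..<k}))" for f'
    using zdet_pick_rows[OF assms(2), of "x \<circ> prod.swap" f'] by (simp add: zdet_transpose[of x])
  from this[of "pick (f ` {..<k})"] show ?thesis using zdet_pick_rows[OF assms(1), of x g] by auto
qed

lemma zdet_in_zring:
  assumes "\<And>p q. p < k \<Longrightarrow> q < k \<Longrightarrow> x (f p, g q) \<in> carrier (zring n)"
  shows "zdet x k f g \<in> carrier (zring n)"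
  using assms
proof (induction k arbitrary: f g)
  case 0
  then show ?case by (simp add: zring_one)
next
  case (Suc k)
  have sgn: "(- 1 :: 'a zpoly) ^ m \<in> carrier (zring n)" for m
    by (intro zring_power zring_uminus zring_one)
  have "zdet x k (f \<circ> insert_index 0) (g \<circ> insert_index q) \<in> carrier (zring n)" for q
    by (rule Suc.IH) (use Suc.prems insert_index_less in auto)
  then show ?case
    unfolding zdet_laplace_row[OF zero_less_Suc]
    using Suc.prems sgn by (intro zring_sum zring_mult) auto
qed

section \<open>Minors of the generic matrix and generators of the ASM ideal\<close>

lemma submatrix_generic_mat:
  assumes "i \<le> n" "j \<le> n"
  shows "submatrix (generic_mat n) {..<i} {..<j} = mat i j zvar"
proof -
  have pick: "pick {..<m} p = p" if "p < m" for m p :: nat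
  proof -
    have "{a \<in> {..<m}. a < p} = {..<p}" using that by auto
    then show ?thesis using pick_card_in_set[of p "{..<m}"] that by simp
  qed
  have card: "card {a. a < n \<and> a < m} = m" if "m \<le> n" for m
  proof -
    have "{a. a < n \<and> a < m} = {..<m}" using that by auto
    then show ?thesis by simp
  qed
  show ?thesis
    by (rule eq_matI) (use assms in \<open>auto simp: submatrix_def generic_mat_def card[OF assms(1)] card[OF assms(2)] pick\<close>)
qed

lemma minors_generic:
  "minors k (mat i j (zvar :: _ \<Rightarrow> 'k::field zpoly)) = {zdet zvar k (pick I) (pick J) | I J.
     I \<subseteq> {..<i} \<and> J \<subseteq> {..<j} \<and> card I = k \<and> card J = k}"
proof -
  have "submatrix (mat i j (zvar :: _ \<Rightarrow> 'k zpoly)) I J = mat k k (\<lambda>(p, q). zvar (pick I p, pick J q))"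
    if IJ: "I \<subseteq> {..<i}" "J \<subseteq> {..<j}" "card I = k" "card J = k" for I J
  proof -
    have c: "{a. a < i \<and> a \<in> I} = I" "{a. a < j \<and> a \<in> J} = J" using IJ by auto
    have "pick I p < i" if "p < k" for p using pick_le[of p i I] that IJ c by simp
    moreover have "pick J p < j" if "p < k" for p using pick_le[of p j J] that IJ c by simp
    ultimately show ?thesis
      by (intro eq_matI) (auto simp: submatrix_def c IJ)
  qed
  then show ?thesis
    unfolding minors_def zdet_def by (intro Collect_cong ex_cong1) auto
qed

lemma genideal_in_zring:
  assumes "S \<subseteq> carrier (zring n)"
  shows "ideal (Idl\<^bsub>zring n\<^esub> S) (zring n)" "S \<subseteq> Idl\<^bsub>zring n\<^esub> S"
    "ideal K (zring n) \<Longrightarrow> S \<subseteq> K \<Longrightarrow> Idl\<^bsub>zring n\<^esub> S \<subseteq> K"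
proof -
  interpret cring "zring n :: 'a zpoly ring" by (rule zring_cring)
  show "ideal (Idl\<^bsub>zring n\<^esub> S) (zring n)" "S \<subseteq> Idl\<^bsub>zring n\<^esub> S"
    "ideal K (zring n) \<Longrightarrow> S \<subseteq> K \<Longrightarrow> Idl\<^bsub>zring n\<^esub> S \<subseteq> K"
    using assms by (auto intro: genideal_ideal dest: genideal_self[THEN subsetD] genideal_minimal[THEN subsetD])
qed

lemma pick_props:
  assumes "I \<subseteq> {..<i}" "card I = k"
  shows "inj_on (pick I) {..<k}" "p < k \<Longrightarrow> pick I p < i"
proof -
  have "pick I p < pick I q" if "p < q" "q < k" for p q using that assms by (intro pick_mono_le) auto
  then show "inj_on (pick I) {..<k}" by (intro linorder_inj_onI) force+
  have "{a. a < i \<and> a \<in> I} = I" using assms by auto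
  then show "p < k \<Longrightarrow> pick I p < i" using pick_le[of p i I] assms by simp
qed

lemma minors_in_zring:
  assumes "i \<le> n" "j \<le> n"
  shows "minors k (mat i j (zvar :: _ \<Rightarrow> 'k::field zpoly)) \<subseteq> carrier (zring n)"
  unfolding minors_generic
proof clarify
  fix I J assume IJ: "I \<subseteq> {..<i}" "J \<subseteq> {..<j}" "card J = card I" "k = card I"
  show "zdet zvar (card I) (pick I) (pick J) \<in> carrier (zring n)"
    using pick_props(2)[OF IJ(1) refl] pick_props(2)[OF IJ(2,3)] assms
    by (intro zdet_in_zring zring_zvar) (auto intro: less_le_trans)
qed

lemma det_ideal_eq:
  "i \<le> n \<Longrightarrow> j \<le> n \<Longrightarrow> det_ideal n k i j = Idl\<^bsub>zring n\<^esub> (minors k (mat i j zvar))"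
  by (simp add: det_ideal_def submatrix_generic_mat)

text \<open>A repeated index makes the determinant 0; otherwise it is a minor up to sign. So
  arbitrary index maps within range are admissible.\<close>

lemma zdet_in_det_ideal:
  assumes ij: "i \<le> n" "j \<le> n" and "\<And>p. p < k \<Longrightarrow> f p < i" "\<And>q. q < k \<Longrightarrow> g q < j"
  shows "(zdet zvar k f g :: 'k::field zpoly) \<in> det_ideal n k i j"
proof -
  note gen = genideal_in_zring[OF minors_in_zring[OF ij, of k, where 'k = 'k]]
  interpret ideal "det_ideal n k i j :: 'k zpoly set" "zring n :: 'k zpoly ring"
    unfolding det_ideal_eq[OF ij] by (rule gen(1))
  show ?thesis
  proof (cases "inj_on f {..<k} \<and> inj_on g {..<k}")
    case False
    then have "(zdet zvar k f g :: 'k zpoly) = 0"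
      using zdet_not_inj zdet_not_inj_cols by blast
    then show ?thesis using additive_subgroup.zero_closed[OF is_additive_subgroup] by simp
  next
    case True
    let ?d = "zdet zvar k (pick (f ` {..<k})) (pick (g ` {..<k})) :: 'k zpoly"
    have "card (f ` {..<k}) = k" "card (g ` {..<k}) = k" using True by (auto simp: card_image)
    then have "?d \<in> minors k (mat i j zvar)"
      unfolding minors_generic using assms(3,4)
      by (intro CollectI exI[of _ "f ` {..<k}"] exI[of _ "g ` {..<k}"] conjI refl) auto
    then have d: "?d \<in> det_ideal n k i j" unfolding det_ideal_eq[OF ij] using gen(2) by blast
    then have "- ?d \<in> det_ideal n k i j" 
      using additive_subgroup.a_inv_closed[OF is_additive_subgroup d] zring_a_inv[OF Icarr[OF d]] by simp
    then show ?thesis using d zdet_pick[of f k g "zvar :: _ \<Rightarrow> 'k zpoly"] True by auto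
  qed
qed

lemma asm_ideal_gens_in_zring:
  "(\<Union>i \<in> {1..n}. \<Union>j \<in> {1..n}. det_ideal n (nat (rk A i j) + 1) i j) \<subseteq> carrier (zring n)"
proof clarify
  fix i j and p :: "'a zpoly" assume ij: "i \<in> {1..n}" "j \<in> {1..n}" and p: "p \<in> det_ideal n (nat (rk A i j) + 1) i j"
  then have "i \<le> n" "j \<le> n" by auto
  then show "p \<in> carrier (zring n)"
    using p genideal_in_zring(1)[OF minors_in_zring] unfolding det_ideal_eq[OF \<open>i \<le> n\<close> \<open>j \<le> n\<close>]
    by (meson ideal.Icarr)
qed

lemma asm_ideal_ideal: "ideal (asm_ideal n A :: 'k::field zpoly set) (zring n)"
  unfolding asm_ideal_def by (rule genideal_in_zring(1)[OF asm_ideal_gens_in_zring])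

lemma zdet_in_asm_ideal:
  assumes "1 \<le> i" "i \<le> n" "1 \<le> c" "c \<le> n" "k = nat (rk A i c) + 1"
    and "\<And>p. p < k \<Longrightarrow> f p < i" "\<And>q. q < k \<Longrightarrow> g q < c"
  shows "(zdet zvar k f g :: 'k::field zpoly) \<in> asm_ideal n A"
proof -
  have "(zdet zvar k f g :: 'k zpoly) \<in> det_ideal n (nat (rk A i c) + 1) i c"
    using assms zdet_in_det_ideal[of i n c k f g] by simp
  then show ?thesis
    unfolding asm_ideal_def using assms(1-4)
    by (intro subsetD[OF genideal_in_zring(2)[OF asm_ideal_gens_in_zring]] UN_I) auto
qed

text \<open>Counterpart of \<open>zdet_in_asm_ideal\<close>: inclusions need testing only on
  injective index maps, while membership is available for all. The deformation arguments rely on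
  this asymmetry.\<close>

lemma asm_ideal_least:
  assumes K: "ideal (K :: 'k::field zpoly set) (zring n)"
    and gens: "\<And>i c k f g. 1 \<le> i \<Longrightarrow> i \<le> n \<Longrightarrow> 1 \<le> c \<Longrightarrow> c \<le> n \<Longrightarrow> k = nat (rk A i c) + 1 \<Longrightarrow>
      inj_on f {..<k} \<Longrightarrow> inj_on g {..<k} \<Longrightarrow> (\<And>p. p < k \<Longrightarrow> f p < i) \<Longrightarrow> (\<And>q. q < k \<Longrightarrow> g q < c) \<Longrightarrow>
      zdet zvar k f g \<in> K"
  shows "asm_ideal n A \<subseteq> K"
  unfolding asm_ideal_def
proof (rule genideal_in_zring(3)[OF asm_ideal_gens_in_zring K], intro UN_least)
  fix i c assume "i \<in> {1..n}" "c \<in> {1..n}"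
  then have ic: "1 \<le> i" "i \<le> n" "1 \<le> c" "c \<le> n" by auto
  show "det_ideal n (nat (rk A i c) + 1) i c \<subseteq> K"
    unfolding det_ideal_eq[OF ic(2,4)]
  proof (rule genideal_in_zring(3)[OF minors_in_zring[OF ic(2,4)] K])
    show "minors (nat (rk A i c) + 1) (mat i c zvar) \<subseteq> K"
      unfolding minors_generic using gens[OF ic refl] pick_props by blast
  qed
qed

section \<open>Regular elements from one-parameter deformations\<close>

text \<open>For an ideal L this is its extension L[u] to polynomials in the deformation parameter u;
  for the carrier it is the polynomial ring over \<open>zring n\<close>.\<close>

definition coeffs_in :: "'a::zero set \<Rightarrow> 'a poly set" where
  "coeffs_in L = {q. \<forall>d. coeff q d \<in> L}"

lemma zring_idealI:
  assumes "I \<subseteq> carrier (zring n)" "0 \<in> I" "\<And>a b. a \<in> I \<Longrightarrow> b \<in> I \<Longrightarrow> a + b \<in> I"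
    and mult: "\<And>r a. r \<in> carrier (zring n) \<Longrightarrow> a \<in> I \<Longrightarrow> r * a \<in> I"
  shows "ideal I (zring n)"
proof -
  interpret cring "zring n :: 'a zpoly ring" by (rule zring_cring)
  show ?thesis
  proof (rule idealI)
    show "subgroup I (add_monoid (zring n))"
    proof (rule add.subgroupI)
      fix a assume a: "a \<in> I"
      then have "(- 1) * a \<in> I" by (intro mult zring_uminus zring_one)
      then show "\<ominus>\<^bsub>zring n\<^esub> a \<in> I" using a assms(1) by (auto simp: zring_a_inv)
    qed (use assms in auto)
    fix a x :: "'a zpoly" assume ax: "a \<in> I" "x \<in> carrier (zring n)"
    show xa: "x \<otimes>\<^bsub>zring n\<^esub> a \<in> I" using mult[OF ax(2,1)] by simp
    then show "a \<otimes>\<^bsub>zring n\<^esub> x \<in> I" by (simp add: mult.commute)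
  qed (rule ring_axioms)
qed

section \<open>Cancellation in polynomials with coefficients modulo an ideal\<close>

locale zring_ideal =
  fixes n and L :: "'k::field zpoly set"
  assumes ideal: "ideal L (zring n)"
begin

lemma L_zero: "0 \<in> L"
  using ideal_zero[OF ideal] by simp

lemma L_add: "a \<in> L \<Longrightarrow> b \<in> L \<Longrightarrow> a + b \<in> L"
  using ideal_add[OF ideal] by simp

lemma L_mult: "r \<in> carrier (zring n) \<Longrightarrow> a \<in> L \<Longrightarrow> r * a \<in> L"
  using ideal_lmult[OF ideal] by simp

lemma L_uminus: "a \<in> L \<Longrightarrow> - a \<in> L"
  using L_mult[of "- 1" a] by (simp add: zring_uminus zring_one)

lemma L_diff: "a \<in> L \<Longrightarrow> b \<in> L \<Longrightarrow> a - b \<in> L"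
  using L_add[of a "- b"] L_uminus by simp

lemma L_sum: "(\<And>i. i \<in> A \<Longrightarrow> f i \<in> L) \<Longrightarrow> sum f A \<in> L"
  by (induction A rule: infinite_finite_induct) (auto intro: L_zero L_add)

lemma coeffs_in_add: "p \<in> coeffs_in L \<Longrightarrow> q \<in> coeffs_in L \<Longrightarrow> p + q \<in> coeffs_in L"
  by (auto simp: coeffs_in_def intro: L_add)

lemma coeffs_in_mult:
  "p \<in> coeffs_in (carrier (zring n)) \<Longrightarrow> q \<in> coeffs_in L \<Longrightarrow> p * q \<in> coeffs_in L"
  by (auto simp: coeffs_in_def coeff_mult intro!: L_sum L_mult)

lemma coeffs_in_zero: "0 \<in> coeffs_in L"
  by (simp add: coeffs_in_def L_zero)

lemma coeffs_in_const: "a \<in> L \<Longrightarrow> [:a:] \<in> coeffs_in L"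
  by (auto simp: coeffs_in_def coeff_pCons L_zero split: nat.split)

lemma coeffs_in_shift: "a \<in> L \<Longrightarrow> [:0, 1:] * [:a:] \<in> coeffs_in L"
  by (auto simp: coeffs_in_def coeff_pCons L_zero split: nat.split)

lemma poly_in: "q \<in> coeffs_in L \<Longrightarrow> r \<in> carrier (zring n) \<Longrightarrow> poly q r \<in> L"
  unfolding poly_altdef coeffs_in_def
  by (intro L_sum) (auto simp: mult.commute[of "coeff q _"] intro!: L_mult zring_power)

text \<open>Coefficients of q are found to be in L from the lowest upwards: the constant one
  directly, then w q_d - q_(d+1) in L gives the next.\<close>

lemma cancel_unit_constant_coeff:
  assumes "[:- 1, w:] * q \<in> coeffs_in L" "w \<in> carrier (zring n)"
  shows "q \<in> coeffs_in L"
proof -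
  have c: "coeff ([:- 1, w:] * q) d \<in> L" for d using assms(1) by (simp add: coeffs_in_def)
  have "coeff q d \<in> L" for d
  proof (induction d)
    case 0
    show ?case using L_uminus[OF c[of 0]] by simp
  next
    case (Suc d)
    have "w * coeff q d - coeff q (Suc d) \<in> L" using c[of "Suc d"] by simp
    from L_diff[OF L_mult[OF assms(2) Suc] this] show ?case by simp
  qed
  then show ?thesis by (simp add: coeffs_in_def)
qed

text \<open>Here the argument runs from the top downwards, since only the coefficient w of u is a
  unit modulo L: t q_(d+1) + w q_d lies in L and w is 1 modulo L.\<close>

lemma cancel_unit_leading_coeff:
  assumes "[:t, w:] * q \<in> coeffs_in L" "t \<in> carrier (zring n)" "w - 1 \<in> L"
    and q: "q \<in> coeffs_in (carrier (zring n))"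
  shows "q \<in> coeffs_in L"
proof -
  have c: "t * coeff q (Suc d) + w * coeff q d \<in> L" for d
    using assms(1) by (auto simp: coeffs_in_def dest: spec[of _ "Suc d"])
  have step: "coeff q d \<in> L" if "coeff q (Suc d) \<in> L" for d
  proof -
    have "w * coeff q d \<in> L" using L_diff[OF c[of d] L_mult[OF assms(2) that]] by simp
    moreover have "coeff q d * (w - 1) \<in> L" using q assms(3) by (intro L_mult) (auto simp: coeffs_in_def)
    ultimately have "w * coeff q d - coeff q d * (w - 1) \<in> L" by (rule L_diff)
    then show ?thesis by (simp add: algebra_simps)
  qed
  \<comment> \<open>Descending induction starting one above the degree, where the coefficient is
    0.\<close>
  have "coeff q (Suc (degree q) - d) \<in> L" for d
  proof (induction d)
    case 0
    show ?case by (simp add: coeff_eq_0 L_zero)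
  next
    case (Suc d)
    show ?case
    proof (cases "d \<le> degree q")
      case True
      then have "Suc (Suc (degree q) - Suc d) = Suc (degree q) - d" by simp
      then show ?thesis using step Suc by metis
    next
      case False
      then show ?thesis using Suc by simp
    qed
  qed
  from this[of "Suc (degree q) - _"] have "coeff q d \<in> L" if "d \<le> Suc (degree q)" for d
    using that by (metis diff_diff_cancel)
  moreover have "coeff q d \<in> L" if "\<not> d \<le> Suc (degree q)" for d
    using that by (simp add: coeff_eq_0 L_zero)
  ultimately show ?thesis by (auto simp: coeffs_in_def)
qed

end

lemma zconst_poly_hom: "zeval_hom (\<lambda>a. [:zconst a:])"
  unfolding zeval_hom_def by unfold_locales (auto simp: single_add mult_single mult.commute)

interpretation zconst_poly: zeval_hom "\<lambda>a. [:zconst a:]"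
  by (rule zconst_poly_hom)

lemma const_poly_hom: "comm_ring_hom (\<lambda>a::'a::comm_ring_1. [:a:])"
  by unfold_locales auto

text \<open>A deformation \<open>z\<^sub>v \<mapsto> X v\<close> with parameter \<open>u\<close> which is the identity at \<open>u = r\<close>. If it preserves
  the ideal \<open>L\<close>, then regularity modulo \<open>L\<close> of an element can be read off its deformation, where
  one unit coefficient suffices.\<close>

locale deformation =
  fixes n :: nat and X :: "nat \<times> nat \<Rightarrow> 'k::field zpoly poly" and r :: "'k zpoly"
  assumes X_carrier: "\<And>a b. a < n \<Longrightarrow> b < n \<Longrightarrow> X (a, b) \<in> coeffs_in (carrier (zring n))"
    and X_eval: "\<And>a b. a < n \<Longrightarrow> b < n \<Longrightarrow> poly (X (a, b)) r = zvar (a, b)"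
    and r_carrier: "r \<in> carrier (zring n)"
begin

definition \<theta> :: "'k zpoly \<Rightarrow> 'k zpoly poly" where
  "\<theta> = zeval (\<lambda>a. [:zconst a:]) X"

sublocale \<theta>: comm_ring_hom \<theta>
  unfolding \<theta>_def by (rule zconst_poly.hom.comm_ring_hom_axioms)

lemma \<theta>_zvar: "\<theta> (zvar v) = X v"
  unfolding \<theta>_def by (rule zeval_zvar[OF zconst_poly_hom])

lemma \<theta>_zconst: "\<theta> (zconst a) = [:zconst a:]"
  unfolding \<theta>_def by (simp add: zconst_poly.zeval_single)

lemma \<theta>_carrier:
  assumes "p \<in> carrier (zring n)"
  shows "\<theta> p \<in> coeffs_in (carrier (zring n))"
proof -
  interpret cring "zring n :: 'k zpoly ring" by (rule zring_cring)
  interpret C: zring_ideal n "carrier (zring n :: 'k zpoly ring)"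
    by (rule zring_ideal.intro[OF oneideal])
  show ?thesis
    using assms
    by (induction p rule: zring_induct)
      (auto simp: \<theta>_zvar \<theta>_zconst \<theta>.hom_add \<theta>.hom_mult
        intro: X_carrier C.coeffs_in_const C.coeffs_in_add C.coeffs_in_mult zring_zconst)
qed

lemma \<theta>_eval: "p \<in> carrier (zring n) \<Longrightarrow> poly (\<theta> p) r = p"
  by (induction p rule: zring_induct)
    (auto simp: \<theta>_zvar \<theta>_zconst \<theta>.hom_add \<theta>.hom_mult X_eval)

text \<open>Allows invariance of L under the deformation to be checked on generators.\<close>

lemma preserved_ideal:
  assumes "ideal L (zring n)"
  shows "ideal {p \<in> carrier (zring n). \<theta> p \<in> coeffs_in L} (zring n)"
proof -
  interpret zring_ideal n L by (rule zring_ideal.intro[OF assms])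
  show ?thesis
    by (rule zring_idealI)
      (auto simp: \<theta>.hom_add \<theta>.hom_mult intro: zring_closed coeffs_in_zero coeffs_in_add coeffs_in_mult \<theta>_carrier)
qed

text \<open>Deform t a in L, cancel the factor \<open>\<theta> t\<close> in L[u], and set u = r to
  recover a in L.\<close>

lemma regular_mod_preserved:
  assumes L: "ideal L (zring n)" "\<And>p. p \<in> L \<Longrightarrow> \<theta> p \<in> coeffs_in L" and t: "t \<in> carrier (zring n)"
    and cancel: "\<And>q. q \<in> coeffs_in (carrier (zring n)) \<Longrightarrow> \<theta> t * q \<in> coeffs_in L \<Longrightarrow> q \<in> coeffs_in L"
  shows "regular_mod (zring n) L t"
  unfolding regular_mod_def
proof (intro conjI ballI impI t)
  interpret zring_ideal n L by (rule zring_ideal.intro[OF L(1)])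
  fix a assume a: "a \<in> carrier (zring n)" "t \<otimes>\<^bsub>zring n\<^esub> a \<in> L"
  have "\<theta> t * \<theta> a \<in> coeffs_in L" using L(2)[OF a(2)] by (simp add: \<theta>.hom_mult)
  then have "\<theta> a \<in> coeffs_in L" using cancel \<theta>_carrier[OF a(1)] by blast
  then have "poly (\<theta> a) r \<in> L" using r_carrier by (rule poly_in)
  then show "a \<in> L" using \<theta>_eval[OF a(1)] by simp
qed

lemma \<theta>_zdet: "\<theta> (zdet zvar k f g) = zdet X k f g"
proof -
  have "\<theta> \<circ> zvar = X" by (auto simp: \<theta>_zvar)
  then show ?thesis using zdet_hom[OF \<theta>.comm_ring_hom_axioms, of zvar k f g] by simp
qed

end

section \<open>Determinants under elementary deformations\<close>

lemma zdet_const: "zdet (\<lambda>v. [:x v:]) k f g = [:zdet x k f g:]"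
  using zdet_hom[OF const_poly_hom, of x k f g] by (simp add: comp_def)

text \<open>Injectivity of f makes row a occur at most once, so the parameter u, which is
  \<open>[:0, 1:]\<close>, comes out at most to the first power.\<close>

lemma zdet_scale_row:
  assumes "inj_on f {..<k}"
  shows "zdet (\<lambda>v. if fst v = a then [:0, x v:] else [:x v:]) k f g = [:zdet x k f g:] \<or>
    zdet (\<lambda>v. if fst v = a then [:0, x v:] else [:x v:]) k f g = [:0, 1:] * [:zdet x k f g:]"
    (is "zdet ?X k f g = _ \<or> _")
proof (cases "\<exists>p0 < k. f p0 = a")
  case False
  then have "zdet ?X k f g = zdet (\<lambda>v. [:x v:]) k f g" by (intro zdet_cong) auto
  then show ?thesis by (simp add: zdet_const)
next
  case True
  then obtain p0 where p0: "p0 < k" "f p0 = a" by blast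
  have ne: "f p \<noteq> a" if "p < k" "p \<noteq> p0" for p
    using assms p0 that unfolding inj_on_def by auto
  have "zdet ?X k f g = [:0, 1:] * zdet (\<lambda>v. [:x v:]) k f g + 0 * zdet (\<lambda>v. [:x v:]) k f g"
    using p0 ne by (intro zdet_row_linear[of p0]) auto
  then show ?thesis by (simp add: zdet_const)
qed

text \<open>If row a occurs, it occurs once; splitting it leaves the old determinant plus u times
  the one with index a replaced by a'. The new index map need not be injective.\<close>

lemma zdet_add_row:
  assumes "inj_on f {..<k}"
  shows "zdet (\<lambda>v. if fst v = a then [:x v, x (a', snd v):] else [:x v:]) k f g = [:zdet x k f g:] \<or>
    (\<exists>p0 < k. f p0 = a \<and> zdet (\<lambda>v. if fst v = a then [:x v, x (a', snd v):] else [:x v:]) k f g =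
      [:zdet x k f g:] + [:0, 1:] * [:zdet x k (f(p0 := a')) g:])"
    (is "zdet ?X k f g = _ \<or> _")
proof (cases "\<exists>p0 < k. f p0 = a")
  case False
  then have "zdet ?X k f g = zdet (\<lambda>v. [:x v:]) k f g" by (intro zdet_cong) auto
  then show ?thesis by (simp add: zdet_const)
next
  case True
  then obtain p0 where p0: "p0 < k" "f p0 = a" by blast
  have ne: "f p \<noteq> a" if "p < k" "p \<noteq> p0" for p
    using assms p0 that unfolding inj_on_def by auto
  have "zdet ?X k f g = 1 * zdet (\<lambda>v. [:x v:]) k f g +
      [:0, 1:] * zdet (\<lambda>v. [:x v:]) k (f(p0 := a')) g"
    using p0 ne by (intro zdet_row_linear[of p0]) auto
  then show ?thesis using p0 by (auto simp: zdet_const)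
qed

lemma zdet_add_col:
  assumes "inj_on g {..<k}"
  shows "zdet (\<lambda>v. if snd v = b then [:x v, x (fst v, b'):] else [:x v:]) k f g = [:zdet x k f g:] \<or>
    (\<exists>q0 < k. g q0 = b \<and> zdet (\<lambda>v. if snd v = b then [:x v, x (fst v, b'):] else [:x v:]) k f g =
      [:zdet x k f g:] + [:0, 1:] * [:zdet x k f (g(q0 := b')):])"
proof -
  have "(\<lambda>v. if snd v = b then [:x v, x (fst v, b'):] else [:x v:]) \<circ> prod.swap =
    (\<lambda>v. if fst v = b then [:(x \<circ> prod.swap) v, (x \<circ> prod.swap) (b', snd v):] else [:(x \<circ> prod.swap) v:])"
    by auto
  then show ?thesis
    using zdet_add_row[OF assms, of b "x \<circ> prod.swap" b' f]
    by (simp add: zdet_transpose[of _ k f])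
qed

section \<open>Adjoining a list of elements to an ideal\<close>

lemma foldl_adjoin_ideal:
  assumes R: "cring R" and "ideal L R" "set us \<subseteq> carrier R"
  shows "ideal (foldl (adjoin R) L us) R"
  using assms(2,3) by (induction us arbitrary: L) (auto intro: cring.adjoin_ideal[OF R])

lemma foldl_adjoin_superset:
  assumes R: "cring R" and "ideal L R" "set us \<subseteq> carrier R"
  shows "L \<subseteq> foldl (adjoin R) L us \<and> set us \<subseteq> foldl (adjoin R) L us"
  using assms(2,3)
proof (induction us arbitrary: L)
  case Nil
  then show ?case by simp
next
  case (Cons u us)
  have u: "u \<in> carrier R" using Cons.prems by simp
  have "adjoin R L u \<subseteq> foldl (adjoin R) (adjoin R L u) us \<and> set us \<subseteq> foldl (adjoin R) (adjoin R L u) us"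
    using Cons.IH[OF cring.adjoin_ideal[OF R Cons.prems(1) u]] Cons.prems(2) by simp
  then show ?case
    using cring.adjoin_superset[OF R Cons.prems(1) u] cring.adjoin_self[OF R Cons.prems(1) u] by auto
qed

lemma foldl_adjoin_least:
  assumes R: "cring R" and "ideal K R" "L \<subseteq> K" "set us \<subseteq> K"
  shows "foldl (adjoin R) L us \<subseteq> K"
  using assms(3,4)
  by (induction us arbitrary: L) (use cring.adjoin_least[OF R assms(2)] in auto)

lemma regular_listI:
  assumes "\<And>us t vs. ts = us @ t # vs \<Longrightarrow> regular_mod R (foldl (adjoin R) L us) t"
  shows "regular_list R L ts"
  using assms
proof (induction ts arbitrary: L)
  case Nil
  then show ?case by simp
next
  case (Cons t ts)
  have "regular_mod R L t" using Cons.prems[of "[]" t ts] by simp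
  moreover have "regular_list R (adjoin R L t) ts"
    by (rule Cons.IH) (use Cons.prems[of "t # _"] in simp)
  ultimately show ?case by simp
qed

lemma coeffs_in_mono: "L \<subseteq> L' \<Longrightarrow> coeffs_in L \<subseteq> coeffs_in L'"
  by (auto simp: coeffs_in_def)

section \<open>Invariance of the ASM ideal and regularity of the border sequence\<close>

lemma scale_row_deformation:
  "deformation n (\<lambda>v. if fst v = 0 then [:0, zvar v:] else [:zvar v:]) 1"
  by unfold_locales
    (auto simp: coeffs_in_def coeff_pCons zring_zvar zring_zero zring_one split: nat.split)

lemma add_row_deformation:
  "deformation n (\<lambda>v. if fst v = a then [:zvar v, zvar (0, snd v):] else [:zvar v:]) 0"
  by unfold_locales
    (auto simp: coeffs_in_def coeff_pCons zring_zvar zring_zero split: nat.split)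

lemma add_col_deformation:
  "deformation n (\<lambda>v. if snd v = b then [:zvar v, zvar (fst v, j):] else [:zvar v:]) 0" if "j < n"
  by unfold_locales
    (use that in \<open>auto simp: coeffs_in_def coeff_pCons zring_zvar zring_zero split: nat.split\<close>)

lemma (in deformation) asm_ideal_preserved:
  assumes "\<And>i c k f g. 1 \<le> i \<Longrightarrow> i \<le> n \<Longrightarrow> 1 \<le> c \<Longrightarrow> c \<le> n \<Longrightarrow> k = nat (rk A i c) + 1 \<Longrightarrow>
      inj_on f {..<k} \<Longrightarrow> inj_on g {..<k} \<Longrightarrow> (\<And>p. p < k \<Longrightarrow> f p < i) \<Longrightarrow> (\<And>q. q < k \<Longrightarrow> g q < c) \<Longrightarrow>
      zdet X k f g \<in> coeffs_in (asm_ideal n A)"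
    and "p \<in> asm_ideal n A"
  shows "\<theta> p \<in> coeffs_in (asm_ideal n A)"
proof -
  have "asm_ideal n A \<subseteq> {p \<in> carrier (zring n). \<theta> p \<in> coeffs_in (asm_ideal n A)}"
  proof (rule asm_ideal_least[OF preserved_ideal[OF asm_ideal_ideal]])
    fix i c k f g
    assume h: "1 \<le> i" "i \<le> n" "1 \<le> c" "c \<le> n" "k = nat (rk A i c) + 1" "inj_on f {..<k}" "inj_on g {..<k}"
      "\<And>p. p < k \<Longrightarrow> f p < i" "\<And>q. q < k \<Longrightarrow> g q < c"
    have "zdet zvar k f g \<in> carrier (zring n)"
      using h by (intro zdet_in_zring zring_zvar) (auto intro: less_le_trans)
    then show "zdet zvar k f g \<in> {p \<in> carrier (zring n). \<theta> p \<in> coeffs_in (asm_ideal n A)}"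
      using assms(1)[OF h] by (simp add: \<theta>_zdet)
  qed
  then show ?thesis using assms(2) by blast
qed

text \<open>Scaling row 0 by u fixes a generator or multiplies it by u, so the ideal is preserved.
  The operation is the identity at u = 1, whereas the additive ones below are so at u = 0.\<close>

lemma regular_mod_corner_minus_one:
  assumes "j < n"
  shows "regular_mod (zring n) (asm_ideal n A :: 'k::field zpoly set) (zvar (0, j) - 1)"
proof -
  interpret D: deformation n "\<lambda>v. if fst v = 0 then [:0, zvar v:] else [:zvar v :: 'k zpoly:]" 1
    by (rule scale_row_deformation)
  interpret I: zring_ideal n "asm_ideal n A :: 'k zpoly set"
    by (rule zring_ideal.intro[OF asm_ideal_ideal])
  have w: "(zvar (0, j) :: 'k zpoly) \<in> carrier (zring n)" using assms by (intro zring_zvar) auto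
  have tw: "D.\<theta> (zvar (0, j) - 1) = [:- 1, zvar (0, j):]"
    by (simp add: D.\<theta>.hom_minus D.\<theta>_zvar D.\<theta>.hom_one one_pCons)
  show ?thesis
  proof (rule D.regular_mod_preserved[OF asm_ideal_ideal])
    fix p :: "'k zpoly" assume "p \<in> asm_ideal n A"
    then show "D.\<theta> p \<in> coeffs_in (asm_ideal n A)"
    proof (rule D.asm_ideal_preserved[rotated])
      fix i c k f g
      assume h: "1 \<le> i" "i \<le> n" "1 \<le> c" "c \<le> n" "k = nat (rk A i c) + 1" "inj_on f {..<k}" "inj_on g {..<k}"
        "\<And>p. p < k \<Longrightarrow> f p < i" "\<And>q. q < k \<Longrightarrow> g q < c"
      have d: "(zdet zvar k f g :: 'k zpoly) \<in> asm_ideal n A" by (rule zdet_in_asm_ideal[OF h(1-5,8,9)])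
      from zdet_scale_row[OF h(6), of 0 "zvar :: _ \<Rightarrow> 'k zpoly" g] show "zdet (\<lambda>v. if fst v = 0 then [:0, zvar v:] else [:zvar v :: 'k zpoly:]) k f g
          \<in> coeffs_in (asm_ideal n A)"
        by (elim disjE) (simp_all only: I.coeffs_in_const[OF d] I.coeffs_in_shift[OF d])
    qed
  next
    show "(zvar (0, j) - 1 :: 'k zpoly) \<in> carrier (zring n)" using w by (intro zring_minus zring_one)
    fix q assume "D.\<theta> (zvar (0, j) - 1) * q \<in> coeffs_in (asm_ideal n A)"
    then show "q \<in> coeffs_in (asm_ideal n A)" unfolding tw using w by (rule I.cancel_unit_constant_coeff)
  qed
qed

text \<open>Replacing a row index by 0 stays within the first i rows for every i >= 1, so the new
  determinant meets the same rank condition. It may have a repeated row, which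
  \<open>zdet_in_asm_ideal\<close> admits.\<close>

lemma add_row_preserves_asm_ideal:
  assumes "p \<in> (asm_ideal n A :: 'k::field zpoly set)"
  shows "deformation.\<theta> (\<lambda>v. if fst v = a then [:zvar v, zvar (0, snd v):] else [:zvar v:]) p
    \<in> coeffs_in (asm_ideal n A)"
proof -
  interpret D: deformation n "\<lambda>v. if fst v = a then [:zvar v, zvar (0, snd v):] else [:zvar v :: 'k zpoly:]" 0
    by (rule add_row_deformation)
  interpret I: zring_ideal n "asm_ideal n A :: 'k zpoly set"
    by (rule zring_ideal.intro[OF asm_ideal_ideal])
  show ?thesis
  proof (rule D.asm_ideal_preserved[OF _ assms])
    fix i c k f g
    assume h: "1 \<le> i" "i \<le> n" "1 \<le> c" "c \<le> n" "k = nat (rk A i c) + 1" "inj_on f {..<k}" "inj_on g {..<k}"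
      "\<And>p. p < k \<Longrightarrow> f p < i" "\<And>q. q < k \<Longrightarrow> g q < c"
    have 1: "(zdet zvar k f g :: 'k zpoly) \<in> asm_ideal n A" by (rule zdet_in_asm_ideal[OF h(1-5,8,9)])
    have 2: "(zdet zvar k (f(p0 := 0)) g :: 'k zpoly) \<in> asm_ideal n A" for p0
      by (rule zdet_in_asm_ideal[OF h(1-5) _ h(9)]) (use h(1,8) in auto)
    from zdet_add_row[OF h(6), of a "zvar :: _ \<Rightarrow> 'k zpoly" 0 g]
    show "zdet (\<lambda>v. if fst v = a then [:zvar v, zvar (0, snd v):] else [:zvar v :: 'k zpoly:]) k f g
        \<in> coeffs_in (asm_ideal n A)"
      by (elim disjE exE conjE)
        (simp_all only: I.coeffs_in_const[OF 1] I.coeffs_in_add[OF I.coeffs_in_const[OF 1] I.coeffs_in_shift[OF 2]])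
  qed
qed

text \<open>Since j < b, column j is among the first c columns whenever column b is. This restricts
  the operation to columns right of the corner.\<close>

lemma add_col_preserves_asm_ideal:
  assumes "p \<in> (asm_ideal n A :: 'k::field zpoly set)" "j < b" "b < n"
  shows "deformation.\<theta> (\<lambda>v. if snd v = b then [:zvar v, zvar (fst v, j):] else [:zvar v:]) p
    \<in> coeffs_in (asm_ideal n A)"
proof -
  interpret D: deformation n "\<lambda>v. if snd v = b then [:zvar v, zvar (fst v, j):] else [:zvar v :: 'k zpoly:]" 0
    using assms by (intro add_col_deformation) auto
  interpret I: zring_ideal n "asm_ideal n A :: 'k zpoly set"
    by (rule zring_ideal.intro[OF asm_ideal_ideal])
  show ?thesis
  proof (rule D.asm_ideal_preserved[OF _ assms(1)])
    fix i c k f g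
    assume h: "1 \<le> i" "i \<le> n" "1 \<le> c" "c \<le> n" "k = nat (rk A i c) + 1" "inj_on f {..<k}" "inj_on g {..<k}"
      "\<And>p. p < k \<Longrightarrow> f p < i" "\<And>q. q < k \<Longrightarrow> g q < c"
    have 1: "(zdet zvar k f g :: 'k zpoly) \<in> asm_ideal n A" by (rule zdet_in_asm_ideal[OF h(1-5,8,9)])
    have 2: "(zdet zvar k f (g(q0 := j)) :: 'k zpoly) \<in> asm_ideal n A" if "q0 < k" "g q0 = b" for q0
    proof (rule zdet_in_asm_ideal[OF h(1-5,8)])
      show "(g(q0 := j)) q < c" if "q < k" for q
        using h(9)[OF that] h(9)[OF \<open>q0 < k\<close>] \<open>g q0 = b\<close> assms(2) by auto
    qed
    from zdet_add_col[OF h(7), of b "zvar :: _ \<Rightarrow> 'k zpoly" j f]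
    show "zdet (\<lambda>v. if snd v = b then [:zvar v, zvar (fst v, j):] else [:zvar v :: 'k zpoly:]) k f g
        \<in> coeffs_in (asm_ideal n A)"
      by (elim disjE exE conjE)
        (simp_all only: I.coeffs_in_const[OF 1] I.coeffs_in_add[OF I.coeffs_in_const[OF 1] I.coeffs_in_shift[OF 2]])
  qed
qed

text \<open>Variables left of the corner are absent: being 0 modulo the ideal of the bordered
  matrix, they could be regular only modulo the whole ring.\<close>

definition border_vars :: "nat \<Rightarrow> nat \<Rightarrow> (nat \<times> nat) list" where
  "border_vars n j = map (Pair 0) [Suc j..<n] @ map (\<lambda>a. (a, j)) [1..<n]"

text \<open>The corner comes first because the regularity of every later element uses w = 1; among
  the variables the order is immaterial.\<close>

definition border_seq :: "nat \<Rightarrow> nat \<Rightarrow> 'k::field zpoly list" where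
  "border_seq n j = (zvar (0, j) - 1) # map zvar (border_vars n j)"

lemma distinct_border_vars: "distinct (border_vars n j)"
  by (auto simp: border_vars_def distinct_map inj_on_def)

lemma set_border_vars:
  "set (border_vars n j) = {(0, b) | b. j < b \<and> b < n} \<union> {(a, j) | a. 1 \<le> a \<and> a < n}"
  by (auto simp: border_vars_def)

lemma regular_mod_border_var:
  fixes A :: "int mat"
  assumes j: "j < n" and v: "v \<in> set (border_vars n j)" and vs: "set vs \<subseteq> set (border_vars n j)" "v \<notin> set vs"
  shows "regular_mod (zring n)
    (foldl (adjoin (zring n)) (asm_ideal n A :: 'k::field zpoly set) ((zvar (0, j) - 1) # map zvar vs)) (zvar v)"
    (is "regular_mod _ ?L _")
proof -
  note R = zring_cring[of n, where 'k = 'k]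
  have w: "(zvar (0, j) :: 'k zpoly) \<in> carrier (zring n)" using j by (intro zring_zvar) auto
  have us: "set ((zvar (0, j) - 1) # map zvar vs) \<subseteq> carrier (zring n :: 'k zpoly ring)"
    using w vs(1) j unfolding set_border_vars by (auto intro!: zring_minus zring_one zring_zvar)
  have L: "ideal ?L (zring n)" by (rule foldl_adjoin_ideal[OF R asm_ideal_ideal us])
  interpret L: zring_ideal n ?L by (rule zring_ideal.intro[OF L])
  have sup: "asm_ideal n A \<subseteq> ?L" "set ((zvar (0, j) - 1) # map zvar vs) \<subseteq> ?L"
    using foldl_adjoin_superset[OF R asm_ideal_ideal us] by blast+
  have w1: "zvar (0, j) - 1 \<in> ?L" and vsL: "\<And>u. u \<in> set vs \<Longrightarrow> zvar u \<in> ?L" using sup(2) by auto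
  have t: "(zvar v :: 'k zpoly) \<in> carrier (zring n)"
    using v j unfolding set_border_vars by (auto intro!: zring_zvar)
  \<comment> \<open>Shared by the row and the column case. The operation moves a whole line, but v
    is the only border variable on it, so w and all the adjoined variables are fixed and the
    enlarged ideal is still preserved.\<close>
  have main: "regular_mod (zring n) ?L (zvar v)"
    if "deformation n X (0 :: 'k zpoly)" and pres: "\<And>p. p \<in> asm_ideal n A \<Longrightarrow> deformation.\<theta> X p \<in> coeffs_in (asm_ideal n A)"
      and Xv: "X v = [:zvar v, zvar (0, j):]" and Xw: "X (0, j) = [:zvar (0, j):]"
      and Xvs: "\<And>u. u \<in> set vs \<Longrightarrow> X u = [:zvar u:]" for X
  proof -
    interpret D: deformation n X 0 by (rule that(1))
    let ?K = "{p \<in> carrier (zring n). D.\<theta> p \<in> coeffs_in ?L}"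
    have LK: "?L \<subseteq> ?K"
    proof (rule foldl_adjoin_least[OF R D.preserved_ideal[OF L]])
      show "asm_ideal n A \<subseteq> ?K"
        using pres coeffs_in_mono[OF sup(1)] ideal_carrier[OF asm_ideal_ideal[of n A]] by blast
      have "D.\<theta> (zvar (0, j) - 1) = [:zvar (0, j) - 1:]"
        by (simp add: D.\<theta>.hom_minus D.\<theta>_zvar D.\<theta>.hom_one one_pCons Xw)
      moreover have "D.\<theta> (zvar u) = [:zvar u:]" if "u \<in> set vs" for u
        using Xvs[OF that] by (simp add: D.\<theta>_zvar)
      ultimately show "set ((zvar (0, j) - 1) # map zvar vs) \<subseteq> ?K"
        using us L.coeffs_in_const[OF w1] L.coeffs_in_const[OF vsL] by auto
    qed
    show ?thesis
    proof (intro D.regular_mod_preserved[OF L _ t])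
      show "D.\<theta> p \<in> coeffs_in ?L" if "p \<in> ?L" for p using LK that by blast
      fix q assume q: "q \<in> coeffs_in (carrier (zring n))" "D.\<theta> (zvar v) * q \<in> coeffs_in ?L"
      show "q \<in> coeffs_in ?L"
        using q(2) unfolding D.\<theta>_zvar Xv by (rule L.cancel_unit_leading_coeff[OF _ t w1 q(1)])
    qed
  qed
  from v consider b where "v = (0, b)" "j < b" "b < n" | a where "v = (a, j)" "1 \<le> a" "a < n"
    unfolding set_border_vars by blast
  then show ?thesis
  proof cases
    case 1
    show ?thesis
    proof (rule main[OF add_col_deformation[OF j, of b] add_col_preserves_asm_ideal[OF _ 1(2,3)]])
      fix u assume "u \<in> set vs"
      then have "u \<in> set (border_vars n j)" "u \<noteq> v" using vs by auto
      then have "snd u \<noteq> b" using 1 unfolding set_border_vars by auto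
      then show "(if snd u = b then [:zvar u, zvar (fst u, j):] else [:zvar u:]) = [:zvar u:]" by simp
    qed (use 1 in auto)
  next
    case 2
    show ?thesis
    proof (rule main[OF add_row_deformation[of n a] add_row_preserves_asm_ideal])
      fix u assume "u \<in> set vs"
      then have "u \<in> set (border_vars n j)" "u \<noteq> v" using vs by auto
      then have "fst u \<noteq> a" using 2 unfolding set_border_vars by auto
      then show "(if fst u = a then [:zvar u, zvar (0, snd u):] else [:zvar u:]) = [:zvar u:]" by simp
    qed (use 2 in auto)
  qed
qed

lemma regular_list_border_seq:
  fixes A :: "int mat"
  assumes "j < n"
  shows "regular_list (zring n) (asm_ideal n A :: 'k::field zpoly set) (border_seq n j)"
proof (rule regular_listI)
  fix us t vs assume e: "border_seq n j = us @ t # (vs :: 'k zpoly list)"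
  show "regular_mod (zring n) (foldl (adjoin (zring n)) (asm_ideal n A) us) t"
  proof (cases us)
    case Nil
    then show ?thesis
      using e regular_mod_corner_minus_one[OF assms, of A, where 'k = 'k] by (auto simp: border_seq_def)
  next
    case (Cons u us')
    then have u: "u = zvar (0, j) - 1" "map zvar (border_vars n j) = us' @ t # vs"
      using e by (simp_all add: border_seq_def)
    then obtain xs v ys where v: "border_vars n j = xs @ v # ys" "us' = map zvar xs" "t = zvar v"
      by (auto simp: map_eq_append_conv map_eq_Cons_conv)
    have "v \<in> set (border_vars n j)" "set xs \<subseteq> set (border_vars n j)" "v \<notin> set xs"
      using v(1) distinct_border_vars[of n j] by auto
    from regular_mod_border_var[OF assms this, of A, where 'k = 'k] show ?thesis
      unfolding Cons u(1) v(2,3) .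
  qed
qed

section \<open>Bordering an alternating sign matrix\<close>

text \<open>Alternation confines the partial sums to 0 and the first nonzero entry f a, and the
  total 1 forces f a = 1. Through \<open>rk_nonneg\<close> this makes the conversion
  \<open>nat\<close> in \<open>asm_ideal\<close> faithful.\<close>

lemma alternating_partial_sum_nonneg:
  assumes alt: "alternating n f" and vals: "\<And>b. b < n \<Longrightarrow> f b \<in> {-1, 0, 1}"
    and total: "(\<Sum>b < n. f b) = 1" and "c \<le> n"
  shows "0 \<le> (\<Sum>b < c. f b)"
proof -
  have "\<exists>b. b < n \<and> f b \<noteq> 0"
  proof (rule ccontr)
    assume "\<not> ?thesis"
    then have "(\<Sum>b < n. f b) = 0" by (intro sum.neutral) auto
    then show False using total by simp
  qed
  define a where "a = (LEAST b. b < n \<and> f b \<noteq> 0)"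
  have a: "a < n" "f a \<noteq> 0" and az: "\<And>b. b < a \<Longrightarrow> f b = 0"
    using LeastI_ex[OF \<open>\<exists>b. b < n \<and> f b \<noteq> 0\<close>] not_less_Least[of _ "\<lambda>b. b < n \<and> f b \<noteq> 0"]
    unfolding a_def[symmetric] by (auto dest: order.strict_trans)
  have zero: "(\<Sum>b < a. f b) = 0" using az by (intro sum.neutral) auto
  \<comment> \<open>The invariant records the last nonzero entry l before c: the partial sum is f a
    if that entry equals f a, and 0 if it has the opposite sign.\<close>
  have inv: "\<exists>l < c. f l \<noteq> 0 \<and> (\<forall>b. l < b \<and> b < c \<longrightarrow> f b = 0) \<and>
      (\<Sum>b < c. f b) = (if f l = f a then f a else 0)" if "a < c" "c \<le> n" for c
    using that
  proof (induction c)
    case 0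
    then show ?case by simp
  next
    case (Suc c)
    show ?case
    proof (cases "a = c")
      case True
      then show ?thesis using a zero by (intro exI[of _ a]) auto
    next
      case False
      then obtain l where l: "l < c" "f l \<noteq> 0" "\<forall>b. l < b \<and> b < c \<longrightarrow> f b = 0"
        "(\<Sum>b < c. f b) = (if f l = f a then f a else 0)"
        using Suc by auto
      show ?thesis
      proof (cases "f c = 0")
        case True
        then show ?thesis using l by (intro exI[of _ l]) (auto simp: less_Suc_eq)
      next
        case nz: False
        have "sgn (f c) = - sgn (f l)"
          using alt l nz Suc.prems unfolding alternating_def by simp
        moreover have v: "f c \<in> {-1, 0, 1}" "f l \<in> {-1, 0, 1}" "f a \<in> {-1, 0, 1}"
          using vals[of c] vals[of l] vals[of a] Suc.prems l(1) a(1) by linarith+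
        ultimately have fc: "f c = - f l" using nz l(2) by (elim insertE emptyE) simp_all
        have "(\<Sum>b < Suc c. f b) = (if f c = f a then f a else 0)"
        proof (cases "f l = f a")
          case True
          then show ?thesis using l(4) a(2) fc by simp
        next
          case False
          then have "f c = f a" using v l(2) a(2) nz fc by (elim insertE emptyE) simp_all
          then show ?thesis using l(4) False by simp
        qed
        then show ?thesis using nz by (intro exI[of _ c]) auto
      qed
    qed
  qed
  obtain l where "(\<Sum>b < n. f b) = (if f l = f a then f a else 0)" using inv[OF a(1) order_refl] by blast
  then have "f a = 1" using total by (simp split: if_splits)
  show ?thesis
  proof (cases "a < c")
    case True
    then obtain l where "(\<Sum>b < c. f b) = (if f l = f a then f a else 0)" using inv assms(4) by blast
    then show ?thesis using \<open>f a = 1\<close> by simp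
  next
    case False
    then have "(\<Sum>b < c. f b) = 0" using az by (intro sum.neutral) auto
    then show ?thesis by simp
  qed
qed

lemma rk_nonneg:
  assumes "A \<in> ASM n" "i \<le> n" "c \<le> n"
  shows "0 \<le> rk A i c"
  unfolding rk_def
proof (rule sum_nonneg)
  fix a assume "a \<in> {..<i}"
  then show "0 \<le> (\<Sum>b < c. A $$ (a, b))"
    using assms by (intro alternating_partial_sum_nonneg[of n]) (auto simp: ASM_def)
qed

text \<open>Row 0 contributes 1 exactly when column j is counted, and the inserted column
  contributes nothing below. In the case j < c the subtraction c - 1 is not truncated.\<close>

lemma rk_asm_insert:
  assumes "i \<le> n" "c \<le> Suc n" "j \<le> n"
  shows "rk (asm_insert n A j) (Suc i) c = (if c \<le> j then rk A i c else rk A i (c - 1) + 1)"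
proof -
  have row0: "(\<Sum>b < c. asm_insert n A j $$ (0, b)) = (if c \<le> j then 0 else 1)" if "c \<le> Suc n" for c
    using that by (induction c) (auto simp: asm_insert_def)
  have row: "(\<Sum>b < c. asm_insert n A j $$ (Suc a, b)) =
      (if c \<le> j then \<Sum>b < c. A $$ (a, b) else \<Sum>b < c - 1. A $$ (a, b))" if "c \<le> Suc n" "a < n" for c a
    using that
  proof (induction c)
    case 0
    then show ?case by simp
  next
    case (Suc c)
    consider "c < j" | "c = j" | d where "c = Suc d" "j < c" by (cases c) force+
    then show ?case using Suc by cases (auto simp: asm_insert_def)
  qed
  have "rk (asm_insert n A j) (Suc i) c =
      (\<Sum>b < c. asm_insert n A j $$ (0, b)) + (\<Sum>a < i. \<Sum>b < c. asm_insert n A j $$ (Suc a, b))"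
    unfolding rk_def by (simp only: sum.lessThan_Suc_shift)
  also have "\<dots> = (if c \<le> j then 0 else 1) +
      (\<Sum>a < i. if c \<le> j then \<Sum>b < c. A $$ (a, b) else \<Sum>b < c - 1. A $$ (a, b))"
    using row0[OF assms(2)] row[OF assms(2)] assms(1) by (intro arg_cong2[of _ _ _ _ "(+)"] sum.cong) auto
  finally show ?thesis by (simp add: rk_def)
qed

lemma zdet_1: "zdet x (Suc 0) f g = x (f 0, g 0)"
  using zdet_laplace_row[of 0 0 x f g] by simp

section \<open>Substitutions removing and restoring the border\<close>

definition unborder :: "nat \<Rightarrow> nat \<times> nat \<Rightarrow> 'k::field zpoly" where
  "unborder j v = (if fst v = 0 then (if snd v = j then 1 else 0)
     else if snd v = j then 0 else zvar (fst v - 1, delete_index j (snd v)))"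

text \<open>As a substitution this is a right inverse of \<open>unborder\<close>, which gives
  surjectivity; modulo the border ideal it is also a left inverse, which gives the kernel.\<close>

definition reborder :: "nat \<Rightarrow> nat \<times> nat \<Rightarrow> 'k::field zpoly" where
  "reborder j v = zvar (Suc (fst v), insert_index j (snd v))"

lemma delete_index_less: "b \<noteq> j \<Longrightarrow> b < c \<Longrightarrow> j < c \<Longrightarrow> delete_index j b < c - 1"
  by (auto simp: delete_index_def)

lemma unborder_in_zring:
  assumes "a < Suc n" "b < Suc n" "j \<le> n"
  shows "unborder j (a, b) \<in> carrier (zring n)"
proof -
  have "delete_index j b < n" if "b \<noteq> j" using delete_index_less[OF that assms(2)] assms(3) by simp
  then show ?thesis
    using assms by (auto simp: unborder_def zring_zero zring_one intro!: zring_zvar)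
qed

lemma reborder_in_zring:
  "a < n \<Longrightarrow> b < n \<Longrightarrow> reborder j (a, b) \<in> carrier (zring (Suc n))"
  by (auto simp: reborder_def intro!: zring_zvar insert_index_less)

lemma unborder_reborder:
  "p \<in> carrier (zring n) \<Longrightarrow> zeval zconst (unborder j) (zeval zconst (reborder j) p) = p"
  by (induction p rule: zring_induct)
    (auto simp: zconst.zeval_single zeval_zvar[OF zconst.zeval_hom_axioms] zconst.zeval_add
      zconst.zeval_mult reborder_def unborder_def insert_index_neq)

lemma zeval_zdet: "zeval zconst x (zdet zvar k f g) = zdet x k f g"
proof -
  have "zeval zconst x \<circ> zvar = x" by (auto simp: zeval_zvar[OF zconst.zeval_hom_axioms])
  then show ?thesis using zdet_hom[OF zconst.hom.comm_ring_hom_axioms, of x zvar k f g] by simp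
qed

text \<open>L is the ideal reached after adjoining the whole border sequence; the aim is to
  recognize it as the preimage of \<open>asm_ideal n A\<close> under
  \<open>unborder\<close>.\<close>

locale bordered_asm =
  fixes n j :: nat and A :: "int mat" and L :: "'k::field zpoly set"
  assumes asm: "A \<in> ASM n" and j: "j \<le> n"
  defines "L \<equiv> foldl (adjoin (zring (Suc n))) (asm_ideal (Suc n) (asm_insert n A j)) (border_seq (Suc n) j)"
begin

lemma border_seq_in_zring: "set (border_seq (Suc n) j :: 'k zpoly list) \<subseteq> carrier (zring (Suc n))"
  using j by (auto simp: border_seq_def set_border_vars intro!: zring_minus zring_one zring_zvar)

sublocale L: zring_ideal "Suc n" L
  unfolding L_def
  by (rule zring_ideal.intro[OF foldl_adjoin_ideal[OF zring_cring asm_ideal_ideal border_seq_in_zring]])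

sublocale I: zring_ideal n "asm_ideal n A :: 'k zpoly set"
  by (rule zring_ideal.intro[OF asm_ideal_ideal])

lemma asm_ideal_le_L: "asm_ideal (Suc n) (asm_insert n A j) \<subseteq> L"
  and border_seq_in_L: "set (border_seq (Suc n) j) \<subseteq> L"
  unfolding L_def
  using foldl_adjoin_superset[OF zring_cring asm_ideal_ideal border_seq_in_zring] by blast+

lemma corner_in_L: "zvar (0, j) - 1 \<in> L"
  using border_seq_in_L by (simp add: border_seq_def)

lemma column_in_L: "1 \<le> a \<Longrightarrow> a \<le> n \<Longrightarrow> zvar (a, j) \<in> L"
  using border_seq_in_L by (auto simp: border_seq_def set_border_vars)

lemma row_in_L:
  assumes "b \<noteq> j" "b \<le> n"
  shows "zvar (0, b) \<in> L"
proof (cases "j < b")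
  case True
  then show ?thesis using border_seq_in_L assms by (auto simp: border_seq_def set_border_vars)
next
  case False
  \<comment> \<open>Rank 0 makes the 1 by 1 minors in these positions generators of the
    ideal.\<close>
  have "rk (asm_insert n A j) 1 (Suc b) = 0"
    using rk_asm_insert[of 0 n "Suc b" j A] assms j False by (auto simp: rk_def)
  then have "zdet zvar (Suc 0) (\<lambda>_. 0) (\<lambda>_. b) \<in> asm_ideal (Suc n) (asm_insert n A j)"
    using assms by (intro zdet_in_asm_ideal[of 1 _ "Suc b"]) auto
  then show ?thesis using asm_ideal_le_L by (auto simp: zdet_1)
qed

text \<open>For c <= j a generating minor of A is itself a generator in the larger matrix. For c > j
  the rank there is one higher, so the minor is first bordered by row 0 and column j; modulo L the
  bordered minor is w times the original one, and w is 1.\<close>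

lemma reborder_asm_ideal:
  assumes "p \<in> (asm_ideal n A :: 'k zpoly set)"
  shows "zeval zconst (reborder j) p \<in> L"
proof -
  let ?K = "{p \<in> carrier (zring n). zeval zconst (reborder j) p \<in> L}"
  have "ideal ?K (zring n)"
    by (rule zring_idealI)
      (auto simp: zconst.zeval_zero zconst.zeval_add zconst.zeval_mult
        intro: zring_closed L.L_zero L.L_add L.L_mult zeval_in_zring reborder_in_zring)
  then have "asm_ideal n A \<subseteq> ?K"
  proof (rule asm_ideal_least)
    fix i c k f g
    assume h: "1 \<le> i" "i \<le> n" "1 \<le> c" "c \<le> n" "k = nat (rk A i c) + 1" "inj_on f {..<k}" "inj_on g {..<k}"
      "\<And>p. p < k \<Longrightarrow> f p < i" "\<And>q. q < k \<Longrightarrow> g q < c"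
    let ?d = "zdet zvar k (Suc \<circ> f) (insert_index j \<circ> g) :: 'k zpoly"
    have carr: "(zdet zvar k f g :: 'k zpoly) \<in> carrier (zring n)"
      using h by (intro zdet_in_zring zring_zvar) (auto intro: less_le_trans)
    have e: "zeval zconst (reborder j) (zdet zvar k f g) = ?d"
      unfolding zeval_zdet by (rule zdet_cong) (simp add: reborder_def)
    have "?d \<in> L"
    proof (cases "c \<le> j")
      case True
      then have "rk (asm_insert n A j) (Suc i) c = rk A i c"
        using rk_asm_insert[of i n c j A] h j by simp
      moreover have "insert_index j (g q) < c" if "q < k" for q
        using h(9)[OF that] True by (simp add: insert_index_def)
      ultimately have "?d \<in> asm_ideal (Suc n) (asm_insert n A j)"
        using h by (intro zdet_in_asm_ideal[of "Suc i" _ c]) auto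
      then show ?thesis using asm_ideal_le_L by blast
    next
      case False
      \<comment> \<open>Row 0 and column j are put first, whatever j is, so that the corner sits at
        position (0, 0) and its cofactor carries no sign.\<close>
      define f' where "f' = case_nat 0 (Suc \<circ> f)"
      define g' where "g' = case_nat j (insert_index j \<circ> g)"
      let ?D = "zdet zvar (Suc k) f' g' :: 'k zpoly"
      have f': "f' p < Suc i" if "p < Suc k" for p
        using that h(8) by (auto simp: f'_def split: nat.split)
      have g': "g' q < Suc c" if "q < Suc k" for q
        using that h(9) insert_index_less[of _ c j] False by (auto simp: g'_def split: nat.split)
      have "rk (asm_insert n A j) (Suc i) (Suc c) = rk A i c + 1"
        using rk_asm_insert[of i n "Suc c" j A] h j False by simp
      \<comment> \<open>Nonnegativity of the rank is essential: for a negative value, adding 1 would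
        not commute with \<open>nat\<close>.\<close>
      then have "Suc k = nat (rk (asm_insert n A j) (Suc i) (Suc c)) + 1"
        using h(5) rk_nonneg[OF asm h(2,4)] by simp
      then have D: "?D \<in> L"
        using h f' g' by (intro subsetD[OF asm_ideal_le_L] zdet_in_asm_ideal[of "Suc i" _ "Suc c"]) auto
      let ?m = "\<lambda>q. (- 1) ^ q * zdet zvar k (f' \<circ> insert_index 0) (g' \<circ> insert_index q) :: 'k zpoly"
      \<comment> \<open>Expansion along row 0: every entry except the corner is in L by
        \<open>row_in_L\<close>.\<close>
      have "?D = zvar (0, j) * ?m 0 + (\<Sum>q < k. zvar (0, insert_index j (g q)) * ?m (Suc q))"
        using zdet_laplace_row[of 0 k "zvar :: _ \<Rightarrow> 'k zpoly" f' g']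
        by (simp add: sum.lessThan_Suc_shift f'_def g'_def del: sum.lessThan_Suc)
      moreover have "?m 0 = ?d"
        by simp (rule zdet_cong, simp add: f'_def g'_def insert_index_def)
      ultimately have De: "zvar (0, j) * ?d = ?D - (\<Sum>q < k. zvar (0, insert_index j (g q)) * ?m (Suc q))"
        by simp
      have "(\<Sum>q < k. zvar (0, insert_index j (g q)) * ?m (Suc q)) \<in> L"
      proof (rule L.L_sum)
        fix q assume q: "q \<in> {..<k}"
        have "insert_index j (g q) \<le> n" using insert_index_less[OF h(9), of q j] q h(4) by auto
        then have z: "zvar (0, insert_index j (g q)) \<in> L" using insert_index_neq row_in_L by auto
        have "?m (Suc q) \<in> carrier (zring (Suc n))"
        proof (intro zring_mult zring_power zring_uminus zring_one zdet_in_zring)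
          fix p q' assume "p < k" "q' < k"
          then have "f' (insert_index 0 p) < Suc i" "g' (insert_index (Suc q) q') < Suc c"
            using f' g' insert_index_less by blast+
          then show "zvar ((f' \<circ> insert_index 0) p, (g' \<circ> insert_index (Suc q)) q') \<in> carrier (zring (Suc n))"
            using h(2,4) by (intro zring_zvar) auto
        qed
        from L.L_mult[OF this z] show "zvar (0, insert_index j (g q)) * ?m (Suc q) \<in> L"
          by (simp add: mult.commute)
      qed
      then have "zvar (0, j) * ?d \<in> L" unfolding De using D by (intro L.L_diff)
      moreover have "?d * (zvar (0, j) - 1) \<in> L"
        unfolding e[symmetric]
        by (intro L.L_mult corner_in_L zeval_in_zring[OF carr] reborder_in_zring)
      \<comment> \<open>The minor is recovered as d = w d - d (w - 1).\<close>
      ultimately have "zvar (0, j) * ?d - ?d * (zvar (0, j) - 1) \<in> L" by (rule L.L_diff)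
      then show ?thesis by (simp add: algebra_simps)
    qed
    then show "zdet zvar k f g \<in> ?K" using carr e by simp
  qed
  then show ?thesis using assms by blast
qed

lemma unborder_vimage_ideal:
  "ideal {p \<in> carrier (zring (Suc n)). zeval zconst (unborder j) p \<in> (asm_ideal n A :: 'k zpoly set)} (zring (Suc n))"
  by (rule zring_idealI)
    (use j in \<open>auto simp: zconst.zeval_zero zconst.zeval_add zconst.zeval_mult
      intro: zring_closed I.L_zero I.L_add I.L_mult zeval_in_zring unborder_in_zring\<close>)

text \<open>After the substitution row 0 is a unit vector at column j, and column j is 0 below it.
  For c <= j a minor through row 0 vanishes, and the others are minors for A of the same size. For c
  > j the size required for A is one smaller, and Laplace expansion reaches it unless the minor
  meets column j but not row 0, when it vanishes.\<close>

lemma unborder_asm_ideal: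
  assumes "p \<in> (asm_ideal (Suc n) (asm_insert n A j) :: 'k zpoly set)"
  shows "zeval zconst (unborder j) p \<in> asm_ideal n A"
proof -
  let ?K = "{p \<in> carrier (zring (Suc n)). zeval zconst (unborder j) p \<in> (asm_ideal n A :: 'k zpoly set)}"
  have "asm_ideal (Suc n) (asm_insert n A j) \<subseteq> ?K"
  proof (rule asm_ideal_least[OF unborder_vimage_ideal])
    fix i c k f g
    assume h: "1 \<le> i" "i \<le> Suc n" "1 \<le> c" "c \<le> Suc n" "k = nat (rk (asm_insert n A j) i c) + 1"
      "inj_on f {..<k}" "inj_on g {..<k}" "\<And>p. p < k \<Longrightarrow> f p < i" "\<And>q. q < k \<Longrightarrow> g q < c"
    obtain i' where i': "i = Suc i'" using h(1) by (cases i) auto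
    have i'n: "i' \<le> n" using i' h(2) by simp
    have carr: "(zdet zvar k f g :: 'k zpoly) \<in> carrier (zring (Suc n))"
      using h by (intro zdet_in_zring zring_zvar) (auto intro: less_le_trans)
    have "zdet (unborder j) k f g \<in> (asm_ideal n A :: 'k zpoly set)"
    proof (cases "c \<le> j")
      case True
      have gj: "g q < j" if "q < k" for q using h(9)[OF that] True by simp
      show ?thesis
      proof (cases "\<exists>p0 < k. f p0 = 0")
        case True
        then obtain p0 where p0: "p0 < k" "f p0 = 0" by blast
        have "zdet (unborder j) k f g = (0 :: 'k zpoly)"
          using gj p0 by (intro zdet_zero_row[OF p0(1)]) (force simp: unborder_def)
        then show ?thesis using I.L_zero by simp
      next
        case False
        then have f: "1 \<le> f p" "f p - 1 < i'" if "p < k" for p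
          using that h(8)[OF that] i' by (auto simp: Suc_le_eq)
        have "zdet (unborder j) k f g = (zdet zvar k (\<lambda>p. f p - 1) g :: 'k zpoly)"
        proof (rule zdet_cong)
          fix p q assume "p < k" "q < k"
          then show "unborder j (f p, g q) = zvar (f p - 1, g q)"
            using f[of p] gj[of q] by (auto simp: unborder_def delete_index_def)
        qed
        \<comment> \<open>Because k >= 1, some row below row 0 is used; this excludes i = 1, where
          no row would be left.\<close>
        moreover have "1 \<le> i'" using f(2)[of 0] h(5) by auto
        moreover have "k = nat (rk A i' c) + 1" using h(5) rk_asm_insert[OF i'n h(4) j] True i' by (simp add: \<open>c \<le> j\<close>)
        ultimately show ?thesis
          using zdet_in_asm_ideal[of i' n c k A "\<lambda>p. f p - 1" g, where 'k = 'k] f(2) h(3,9) i'n \<open>c \<le> j\<close> j by simp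
      qed
    next
      case False
      then have cj: "j < c" by simp
      define m where "m = nat (rk A i' (c - 1)) + 1"
      have k: "k = Suc m"
      proof -
        have "c - 1 \<le> n" using h(4) by simp
        from rk_nonneg[OF asm i'n this] show ?thesis
          using h(5) rk_asm_insert[OF i'n h(4) j, of A] False i' by (simp add: m_def nat_add_distrib)
      qed
      have minor: "zdet (unborder j) m f' g' \<in> (asm_ideal n A :: 'k zpoly set)"
        if f': "\<And>p. p < m \<Longrightarrow> f' p < i \<and> f' p \<noteq> 0" and g': "\<And>q. q < m \<Longrightarrow> g' q < c \<and> g' q \<noteq> j" for f' g'
      proof -
        have "zdet (unborder j) m f' g' = (zdet zvar m (\<lambda>p. f' p - 1) (delete_index j \<circ> g') :: 'k zpoly)"
        proof (rule zdet_cong)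
          fix p q assume "p < m" "q < m"
          then show "unborder j (f' p, g' q) = zvar (f' p - 1, (delete_index j \<circ> g') q)"
            using f'[of p] g'[of q] by (simp add: unborder_def)
        qed
        moreover have d: "delete_index j (g' q) < c - 1" if "q < m" for q
          using delete_index_less g'[OF that] cj by blast
        moreover have f1: "f' p - 1 < i'" if "p < m" for p using f'[OF that] i' by auto
        moreover have "1 \<le> i'" "1 \<le> c - 1" using f1[of 0] d[of 0] by (auto simp: m_def)
        ultimately show ?thesis
          using zdet_in_asm_ideal[of i' n "c - 1" m A "\<lambda>p. f' p - 1" "delete_index j \<circ> g'", where 'k = 'k]
            i'n h(4) by (simp add: m_def)
      qed
      \<comment> \<open>The condition on columns is imposed only for nonzero entries of the expanded
        row: in the expansion along row 0, only the term of column j survives, and deleting it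
        removes column j from the minor.\<close>
      have expand: "zdet (unborder j) k f g \<in> (asm_ideal n A :: 'k zpoly set)"
        if p0: "p0 < k" and nz: "\<And>p. p < k \<Longrightarrow> p \<noteq> p0 \<Longrightarrow> f p \<noteq> 0"
          and cols: "\<And>q q'. q < k \<Longrightarrow> q' < k \<Longrightarrow> q' \<noteq> q \<Longrightarrow> unborder j (f p0, g q) \<noteq> (0 :: 'k zpoly) \<Longrightarrow> g q' \<noteq> j" for p0
        unfolding k zdet_laplace_row[OF p0[unfolded k]]
      proof (rule I.L_sum)
        fix q assume q: "q \<in> {..<Suc m}"
        let ?u = "unborder j (f p0, g q) :: 'k zpoly" and ?s = "(- 1) ^ (p0 + q) :: 'k zpoly"
        let ?e = "zdet (unborder j) m (f \<circ> insert_index p0) (g \<circ> insert_index q) :: 'k zpoly"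
        show "?u * (?s * ?e) \<in> asm_ideal n A"
        proof (cases "?u = 0")
          case True
          then show ?thesis using I.L_zero by simp
        next
          case False
          have "?e \<in> asm_ideal n A"
          proof (rule minor)
            show "(f \<circ> insert_index p0) p < i \<and> (f \<circ> insert_index p0) p \<noteq> 0" if "p < m" for p
              using h(8) nz insert_index_less[OF that, of p0] insert_index_neq[of p0 p] k by simp
            show "(g \<circ> insert_index q) q' < c \<and> (g \<circ> insert_index q) q' \<noteq> j" if "q' < m" for q'
              using h(9) cols[of q "insert_index q q'"] False q insert_index_less[OF that, of q] insert_index_neq[of q q'] k by simp
          qed
          moreover have "?u \<in> carrier (zring n)"
            using h(8)[OF p0] h(9)[of q] q k h(2,4) j by (intro unborder_in_zring) auto
          ultimately show ?thesis
            by (intro I.L_mult zring_power zring_uminus zring_one)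
        qed
      qed
      show ?thesis
      proof (cases "\<exists>p0 < k. f p0 = 0")
        case True
        then obtain p0 where p0: "p0 < k" "f p0 = 0" by blast
        show ?thesis
        proof (rule expand[OF p0(1)])
          show "f p \<noteq> 0" if "p < k" "p \<noteq> p0" for p
            using inj_onD[OF h(6), of p p0] p0 that by auto
          show "g q' \<noteq> j" if "q < k" "q' < k" "q' \<noteq> q" "unborder j (f p0, g q) \<noteq> (0 :: 'k zpoly)" for q q'
            using inj_onD[OF h(7), of q' q] p0 that by (auto simp: unborder_def split: if_splits)
        qed
      next
        case nz: False
        show ?thesis
        proof (cases "\<exists>q0 < k. g q0 = j")
          case True
          then obtain q0 where q0: "q0 < k" "g q0 = j" by blast
          have "zdet (unborder j) k f g = (0 :: 'k zpoly)"
            using nz q0 by (intro zdet_zero_col[OF q0(1)]) (auto simp: unborder_def)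
          then show ?thesis using I.L_zero by simp
        next
          case False
          \<comment> \<open>With neither row 0 nor column j present any row will do; a minor of size
            m + 1 lies in the ideal of minors of size m.\<close>
          then show ?thesis using nz k by (intro expand[of 0]) auto
        qed
      qed
    qed
    then show "zdet zvar k f g \<in> ?K" using carr by (simp add: zeval_zdet)
  qed
  then show ?thesis using assms by blast
qed

text \<open>The composite substitution agrees with the identity modulo L on each variable: the
  corner, the rest of row 0 and the rest of column j are covered by elements of L, and the remaining
  variables are fixed.\<close>

lemma reborder_unborder:
  assumes "p \<in> carrier (zring (Suc n))"
  shows "p - zeval zconst (reborder j) (zeval zconst (unborder j) p) \<in> L"
  using assms
proof (induction p rule: zring_induct)
  case (zconst a)
  then show ?case by (simp add: zconst.zeval_single L.L_zero)
next
  case (zvar a b)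
  note eval = zeval_zvar[OF zconst.zeval_hom_axioms]
  consider "a = 0" "b = j" | "a = 0" "b \<noteq> j" | "a \<noteq> 0" "b = j" | "a \<noteq> 0" "b \<noteq> j" by blast
  then show ?case
  proof cases
    case 1
    then show ?thesis using corner_in_L by (simp add: eval unborder_def zconst.zeval_one)
  next
    case 2
    then show ?thesis using row_in_L zvar by (simp add: eval unborder_def zconst.zeval_zero)
  next
    case 3
    then show ?thesis using column_in_L[of a] zvar by (simp add: eval unborder_def zconst.zeval_zero)
  next
    case 4
    then show ?thesis
      by (simp add: eval unborder_def reborder_def insert_delete_index L.L_zero)
  qed
next
  case (add p q)
  have "p + q - zeval zconst (reborder j) (zeval zconst (unborder j) (p + q)) =
    (p - zeval zconst (reborder j) (zeval zconst (unborder j) p)) +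
    (q - zeval zconst (reborder j) (zeval zconst (unborder j) q))"
    by (simp add: zconst.zeval_add)
  then show ?case using L.L_add[OF add.IH] by (simp only:)
next
  case (mult p q)
  let ?r = "\<lambda>p. zeval zconst (reborder j) (zeval zconst (unborder j) p)"
  \<comment> \<open>Congruence modulo L is multiplicative; the product difference is split so that
    each summand has a factor covered by the induction hypothesis.\<close>
  have "p * q - ?r (p * q) = p * (q - ?r q) + ?r q * (p - ?r p)"
    by (simp add: zconst.zeval_mult algebra_simps)
  moreover have "?r q \<in> carrier (zring (Suc n))"
    using mult.hyps(2) j by (intro zeval_in_zring[of _ n] zeval_in_zring[of _ "Suc n"] unborder_in_zring reborder_in_zring)
  ultimately show ?case using L.L_add[OF L.L_mult[OF mult.hyps(1) mult.IH(2)] L.L_mult[OF _ mult.IH(1)]] by simp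
qed

text \<open>If the image of p lies in \<open>asm_ideal n A\<close>, its reborder lies in L and
  differs from p by an element of L. The other inclusion is checked on generators.\<close>

lemma unborder_kernel:
  "{p \<in> carrier (zring (Suc n)). zeval zconst (unborder j) p \<in> (asm_ideal n A :: 'k zpoly set)} = L"
proof (intro subset_antisym subsetI)
  fix p assume "p \<in> {p \<in> carrier (zring (Suc n)). zeval zconst (unborder j) p \<in> (asm_ideal n A :: 'k zpoly set)}"
  then have p: "p \<in> carrier (zring (Suc n))" "zeval zconst (unborder j) p \<in> (asm_ideal n A :: 'k zpoly set)" by auto
  from L.L_add[OF reborder_unborder[OF p(1)] reborder_asm_ideal[OF p(2)]] show "p \<in> L" by simp
next
  let ?K = "{p \<in> carrier (zring (Suc n)). zeval zconst (unborder j) p \<in> (asm_ideal n A :: 'k zpoly set)}"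
  have "L \<subseteq> ?K"
    unfolding L_def
  proof (rule foldl_adjoin_least[OF zring_cring unborder_vimage_ideal])
    show "asm_ideal (Suc n) (asm_insert n A j) \<subseteq> ?K"
      using unborder_asm_ideal ideal_carrier[OF asm_ideal_ideal] by blast
    have "zeval zconst (unborder j) q = 0" if "q \<in> set (border_seq (Suc n) j)" for q :: "'k zpoly"
      using that
      by (auto simp: border_seq_def set_border_vars zconst.hom.hom_minus
          zeval_zvar[OF zconst.zeval_hom_axioms] unborder_def zconst.zeval_one)
    then show "set (border_seq (Suc n) j) \<subseteq> ?K" using border_seq_in_zring I.L_zero by auto
  qed
  then show "p \<in> ?K" if "p \<in> L" for p using that by blast
qed

lemma unborder_ring_hom: "zeval zconst (unborder j) \<in> Ring.ring_hom (zring (Suc n)) (zring n)"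
  by (rule ring_hom_memI)
    (use j in \<open>auto simp: zconst.zeval_add zconst.zeval_mult zconst.zeval_one intro: zeval_in_zring unborder_in_zring\<close>)

text \<open>The map is \<open>unborder\<close> followed by reduction modulo
  \<open>asm_ideal n A\<close>; its kernel is L, so the border sequence is exactly the list of
  regular elements divided out.\<close>

lemma cohen_macaulay_unborder:
  assumes "cohen_macaulay_ring (zring (Suc n) Quot (asm_ideal (Suc n) (asm_insert n A j) :: 'k zpoly set))"
  shows "cohen_macaulay_ring (zring n Quot (asm_ideal n A :: 'k zpoly set))"
proof -
  let ?I = "asm_ideal n A :: 'k zpoly set"
  let ?f = "(+>\<^bsub>zring n\<^esub>) ?I \<circ> zeval zconst (unborder j)"
  interpret R: cring "zring n :: 'k zpoly ring" by (rule zring_cring)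
  interpret id: ideal ?I "zring n" by (rule asm_ideal_ideal)
  show ?thesis
  proof (rule cohen_macaulay_quot_regular_list[OF zring_cring id.quotient_is_cring[OF zring_cring]
        _ _ asm_ideal_ideal assms, of ?f "border_seq (Suc n) j"])
    show "?f \<in> Ring.ring_hom (zring (Suc n)) (zring n Quot ?I)"
      by (rule ring_hom_trans[OF unborder_ring_hom id.rcos_ring_hom])
    show "?f ` carrier (zring (Suc n)) = carrier (zring n Quot ?I)"
    proof (intro subset_antisym subsetI)
      fix X assume "X \<in> ?f ` carrier (zring (Suc n))"
      then show "X \<in> carrier (zring n Quot ?I)"
        using ring_hom_closed[OF ring_hom_trans[OF unborder_ring_hom id.rcos_ring_hom]] by blast
    next
      fix X assume "X \<in> carrier (zring n Quot ?I)"
      then obtain r where r: "r \<in> carrier (zring n)" "X = ?I +>\<^bsub>zring n\<^esub> r"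
        unfolding FactRing_def A_RCOSETS_def' by auto
      have "X = ?f (zeval zconst (reborder j) r)" using r unborder_reborder[OF r(1)] by simp
      moreover have "zeval zconst (reborder j) r \<in> carrier (zring (Suc n))"
        using r(1) by (rule zeval_in_zring) (rule reborder_in_zring)
      ultimately show "X \<in> ?f ` carrier (zring (Suc n))" by blast
    qed
    show "border_seq (Suc n) j \<noteq> ([] :: 'k zpoly list)" by (simp add: border_seq_def)
    show "regular_list (zring (Suc n)) (asm_ideal (Suc n) (asm_insert n A j) :: 'k zpoly set) (border_seq (Suc n) j)"
      using j by (intro regular_list_border_seq) simp
    have z: "\<zero>\<^bsub>zring n Quot ?I\<^esub> = ?I" unfolding FactRing_def by simp
    have "?I +>\<^bsub>zring n\<^esub> r = ?I \<longleftrightarrow> r \<in> ?I" if "r \<in> carrier (zring n)" for r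
      using that id.rcos_const_imp_mem R.a_rcos_zero[OF asm_ideal_ideal] by blast
    then have "{p \<in> carrier (zring (Suc n)). ?f p = \<zero>\<^bsub>zring n Quot ?I\<^esub>} =
        {p \<in> carrier (zring (Suc n)). zeval zconst (unborder j) p \<in> ?I}"
      unfolding z using ring_hom_closed[OF unborder_ring_hom] by auto
    then show "{p \<in> carrier (zring (Suc n)). ?f p = \<zero>\<^bsub>zring n Quot ?I\<^esub>} =
        foldl (adjoin (zring (Suc n))) (asm_ideal (Suc n) (asm_insert n A j)) (border_seq (Suc n) j)"
      unfolding unborder_kernel unfolding L_def .
  qed
qed

end

theorem theorem3p13:
  fixes A :: "int mat" and n j :: nat
  assumes "A \<in> ASM n"
    and "j < n + 1"
    and "cohen_macaulay_asm TYPE('k::field) (n + 1) (asm_insert n A j)"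
  shows "cohen_macaulay_asm TYPE('k) n A"
proof -
  have "bordered_asm n j A" using assms(1,2) by unfold_locales auto
  from bordered_asm.cohen_macaulay_unborder[OF this, where 'k = 'k] show ?thesis
    using assms(3) by (simp add: cohen_macaulay_asm_def)
qed

end
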